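(* Let $k$ and $p$ be positive integers with $k\ge 2p+1$, and write $k=s(p+1)+r$ with integers $s\ge 1$ and $0\le r<p+1$. Suppose $r\neq 0$, and let $m\ge 0$ and $1\le t\le s$ be the unique integers satisfying $r=ms+t$. Then for all sufficiently large $n$, $$\mathrm{EX}(n,C_k^p)=\{K_{t-1}\vee T_{n-t+1,\,p+m+1}\}$$ (up to isomorphism).
   Context: All graphs are finite, simple and undirected. $C_k$ is the cycle on $k$ vertices, and $C_k^p$ (its $p$-th power) is the graph on the same vertices in which two distinct vertices are adjacent iff their distance in $C_k$ is at most $p$. A graph is $F$-free if it contains no subgraph (not necessarily induced) isomorphic to $F$. $\mathrm{ex}(n,F)$ is the maximum number of edges $e(G)$ of an $n$-vertex $F$-free graph $G$, and $\mathrm{EX}(n,F)$ is the set of $n$-vertex $F$-free graphs $G$ with $e(G)=\mathrm{ex}(n,F)$. $K_a$ is the complete graph on $a$ vertices ($K_0$ is the empty graph). $T_{n,q}$ is the $q$-partite Turán graph: the complete $q$-partite graph on $n$ vertices with part sizes pairwise differing by at most $1$. $G\vee H$ (join) is obtained from the disjoint union of $G$ and $H$ by adding all edges between $V(G)$ and $V(H)$. *)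

theory Defs
  imports Complex_Main "HOL-Library.Extended_Nat"
begin

type_synonym 'a graph = "'a set \<times> 'a set set"

abbreviation verts :: "'a graph \<Rightarrow> 'a set" where
  "verts G \<equiv> fst G"

abbreviation edges :: "'a graph \<Rightarrow> 'a set set" where
  "edges G \<equiv> snd G"

definition simple_graph :: "'a graph \<Rightarrow> bool" where
  "simple_graph G \<longleftrightarrow> finite (verts G) \<and> (\<forall>e\<in>edges G. e \<subseteq> verts G \<and> card e = 2)"

definition subgraph :: "'a graph \<Rightarrow> 'a graph \<Rightarrow> bool" where
  "subgraph H G \<longleftrightarrow> simple_graph H \<and> verts H \<subseteq> verts G \<and> edges H \<subseteq> edges G"

text \<open>Meaningful for simple graphs; the two vertex types may differ.\<close>

definition graph_iso :: "'a graph \<Rightarrow> 'b graph \<Rightarrow> bool" where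
  "graph_iso G H \<longleftrightarrow>
     (\<exists>f. bij_betw f (verts G) (verts H) \<and> edges H = (\<lambda>e. f ` e) ` edges G)"

definition free_of :: "'b graph \<Rightarrow> 'a graph \<Rightarrow> bool" where
  "free_of F G \<longleftrightarrow> \<not> (\<exists>H. subgraph H G \<and> graph_iso H F)"

text \<open>
  Every finite graph is isomorphic to one with vertices in \<^typ>\<open>nat\<close>, so it suffices to let the
  host graphs range over graphs whose vertex set is any \<open>n\<close>-element set of naturals.
\<close>

definition free_graphs :: "nat \<Rightarrow> 'b graph \<Rightarrow> nat graph set" where
  "free_graphs n F = {G. simple_graph G \<and> card (verts G) = n \<and> free_of F G}"

definition ex_number :: "nat \<Rightarrow> 'b graph \<Rightarrow> nat" where
  "ex_number n F = Max ((\<lambda>G. card (edges G)) ` free_graphs n F)"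

text \<open>
  \<open>EX(n,F)\<close>, as an isomorphism-closed set of graphs on natural numbers.
\<close>

definition extremal_graphs :: "nat \<Rightarrow> 'b graph \<Rightarrow> nat graph set" where
  "extremal_graphs n F = {G \<in> free_graphs n F. card (edges G) = ex_number n F}"

text \<open>The number of edges of a shortest walk; \<open>\<infinity>\<close> if there is none.\<close>

definition graph_dist :: "'a graph \<Rightarrow> 'a \<Rightarrow> 'a \<Rightarrow> enat" where
  "graph_dist G u v = Inf {enat l | l. (u, v) \<in> {(x, y). {x, y} \<in> edges G} ^^ l}"

definition graph_power :: "'a graph \<Rightarrow> nat \<Rightarrow> 'a graph" where
  "graph_power G p =
     (verts G, {{u, v} | u v. u \<in> verts G \<and> v \<in> verts G \<and> u \<noteq> v \<and> graph_dist G u v \<le> enat p})"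

text \<open>Only intended for \<open>k \<ge> 3\<close>.\<close>

definition cycle_graph :: "nat \<Rightarrow> nat graph" where
  "cycle_graph k = ({..<k}, {{i, Suc i mod k} | i. i < k})"

definition complete_graph :: "nat \<Rightarrow> nat graph" where
  "complete_graph a = ({..<a}, {{u, v} | u v. u < a \<and> v < a \<and> u \<noteq> v})"

definition graph_join :: "'a graph \<Rightarrow> 'b graph \<Rightarrow> ('a + 'b) graph" where
  "graph_join G H =
     (verts G <+> verts H,
      (\<lambda>e. Inl ` e) ` edges G \<union> (\<lambda>e. Inr ` e) ` edges H \<union>
      {{Inl u, Inr v} | u v. u \<in> verts G \<and> v \<in> verts H})"

text \<open>The complete multipartite graph on \<open>V\<close> whose parts are the fibres of \<open>c\<close>.\<close>

definition complete_multipartite :: "'a set \<Rightarrow> ('a \<Rightarrow> 'c) \<Rightarrow> 'a graph" where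
  "complete_multipartite V c = (V, {{u, v} | u v. u \<in> V \<and> v \<in> V \<and> c u \<noteq> c v})"

text \<open>
  Distributing the vertices among the \<open>q\<close> parts by residue modulo \<open>q\<close> makes the part sizes
  differ by at most one, see \<open>turan_graph_balanced\<close> below.
\<close>

definition turan_graph :: "nat \<Rightarrow> nat \<Rightarrow> nat graph" where
  "turan_graph n q = complete_multipartite {..<n} (\<lambda>v. v mod q)"

lemma turan_graph_balanced:
  fixes n q i j :: nat
  assumes "i < q" and "j < q"
  shows "card {v \<in> {..<n}. v mod q = i} \<le> card {v \<in> {..<n}. v mod q = j} + 1"
proof -
  let ?A = "{v \<in> {..<n}. v mod q = i}" and ?B = "{v \<in> {..<n}. v mod q = j}"
  define f :: "nat \<Rightarrow> nat" where "f v = j + q * (v div q - 1)" for v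
  have div_eq: "(i + q * Suc a) div q - 1 = a" for a
  proof -
    have "(i + q * Suc a) div q = Suc a"
      using div_mult_self2[of q i "Suc a"] assms(1) by simp
    then show ?thesis by simp
  qed
  have *: "\<exists>a. v = i + q * Suc a" if "v \<in> ?A - {i}" for v
  proof -
    have "v = i + q * (v div q)"
      using that mod_mult_div_eq[of v q] by simp
    moreover have "v div q \<noteq> 0"
    proof
      assume "v div q = 0"
      with calculation have "v = i" by simp
      with that show False by simp
    qed
    ultimately show ?thesis by (cases "v div q") auto
  qed
  have "card (?A - {i}) \<le> card ?B"
  proof (rule card_inj_on_le)
    show "inj_on f (?A - {i})"
    proof (rule inj_onI)
      fix v w assume vw: "v \<in> ?A - {i}" "w \<in> ?A - {i}" "f v = f w"
      obtain a b where ab: "v = i + q * Suc a" "w = i + q * Suc b"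
        using *[OF vw(1)] *[OF vw(2)] by blast
      then have "f v = j + q * a" "f w = j + q * b"
        by (simp_all only: f_def div_eq)
      with vw(3) assms ab show "v = w" by simp
    qed
    show "f ` (?A - {i}) \<subseteq> ?B"
    proof
      fix x assume "x \<in> f ` (?A - {i})"
      then obtain v where v: "v \<in> ?A - {i}" "x = f v" by blast
      obtain a where a: "v = i + q * Suc a" using *[OF v(1)] by blast
      have "v div q - 1 = a" unfolding a by (rule div_eq)
      then have x: "x = j + q * a" using v(2) by (simp add: f_def)
      have "q * Suc a < n" using a v(1) by simp
      then have "x < n" using x assms by simp
      with x assms show "x \<in> ?B" by simp
    qed
  qed simp
  moreover have "card ?A - 1 \<le> card (?A - {i})"
    using diff_card_le_card_Diff[of "{i}" ?A] by simp
  ultimately show ?thesis by linarith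
qed

end

(* C_k^p has chromatic number q + 1, where q = p + m + 1 and k = s q + t: cutting the cycle into blocks
   gives a q-colouring with t disjoint conflicting edges, while t - 1 deleted vertices leave more than
   s q vertices and independent sets have at most s. The argument is that of Simonovits.

   As long as some degree is below the minimum degree of K_{t-1} v T, delete such a vertex; the excess
   of edges then grows and cannot persist. So assume all degrees are at least about (1 - 1/q) n. A large
   complete q-partite subgraph exists (Erdos-Stone), and counting edges into it yields q independent
   sets of size about n/q that are almost completely joined to each other. The vertices with many
   neighbours in each of these sets are exceptional. Choosing common neighbourhood types class by class
   shows that t of them would complete a copy of C_k^p, unless their degree sum is too small for the
   number of edges. Hence there are exactly t - 1 of them, each adjacent to almost everything, the
   remaining classes are independent, and comparing degree sums with those of the Turan graph leaves
   only K_{t-1} v T. *)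

theory Submission
  imports Defs
begin

section \<open>Graphs as neighbourhood functions\<close>

text \<open>The core is one implication: for large n, a graph without a configuration whose degree
  sum reaches that of K_{t-1} v T is K_{t-1} v T. It yields the extremal number and the uniqueness
  together. All that it uses of C_k^p is that it embeds into every configuration. The obstacle is
  the exceptional vertices: each has g neighbours in every class, but t of them need not have common
  ones. Sorting the classes by their neighbourhoods in a set of c exceptional vertices costs a
  factor 2^c, so c has to be bounded first. Hence two rounds: the minimum degree alone rules out q t
  exceptional vertices, and only then does the edge count reduce their number to t - 1. Both rounds
  compare terms linear in n, with a margin of a single n, so every error must be a small fraction of
  n. The vertices discarded while the classes are built are only bounded by such a fraction, so the
  defect d of the classes is not a constant: it is at most n / E, with E chosen in advance.
  Inequalities involving n / q are kept multiplied by q, in natural numbers or integers.\<close>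

lemma pigeonhole_fibre:
  assumes "finite W" "finite T" "f ` W \<subseteq> T" "L * card T < card W"
  shows "\<exists>y\<in>T. L < card {x \<in> W. f x = y}"
proof (rule ccontr)
  assume "\<not> ?thesis"
  then have "card {x \<in> W. f x = y} \<le> L" if "y \<in> T" for y using that by (meson not_le)
  then have "(\<Sum>y\<in>T. card {x \<in> W. f x = y}) \<le> card T * L"
    using sum_bounded_above[of T "\<lambda>y. card {x \<in> W. f x = y}" L] by simp
  moreover have "card W = (\<Sum>y\<in>T. card {x \<in> W. f x = y})"
    using sum.group[of W T f "\<lambda>_. 1::nat"] assms by simp
  ultimately show False using assms(4) by (simp add: mult.commute)
qed

text \<open>A greedy case of Hall's theorem: when \<open>R v\<close> is reached, fewer than
  \<open>card T\<close> elements are taken. It supplies the second endpoints of matchings.\<close>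

lemma distinct_representatives:
  assumes "finite T" "\<And>v. v \<in> T \<Longrightarrow> finite (R v) \<and> card T \<le> card (R v)"
  shows "\<exists>w. inj_on w T \<and> (\<forall>v\<in>T. w v \<in> R v)"
  using assms
proof (induction T rule: finite_induct)
  case (insert x T)
  have "finite (R v) \<and> card T \<le> card (R v)" if "v \<in> T" for v
    using insert.prems[of v] insert.hyps that by auto
  then obtain w where w: "inj_on w T" "\<forall>v\<in>T. w v \<in> R v" using insert.IH by blast
  have "card (w ` T) < card (R x)" using insert.prems[of x] insert.hyps
    by (metis Suc_le_eq card_image card_insert_disjoint insertI1 w(1))
  then obtain y where y: "y \<in> R x" "y \<notin> w ` T"
    by (meson card_mono finite_imageI insert.hyps(1) linorder_not_le subsetI)
  have "inj_on (w(x := y)) (insert x T)"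
    using w(1) y(2) insert.hyps(2) by (auto simp: inj_on_def)
  then show ?case using w y insert.hyps(2) by (intro exI[of _ "w(x := y)"] conjI) (assumption, auto)
qed simp

text \<open>Since \<open>N\<close> is total, \<open>N_subset\<close> and \<open>N_sym\<close>
  together force \<open>N v\<close> to be empty for \<open>v\<close> outside \<open>V\<close>. Edge
  numbers appear only as degree sums, which behave well under deletion of a vertex.\<close>

locale sgraph =
  fixes V :: "'a set" and N :: "'a \<Rightarrow> 'a set"
  assumes finite_V [simp]: "finite V"
    and N_subset: "N v \<subseteq> V"
    and N_sym: "u \<in> N v \<Longrightarrow> v \<in> N u"
    and N_irrefl [simp]: "v \<notin> N v"
begin

lemma finite_N [simp]: "finite (N v)"
  using N_subset finite_V by (rule finite_subset)

lemma N_in_V: "u \<in> N v \<Longrightarrow> u \<in> V \<and> v \<in> V"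
  using N_subset N_sym by blast

lemma sum_card_N_swap:
  assumes "finite S" "finite T"
  shows "(\<Sum>v\<in>S. card (N v \<inter> T)) = (\<Sum>v\<in>T. card (N v \<inter> S))"
proof -
  have *: "card (N v \<inter> X) = (\<Sum>u\<in>X. if u \<in> N v then 1 else 0)" if "finite X" for v X
    using that by (simp add: sum.If_cases Int_commute)
  have "(\<Sum>v\<in>S. card (N v \<inter> T)) = (\<Sum>v\<in>S. \<Sum>u\<in>T. if u \<in> N v then 1 else 0)"
    using * assms by simp
  also have "\<dots> = (\<Sum>u\<in>T. \<Sum>v\<in>S. if u \<in> N v then 1 else 0)" by (rule sum.swap)
  also have "\<dots> = (\<Sum>u\<in>T. \<Sum>v\<in>S. if v \<in> N u then 1 else 0)"
    using N_sym by (intro sum.cong refl) auto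
  finally show ?thesis using * assms by simp
qed

text \<open>Take out an edge with both its ends and repeat. Either this succeeds \<open>t\<close>
  times, or the ends taken so far, at most \<open>2 * t\<close>, leave an independent set.\<close>

lemma matching_or_cover:
  "S \<subseteq> V \<Longrightarrow>
    (\<exists>X\<subseteq>S. card X \<le> 2 * t \<and> (\<forall>x\<in>S - X. N x \<inter> (S - X) = {})) \<or>
    (\<exists>u w. inj_on u {..<t} \<and> inj_on w {..<t} \<and> u ` {..<t} \<inter> w ` {..<t} = {} \<and>
       u ` {..<t} \<union> w ` {..<t} \<subseteq> S \<and> (\<forall>i<t. w i \<in> N (u i)))"
proof (induction t arbitrary: S)
  case (Suc t)
  show ?case
  proof (cases "\<forall>x\<in>S. N x \<inter> S = {}")
    case True
    then show ?thesis by (intro disjI1 exI[of _ "{}"]) auto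
  next
    case False
    then obtain x y where xy: "x \<in> S" "y \<in> S" "y \<in> N x" by auto
    have ne: "x \<noteq> y" using xy by auto
    have "S - {x, y} \<subseteq> V" using Suc.prems by auto
    from Suc.IH[OF this] show ?thesis
    proof (elim disjE exE conjE)
      fix X assume X: "X \<subseteq> S - {x, y}" "card X \<le> 2 * t"
        "\<forall>z\<in>S - {x, y} - X. N z \<inter> (S - {x, y} - X) = {}"
      have "card (X \<union> {x, y}) \<le> card X + card {x, y}" by (rule card_Un_le)
      also have "\<dots> \<le> 2 * Suc t" using X(2) ne by simp
      finally have "card (X \<union> {x, y}) \<le> 2 * Suc t" .
      moreover have "S - {x, y} - X = S - (X \<union> {x, y})" by auto
      ultimately show ?thesis using X xy
        by (intro disjI1 exI[of _ "X \<union> {x, y}"]) auto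
    next
      fix u w assume uw: "inj_on u {..<t}" "inj_on w {..<t}" "u ` {..<t} \<inter> w ` {..<t} = {}"
        "u ` {..<t} \<union> w ` {..<t} \<subseteq> S - {x, y}" "\<forall>i<t. w i \<in> N (u i)"
      let ?u = "u(t := x)" and ?w = "w(t := y)"
      have im: "?u ` {..<Suc t} = insert x (u ` {..<t})" "?w ` {..<Suc t} = insert y (w ` {..<t})"
        by (auto simp: lessThan_Suc)
      have "inj_on ?u {..<Suc t}" "inj_on ?w {..<Suc t}"
        using uw by (auto simp: lessThan_Suc inj_on_def)
      moreover have "?u ` {..<Suc t} \<inter> ?w ` {..<Suc t} = {}"
        unfolding im using uw ne by auto
      moreover have "?u ` {..<Suc t} \<union> ?w ` {..<Suc t} \<subseteq> S"
        unfolding im using uw xy by auto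
      moreover have "\<forall>i<Suc t. ?w i \<in> N (?u i)" using uw xy by (auto simp: less_Suc_eq)
      ultimately show ?thesis by (intro disjI2 exI[of _ ?u] exI[of _ ?w] conjI)
    qed
  qed
qed simp

end

section \<open>Complete multipartite subgraphs under a minimum degree condition\<close>

definition blowup :: "('a \<Rightarrow> 'a set) \<Rightarrow> nat \<Rightarrow> nat \<Rightarrow> (nat \<Rightarrow> 'a set) \<Rightarrow> bool" where
  "blowup N r L P \<longleftrightarrow>
     (\<forall>i<r. finite (P i) \<and> card (P i) = L) \<and>
     (\<forall>i<r. \<forall>j<r. i \<noteq> j \<longrightarrow> (\<forall>x\<in>P i. P j \<subseteq> N x))"

text \<open>A common vertex of two parts would be its own neighbour. Edges inside a part, by
  contrast, are allowed.\<close>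

lemma (in sgraph) blowup_disjoint:
  assumes "blowup N r L P" "i < r" "j < r" "i \<noteq> j"
  shows "P i \<inter> P j = {}"
  using assms unfolding blowup_def by (meson N_irrefl disjoint_iff subsetD)

lemma (in sgraph) card_blowup:
  assumes "blowup N r L P"
  shows "card (\<Union>i<r. P i) = r * L"
proof -
  have "card (\<Union>i<r. P i) = (\<Sum>i<r. card (P i))"
    using assms blowup_disjoint[OF assms] by (intro card_UN_disjoint) (auto simp: blowup_def)
  also have "\<dots> = r * L" using assms by (simp add: blowup_def)
  finally show ?thesis .
qed

text \<open>A lower bound \<open>(1 - 1/q) n - 1\<close> on the degrees, without division.\<close>

definition dense_degrees :: "nat \<Rightarrow> 'a set \<Rightarrow> ('a \<Rightarrow> 'a set) \<Rightarrow> bool" where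
  "dense_degrees q V N \<longleftrightarrow> (\<forall>v\<in>V. q * card V \<le> q * card (N v) + card V + q)"

lemma (in sgraph) card_N_Int_blowup:
  assumes P: "blowup N r L P" and "j < r" "card (N v \<inter> P j) < M"
  shows "card (N v \<inter> (\<Union>i<r. P i)) + L \<le> r * L + M"
proof -
  have "N v \<inter> (\<Union>i<r. P i) \<subseteq> (N v \<inter> P j) \<union> ((\<Union>i<r. P i) - P j)" by auto
  then have "card (N v \<inter> (\<Union>i<r. P i)) \<le> card ((N v \<inter> P j) \<union> ((\<Union>i<r. P i) - P j))"
    using P by (intro card_mono) (auto simp: blowup_def)
  also have "\<dots> \<le> card (N v \<inter> P j) + card ((\<Union>i<r. P i) - P j)" by (rule card_Un_le)
  also have "card ((\<Union>i<r. P i) - P j) = r * L - L"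
    using card_blowup[OF P] P assms(2) by (subst card_Diff_subset) (auto simp: blowup_def)
  finally have "card (N v \<inter> (\<Union>i<r. P i)) \<le> card (N v \<inter> P j) + (r * L - L)" .
  moreover have "L \<le> r * L" using assms(2) by simp
  ultimately show ?thesis using assms(3) by linarith
qed

text \<open>Double counting: each of the \<open>r * L\<close> vertices of the blow-up has degree at
  least (1 - 1/q) n - 1, and the same pairs are counted from the side of \<open>V\<close>.\<close>

lemma (in sgraph) sum_degrees_blowup:
  assumes P: "blowup N r L P" and "(\<Union>i<r. P i) \<subseteq> V" and "dense_degrees q V N"
  shows "r * L * (q * card V) \<le> q * (\<Sum>v\<in>V. card (N v \<inter> (\<Union>i<r. P i))) + r * L * (card V + q)"
proof -
  let ?K = "\<Union>i<r. P i"
  have finK: "finite ?K" using finite_subset[OF assms(2)] by simp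
  have "(\<Sum>v\<in>V. card (N v \<inter> ?K)) = (\<Sum>v\<in>?K. card (N v \<inter> V))"
    using finK by (intro sum_card_N_swap) auto
  also have "\<dots> = (\<Sum>v\<in>?K. card (N v))"
    using N_subset by (intro sum.cong refl) (simp add: Int_absorb2)
  finally have eq: "(\<Sum>v\<in>V. card (N v \<inter> ?K)) = (\<Sum>v\<in>?K. card (N v))" .
  have "(\<Sum>v\<in>?K. q * card V) \<le> (\<Sum>v\<in>?K. q * card (N v) + (card V + q))"
    using assms(2,3) by (intro sum_mono) (force simp: dense_degrees_def)
  then show ?thesis
    using card_blowup[OF P] unfolding eq by (simp add: sum.distrib sum_distrib_left)
qed

text \<open>Erdos-Stone for minimum degree. A vertex weak on some part has at most about (r - 1) M
  neighbours in the blow-up found so far, while the average is about r M (1 - 1/q), which is larger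
  as r < q. So linearly many vertices are strong on every part; pigeonhole finds \<open>L\<close> of
  them with the same trace, and these form the new part.\<close>

lemma blowup_exists:
  assumes "1 \<le> r" "r \<le> q"
  shows "\<exists>n0. \<forall>V (N :: 'a \<Rightarrow> 'a set). sgraph V N \<longrightarrow> n0 \<le> card V \<longrightarrow> dense_degrees q V N \<longrightarrow>
    (\<exists>P. blowup N r L P \<and> (\<Union>i<r. P i) \<subseteq> V)"
  using assms
proof (induction r arbitrary: L rule: dec_induct)
  case base
  show ?case
  proof (intro exI[of _ L] allI impI)
    fix V and N :: "'a \<Rightarrow> 'a set"
    assume "sgraph V N" "L \<le> card V"
    then obtain S where "S \<subseteq> V" "card S = L" "finite S"
      by (metis obtain_subset_with_card_n)
    then show "\<exists>P. blowup N 1 L P \<and> (\<Union>i<1. P i) \<subseteq> V"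
      by (intro exI[of _ "\<lambda>_. S"]) (auto simp: blowup_def)
  qed
next
  case (step r)
  \<comment> \<open>The excess of \<open>M\<close> over \<open>q * L\<close> is what remains of the
    coefficient of \<open>card V\<close> when the two sides of the count are compared.\<close>
  define M where "M = q * L + L + 1"
  obtain n1 where n1: "\<And>V N. sgraph V (N :: 'a \<Rightarrow> 'a set) \<Longrightarrow> n1 \<le> card V \<Longrightarrow> dense_degrees q V N \<Longrightarrow>
    \<exists>P. blowup N r M P \<and> (\<Union>i<r. P i) \<subseteq> V"
    using step.IH[of M] step.prems by (meson Suc_leD)
  let ?n0 = "n1 + q * (r * M) * (L * 2 ^ (r * M) + r * M + 1) + 1"
  show ?case
  proof (intro exI[of _ ?n0] allI impI)
    fix V and N :: "'a \<Rightarrow> 'a set"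
    assume G: "sgraph V N" and n: "?n0 \<le> card V" and dd: "dense_degrees q V N"
    interpret sgraph V N by fact
    obtain P where P: "blowup N r M P" and PV: "(\<Union>i<r. P i) \<subseteq> V"
      using n1[OF G _ dd] n by auto
    define K where "K = (\<Union>i<r. P i)"
    have finK: "finite K" using finite_subset[OF PV] by (simp add: K_def)
    have cardK: "card K = r * M" using card_blowup[OF P] by (simp add: K_def)
    define W where "W = {v \<in> V - K. \<forall>i<r. L \<le> card (N v \<inter> P i)}"
    have finW: "finite W" by (simp add: W_def)
    have WK: "W \<union> K \<subseteq> V" using PV by (auto simp: W_def K_def)
    have bound: "card (N v \<inter> K) \<le> (r - 1) * M + L + (if v \<in> W \<union> K then r * M else 0)"
      if vV: "v \<in> V" for v
    proof (cases "v \<in> W \<union> K")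
      case True
      have "card (N v \<inter> K) \<le> card K" using finK by (intro card_mono) auto
      then show ?thesis using True cardK by simp
    next
      case False
      then obtain j where "j < r" "card (N v \<inter> P j) < L" using vV by (force simp: W_def)
      from card_N_Int_blowup[OF P this] have "card (N v \<inter> K) + M \<le> r * M + L" by (simp add: K_def)
      then show ?thesis using step.hyps False by (cases r) auto
    qed
    have "(\<Sum>v\<in>V. card (N v \<inter> K)) \<le> (\<Sum>v\<in>V. (r - 1) * M + L + (if v \<in> W \<union> K then r * M else 0))"
      using bound by (rule sum_mono)
    also have "\<dots> = card V * ((r - 1) * M + L) + card (W \<union> K) * (r * M)"
    proof -
      have "V \<inter> {v. v \<in> W \<or> v \<in> K} = W \<union> K" using WK by auto
      then show ?thesis by (simp add: sum.distrib sum.If_cases)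
    qed
    finally have s: "(\<Sum>v\<in>V. card (N v \<inter> K)) \<le> card V * ((r - 1) * M + L) + card (W \<union> K) * (r * M)" .
    have "card (W \<union> K) \<le> card W + r * M" using card_Un_le[of W K] cardK by simp
    then have s': "(\<Sum>v\<in>V. card (N v \<inter> K)) \<le> card V * ((r - 1) * M + L) + (card W + r * M) * (r * M)"
      using s by (meson add_left_mono le_trans mult_le_mono1)
    have "r * M * (q * card V) \<le> q * (\<Sum>v\<in>V. card (N v \<inter> K)) + r * M * (card V + q)"
      using sum_degrees_blowup[OF P PV dd] by (simp add: K_def)
    also have "\<dots> \<le> q * (card V * ((r - 1) * M + L) + (card W + r * M) * (r * M)) + r * M * (card V + q)"
      using s' by (intro add_mono mult_le_mono) auto
    finally have main: "r * M * (q * card V) \<le>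
       q * (card V * ((r - 1) * M + L) + (card W + r * M) * (r * M)) + r * M * (card V + q)" .
    have "r < q" using step.prems by simp
    then obtain e where e: "q = r + Suc e" using less_imp_Suc_add by auto
    obtain r' where r': "r = Suc r'" using step.hyps by (cases r) auto
    \<comment> \<open>The coefficient is q r - q (r - 1) - r = q - r.\<close>
    have "card V * (M * (q - r)) \<le> card V * (q * L) + q * (r * M) * (card W + r * M + 1)"
      using main unfolding e r' by (simp add: algebra_simps)
    moreover have "M \<le> M * (q - r)" using e by simp
    ultimately have "card V * M \<le> card V * (q * L) + q * (r * M) * (card W + r * M + 1)"
      by (meson le_trans mult_le_mono2)
    then have "card V \<le> q * (r * M) * (card W + r * M + 1)"
      unfolding M_def by (simp add: algebra_simps)
    with n have "q * (r * M) * (L * 2 ^ (r * M) + r * M + 1) < q * (r * M) * (card W + r * M + 1)"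
      by linarith
    then have "L * card (Pow K) < card W" using cardK by (simp add: card_Pow finK)
    then obtain Y where Y: "Y \<subseteq> K" "L < card {x \<in> W. N x \<inter> K = Y}"
      using pigeonhole_fibre[of W "Pow K" "\<lambda>x. N x \<inter> K" L] finW finK by auto
    obtain Q where Q: "Q \<subseteq> {x \<in> W. N x \<inter> K = Y}" "card Q = L" "finite Q"
      using Y(2) by (meson less_imp_le obtain_subset_with_card_n)
    obtain x where x: "x \<in> W" "N x \<inter> K = Y" using Y(2) card_gt_0_iff
      by (metis (mono_tags, lifting) Collect_empty_eq card.empty not_less0)
    have "\<exists>S. S \<subseteq> N x \<inter> P i \<and> card S = L \<and> finite S" if "i < r" for i
      using x that unfolding W_def by (metis (no_types, lifting) mem_Collect_eq obtain_subset_with_card_n)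
    then obtain S where S: "\<And>i. i < r \<Longrightarrow> S i \<subseteq> N x \<inter> P i \<and> card (S i) = L \<and> finite (S i)"
      by metis
    let ?P = "S(r := Q)"
    have SN: "S i \<subseteq> N y" if "i < r" "y \<in> Q" for i y
    proof -
      have "S i \<subseteq> N x \<inter> K" using S[OF that(1)] that by (auto simp: K_def)
      also have "\<dots> = N y \<inter> K" using x(2) Q(1) that(2) by auto
      finally show ?thesis by auto
    qed
    have "blowup N (Suc r) L ?P"
      unfolding blowup_def
    proof (intro conjI allI impI ballI)
      fix i assume "i < Suc r"
      then show "finite (?P i)" "card (?P i) = L" using S Q by (auto simp: less_Suc_eq)
    next
      fix i j y assume ij: "i < Suc r" "j < Suc r" "i \<noteq> j" and y: "y \<in> ?P i"
      consider "i = r" "j < r" | "i < r" "j = r" | "i < r" "j < r" using ij by linarith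
      then show "?P j \<subseteq> N y"
      proof cases
        case 1 then show ?thesis using SN y by auto
      next
        case 2 then show ?thesis using SN[of i] y N_sym by auto
      next
        case 3
        then have "y \<in> P i" using y S[of i] by auto
        then have "P j \<subseteq> N y" using P ij(3) 3 by (simp add: blowup_def)
        then show ?thesis using 3 S[of j] by auto
      qed
    qed
    moreover have "(\<Union>i<Suc r. ?P i) \<subseteq> V"
    proof -
      have "S i \<subseteq> V" if "i < r" for i using S[OF that] N_subset by blast
      moreover have "Q \<subseteq> V" using Q(1) by (auto simp: W_def)
      ultimately show ?thesis by (fastforce simp: less_Suc_eq)
    qed
    ultimately show "\<exists>P. blowup N (Suc r) L P \<and> (\<Union>i<Suc r. P i) \<subseteq> V" by blast
  qed
qed

section \<open>Configurations\<close>

text \<open>A matching in one class of a complete \<open>q\<close>-partite graph, placed so that the matching, together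
  with \<open>C j0\<close>, forms a class.\<close>

definition config :: "('a \<Rightarrow> 'a set) \<Rightarrow> nat \<Rightarrow> nat \<Rightarrow> nat \<Rightarrow> bool" where
  "config N q t k \<longleftrightarrow>
     (\<exists>C u w j0. blowup N q k C \<and> j0 < q \<and>
        inj_on u {..<t} \<and> inj_on w {..<t} \<and> u ` {..<t} \<inter> w ` {..<t} = {} \<and>
        (u ` {..<t} \<union> w ` {..<t}) \<inter> C j0 = {} \<and>
        (\<forall>i<t. w i \<in> N (u i)) \<and>
        (\<forall>j<q. j \<noteq> j0 \<longrightarrow> (\<forall>x\<in>u ` {..<t} \<union> w ` {..<t}. C j \<subseteq> N x)))"

lemma subset_of_card: "n \<le> card S \<Longrightarrow> \<exists>T\<subseteq>S. card T = n \<and> finite T"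
  by (meson obtain_subset_with_card_n)

lemma configI:
  assumes "blowup N q k C" "j0 < q"
    "inj_on u {..<t}" "inj_on w {..<t}" "u ` {..<t} \<inter> w ` {..<t} = {}"
    "(u ` {..<t} \<union> w ` {..<t}) \<inter> C j0 = {}"
    "\<And>i. i < t \<Longrightarrow> w i \<in> N (u i)"
    "\<And>j x. j < q \<Longrightarrow> j \<noteq> j0 \<Longrightarrow> x \<in> u ` {..<t} \<union> w ` {..<t} \<Longrightarrow> C j \<subseteq> N x"
  shows "config N q t k"
  unfolding config_def using assms by (intro exI[of _ C] exI[of _ u] exI[of _ w] exI[of _ j0] conjI allI impI ballI) auto

section \<open>Large independent classes in the absence of a configuration\<close>

lemma (in sgraph) cover_if_no_matching:
  assumes "S \<subseteq> V"
    and no: "\<And>u w. inj_on u {..<t} \<Longrightarrow> inj_on w {..<t} \<Longrightarrow> u ` {..<t} \<inter> w ` {..<t} = {} \<Longrightarrow>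
      u ` {..<t} \<union> w ` {..<t} \<subseteq> S \<Longrightarrow> (\<And>i. i < t \<Longrightarrow> w i \<in> N (u i)) \<Longrightarrow> False"
  shows "\<exists>X\<subseteq>S. card X \<le> 2 * t \<and> (\<forall>x\<in>S - X. N x \<inter> (S - X) = {})"
  using matching_or_cover[OF assms(1), of t]
proof (elim disjE exE conjE)
  fix u w assume uw: "inj_on u {..<t}" "inj_on w {..<t}" "u ` {..<t} \<inter> w ` {..<t} = {}"
    "u ` {..<t} \<union> w ` {..<t} \<subseteq> S" "\<forall>i<t. w i \<in> N (u i)"
  show ?thesis using no[OF uw(1-4)] uw(5) by simp
next
  fix X assume "X \<subseteq> S" "card X \<le> 2 * t" "\<forall>x\<in>S - X. N x \<inter> (S - X) = {}"
  then show ?thesis by (intro exI[of _ X] conjI)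
qed

lemma card_Int_complements:
  assumes "finite S" "finite U" "\<And>x. x \<in> U \<Longrightarrow> card (S - N x) \<le> m"
  shows "card S \<le> card (S \<inter> (\<Inter>x\<in>U. N x)) + card U * m"
proof -
  have "card S \<le> card ((S \<inter> (\<Inter>x\<in>U. N x)) \<union> (\<Union>x\<in>U. S - N x))"
    using assms by (intro card_mono) auto
  also have "\<dots> \<le> card (S \<inter> (\<Inter>x\<in>U. N x)) + card (\<Union>x\<in>U. S - N x)" by (rule card_Un_le)
  also have "card (\<Union>x\<in>U. S - N x) \<le> (\<Sum>x\<in>U. card (S - N x))"
    using assms(2) by (rule card_UN_le)
  also have "\<dots> \<le> card U * m" using sum_bounded_above[of U "\<lambda>x. card (S - N x)" m] assms(3) by simp
  finally show ?thesis by simp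
qed

text \<open>A single vertex of \<open>A\<close> is enough: its neighbours avoid \<open>A\<close>,
  and it has at least (1 - 1/q) n - 1 of them.\<close>

lemma (in sgraph) independent_small:
  assumes "dense_degrees q V N" "A \<subseteq> V" "\<And>x. x \<in> A \<Longrightarrow> N x \<inter> A = {}"
  shows "q * card A \<le> card V + q"
proof (cases "A = {}")
  case False
  then obtain x where x: "x \<in> A" by auto
  have "N x \<subseteq> V - A" using N_subset assms(3)[OF x] by auto
  then have "card (N x) \<le> card V - card A"
    using card_mono[of "V - A" "N x"] assms(2) by (simp add: card_Diff_subset finite_subset)
  moreover have "card A \<le> card V" using assms(2) by (simp add: card_mono)
  ultimately have "q * card (N x) + q * card A \<le> q * card V"
    by (metis add_mult_distrib2 le_diff_conv2 mult_le_mono2)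
  then show ?thesis using assms(1,2) x by (force simp: dense_degrees_def)
qed simp

text \<open>By pigeonhole, \<open>t\<close> of too many such vertices have the same neighbourhood in the blow-up and could
  serve as the matched vertices of a configuration.\<close>

lemma (in sgraph) few_full_vertices:
  assumes P: "blowup N q M P" and PV: "(\<Union>i<q. P i) \<subseteq> V" and "1 \<le> q"
    and nc: "\<not> config N q t k"
  shows "card {v \<in> V - (\<Union>i<q. P i). \<forall>i<q. k + t \<le> card (N v \<inter> P i)} \<le> t * 2 ^ (q * M)"
proof (rule ccontr)
  define K where "K = (\<Union>i<q. P i)"
  define W where "W = {v \<in> V - K. \<forall>i<q. k + t \<le> card (N v \<inter> P i)}"
  assume "\<not> ?thesis"
  moreover have finK: "finite K" using finite_subset[OF PV] by (simp add: K_def)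
  ultimately have "t * card (Pow K) < card W"
    using card_blowup[OF P] by (simp add: W_def K_def card_Pow)
  then obtain Y where Y: "Y \<subseteq> K" "t < card {x \<in> W. N x \<inter> K = Y}"
    using pigeonhole_fibre[of W "Pow K" "\<lambda>x. N x \<inter> K" t] finK by (auto simp: W_def)
  obtain T where T: "T \<subseteq> {x \<in> W. N x \<inter> K = Y}" "card T = t" "finite T"
    using Y(2) by (meson less_imp_le obtain_subset_with_card_n)
  obtain u where u: "bij_betw u {..<t} T"
    using T bij_betw_iff_card[of "{..<t}" T] by auto
  have "{x \<in> W. N x \<inter> K = Y} \<noteq> {}" using Y(2) by force
  then obtain x where x: "x \<in> W" "N x \<inter> K = Y" by auto
  have "N x \<inter> P i = Y \<inter> P i" if "i < q" for i using x that by (auto simp: K_def)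
  then have Yi: "k + t \<le> card (Y \<inter> P i)" if "i < q" for i using x that by (auto simp: W_def)
  have YT: "Y \<subseteq> N v" if "v \<in> T" for v using T(1) that by auto
  \<comment> \<open>The partners of the matching come from \<open>P 0\<close>, so
    \<open>j0 = 0\<close>. This explains the threshold \<open>k + t\<close>: after \<open>Z\<close>
    is removed, every trace keeps \<open>k\<close> vertices.\<close>
  have "t \<le> card (Y \<inter> P 0)" using Yi[of 0] \<open>1 \<le> q\<close> by linarith
  then obtain Z where Z: "Z \<subseteq> Y \<inter> P 0" "card Z = t" "finite Z"
    using subset_of_card by blast
  obtain w where w: "bij_betw w {..<t} Z"
    using Z bij_betw_iff_card[of "{..<t}" Z] by auto
  have "k \<le> card (Y \<inter> P i - Z)" if "i < q" for i
  proof -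
    have "card (Y \<inter> P i) \<le> card (Y \<inter> P i - Z) + card Z"
      using diff_card_le_card_Diff[OF Z(3), of "Y \<inter> P i"] by linarith
    then show ?thesis using Yi[OF that] Z(2) by simp
  qed
  then have "\<forall>i. \<exists>D. i < q \<longrightarrow> D \<subseteq> Y \<inter> P i - Z \<and> card D = k \<and> finite D"
    using subset_of_card by metis
  then obtain C where C: "\<And>i. i < q \<Longrightarrow> C i \<subseteq> Y \<inter> P i - Z \<and> card (C i) = k \<and> finite (C i)"
    by metis
  have "config N q t k"
  proof (rule configI)
    show "blowup N q k C"
      unfolding blowup_def
    proof (intro conjI allI impI ballI)
      fix i j y assume ij: "i < q" "j < q" "i \<noteq> j" "y \<in> C i"
      then have "y \<in> P i" using C by blast
      then have "P j \<subseteq> N y" using P ij unfolding blowup_def by blast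
      then show "C j \<subseteq> N y" using C ij by blast
    qed (use C in auto)
    have im: "u ` {..<t} = T" "w ` {..<t} = Z" using u w by (auto simp: bij_betw_def)
    have TK: "T \<inter> K = {}" using T(1) by (auto simp: W_def)
    have ZK: "Z \<subseteq> K" using Z Y by auto
    show "0 < q" using \<open>1 \<le> q\<close> by simp
    show "u ` {..<t} \<inter> w ` {..<t} = {}" "(u ` {..<t} \<union> w ` {..<t}) \<inter> C 0 = {}"
      unfolding im using TK ZK C[OF \<open>0 < q\<close>] Y(1) by auto
    show "w i \<in> N (u i)" if "i < t" for i
      using im that Z(1) YT by blast
    show "C j \<subseteq> N y" if j: "j < q" "j \<noteq> 0" "y \<in> u ` {..<t} \<union> w ` {..<t}" for j y
    proof (cases "y \<in> T")
      case True then show ?thesis using YT C j by blast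
    next
      case False
      then have "y \<in> P 0" using j Z unfolding im by auto
      then have "P j \<subseteq> N y" using P j \<open>0 < q\<close> unfolding blowup_def by (metis (no_types))
      then show ?thesis using C j by blast
    qed
  qed (use u w in \<open>auto simp: bij_betw_def\<close>)
  then show False using nc by simp
qed

text \<open>A vertex outside \<open>K\<close> and \<open>W\<close> is weak on some part
  \<open>P j\<close>. Unless it lies in \<open>Z\<close>, its degree into \<open>K\<close> then
  leaves at most \<open>D + L\<close> missing neighbours in each other part. A matching of size
  \<open>t\<close> among such vertices of one type \<open>j\<close> would be a configuration with
  \<open>j0 = j\<close>, so removing a small cover makes each type independent. The number
  \<open>z\<close> is the size of \<open>Z\<close>.\<close>

lemma (in sgraph) layers_of_blowup:
  assumes P: "blowup N q M P" and PV: "(\<Union>i<q. P i) \<subseteq> V" and q: "1 \<le> q"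
    and nc: "\<not> config N q t k" and dd: "dense_degrees q V N"
    and M: "M = 2 * t * (D + (k + t)) + k"
  shows "\<exists>A z. (\<forall>j<q. A j \<subseteq> V \<and> (\<forall>x\<in>A j. N x \<inter> A j = {})) \<and>
     (\<forall>i<q. \<forall>j<q. i \<noteq> j \<longrightarrow> A i \<inter> A j = {}) \<and>
     card (V - (\<Union>j<q. A j)) \<le> q * M + t * 2 ^ (q * M) + z + 2 * t * q \<and>
     (D + (k + t)) * z \<le> card V * (k + t) + q * M * (t * 2 ^ (q * M) + q * M) + M * q"
proof -
  define L where "L = k + t"
  define K where "K = (\<Union>i<q. P i)"
  define W where "W = {v \<in> V - K. \<forall>i<q. L \<le> card (N v \<inter> P i)}"
  define Z where "Z = {v \<in> V - K - W. card (N v \<inter> K) + M + D < q * M}"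
  have finK: "finite K" using finite_subset[OF PV] by (simp add: K_def)
  have KV: "K \<subseteq> V" using PV by (simp add: K_def)
  have cK: "card K = q * M" using card_blowup[OF P] by (simp add: K_def)
  have finP: "finite (P i)" "card (P i) = M" if "i < q" for i using P that by (auto simp: blowup_def)
  have cW: "card W \<le> t * 2 ^ (q * M)"
    using few_full_vertices[OF P PV q nc] by (simp add: W_def K_def L_def)
  have fins: "finite W" "finite Z" by (auto simp: W_def Z_def)
  have WKV: "W \<union> K \<subseteq> V" "Z \<subseteq> V" "Z \<inter> (W \<union> K) = {}" using KV by (auto simp: W_def Z_def)
  have small: "\<exists>j<q. card (N v \<inter> P j) < L" if "v \<in> V - K - W" for v
    using that by (force simp: W_def)
  \<comment> \<open>Outside \<open>W\<close> and \<open>K\<close> the degree into \<open>K\<close>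
    is at most (q - 1) M + L, and a vertex of \<open>Z\<close> stays below this by more than
    \<open>D + L\<close>. As the average is at least about (q - 1) M, the set \<open>Z\<close> is at
    most about a fraction L / (D + L) of \<open>V\<close>.\<close>
  have bound: "card (N v \<inter> K) + M + (if v \<in> Z then D + L else 0) \<le>
      q * M + L + (if v \<in> W \<union> K then q * M else 0)" if vV: "v \<in> V" for v
  proof (cases "v \<in> W \<union> K")
    case True
    have "card (N v \<inter> K) \<le> q * M" using card_mono[of K "N v \<inter> K"] finK cK by simp
    moreover have "M \<le> q * M" using q by simp
    ultimately have "card (N v \<inter> K) + M \<le> q * M + L + q * M" by linarith
    moreover have "v \<notin> Z" using True WKV by auto
    ultimately show ?thesis using True by simp
  next
    case False
    then obtain j where j: "j < q" "card (N v \<inter> P j) < L" using small[of v] vV by auto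
    have "card (N v \<inter> K) + M \<le> q * M + L" using card_N_Int_blowup[OF P j] by (simp add: K_def)
    then show ?thesis using False by (auto simp: Z_def)
  qed
  have "(\<Sum>v\<in>V. card (N v \<inter> K) + M + (if v \<in> Z then D + L else 0)) \<le>
      (\<Sum>v\<in>V. q * M + L + (if v \<in> W \<union> K then q * M else 0))"
    using bound by (rule sum_mono)
  moreover have "V \<inter> {v. v \<in> W \<or> v \<in> K} = W \<union> K" "V \<inter> {v. v \<in> Z} = Z" using WKV by auto
  ultimately have "(\<Sum>v\<in>V. card (N v \<inter> K)) + card V * M + card Z * (D + L)
      \<le> card V * (q * M + L) + card (W \<union> K) * (q * M)"
    by (simp add: sum.distrib sum.If_cases)
  moreover have "card (W \<union> K) \<le> t * 2 ^ (q * M) + q * M"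
    using card_Un_le[of W K] cK cW by simp
  then have "card (W \<union> K) * (q * M) \<le> (t * 2 ^ (q * M) + q * M) * (q * M)"
    by (rule mult_le_mono1)
  moreover have "q * (M * (q * card V)) \<le> q * ((\<Sum>v\<in>V. card (N v \<inter> K)) + M * (card V + q))"
    using sum_degrees_blowup[OF P PV dd] by (simp add: K_def algebra_simps)
  then have "M * (q * card V) \<le> (\<Sum>v\<in>V. card (N v \<inter> K)) + M * (card V + q)" using q by simp
  ultimately have cZ: "(D + L) * card Z \<le> card V * L + q * M * (t * 2 ^ (q * M) + q * M) + M * q"
    by (simp add: algebra_simps)
  define ty where "ty v = (LEAST j. j < q \<and> card (N v \<inter> P j) < L)" for v
  have ty: "ty v < q \<and> card (N v \<inter> P (ty v)) < L" if v: "v \<in> V - K - W" for v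
    using small[OF v] unfolding ty_def by (rule LeastI_ex)
  define G where "G j = {v \<in> V - K - W - Z. ty v = j}" for j
  have miss: "card (P i - N v) \<le> D + L" if v: "v \<in> G j" and ij: "i < q" "j < q" "i \<noteq> j" for v i j
  proof -
    have "card (N v \<inter> P j) < L" using ty[of v] v by (auto simp: G_def)
    moreover have "q * M \<le> card (N v \<inter> K) + M + D" using v by (auto simp: G_def Z_def)
    moreover have "card (K - N v) + card (N v \<inter> K) = q * M"
      using card_Diff_subset_Int[of K "N v"] finK card_mono[of K "N v \<inter> K"] cK by (simp add: Int_commute)
    moreover have "card (P j - N v) + card (N v \<inter> P j) = M"
      using card_Diff_subset_Int[of "P j" "N v"] finP[OF \<open>j < q\<close>] card_mono[of "P j" "N v \<inter> P j"]
      by (simp add: Int_commute)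
    moreover have "card (P i - N v) + card (P j - N v) = card ((P i - N v) \<union> (P j - N v))"
      using blowup_disjoint[OF P ij] finP ij by (intro card_Un_disjoint[symmetric]) auto
    moreover have "card ((P i - N v) \<union> (P j - N v)) \<le> card (K - N v)"
      using finK ij by (intro card_mono) (auto simp: K_def)
    ultimately show ?thesis by linarith
  qed
  have "\<exists>X\<subseteq>G j. card X \<le> 2 * t \<and> (\<forall>x\<in>G j - X. N x \<inter> (G j - X) = {})" if j: "j < q" for j
  proof (rule cover_if_no_matching)
    show "G j \<subseteq> V" by (auto simp: G_def)
    fix u w assume uw: "inj_on u {..<t}" "inj_on w {..<t}" "u ` {..<t} \<inter> w ` {..<t} = {}"
      "u ` {..<t} \<union> w ` {..<t} \<subseteq> G j" "\<And>i. i < t \<Longrightarrow> w i \<in> N (u i)"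
    define U where "U = u ` {..<t} \<union> w ` {..<t}"
    have cU: "finite U" "card U \<le> 2 * t" using card_Un_le[of "u ` {..<t}" "w ` {..<t}"]
        card_image_le[of "{..<t}" u] card_image_le[of "{..<t}" w] by (auto simp: U_def)
    have big: "k \<le> card (if i = j then P i else P i \<inter> (\<Inter>x\<in>U. N x))" if i: "i < q" for i
    proof (cases "i = j")
      case True then show ?thesis using finP[OF i] M by simp
    next
      case False
      have "card (P i) \<le> card (P i \<inter> (\<Inter>x\<in>U. N x)) + card U * (D + L)"
        using miss[of _ j i] uw(4) i j False finP[OF i] cU
        by (intro card_Int_complements) (auto simp: U_def)
      moreover have "card U * (D + L) \<le> 2 * t * (D + L)" by (rule mult_le_mono1[OF cU(2)])
      \<comment> \<open>Here \<open>M\<close> has its origin: up to \<open>2 * t\<close> matched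
        vertices may each miss \<open>D + L\<close> vertices of \<open>P i\<close>, and
        \<open>k\<close> must survive.\<close>
      moreover have "M = 2 * t * (D + L) + k" using M by (simp add: L_def)
      ultimately have "k \<le> card (P i \<inter> (\<Inter>x\<in>U. N x))" using finP[OF i] by linarith
      then show ?thesis using False by simp
    qed
    then have "\<forall>i. \<exists>T. i < q \<longrightarrow> T \<subseteq> (if i = j then P i else P i \<inter> (\<Inter>x\<in>U. N x)) \<and> card T = k \<and> finite T"
      using subset_of_card by metis
    then obtain C where C: "\<And>i. i < q \<Longrightarrow> C i \<subseteq> (if i = j then P i else P i \<inter> (\<Inter>x\<in>U. N x)) \<and>
        card (C i) = k \<and> finite (C i)" by metis
    have CP: "C i \<subseteq> P i" if "i < q" for i using C[OF that] by (auto split: if_splits)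
    have "config N q t k"
    proof (rule configI)
      show "blowup N q k C"
        unfolding blowup_def
      proof (intro conjI allI impI ballI)
        fix i l y assume il: "i < q" "l < q" "i \<noteq> l" "y \<in> C i"
        then have "P l \<subseteq> N y" using P CP unfolding blowup_def by blast
        then show "C l \<subseteq> N y" using CP il by blast
      qed (use C in auto)
      show "(u ` {..<t} \<union> w ` {..<t}) \<inter> C j = {}"
        using uw(4) CP[OF j] j by (force simp: G_def K_def)
      show "C l \<subseteq> N y" if "l < q" "l \<noteq> j" "y \<in> u ` {..<t} \<union> w ` {..<t}" for l y
        using C[OF that(1)] that by (auto simp: U_def)
    qed (use uw j in auto)
    then show False using nc by simp
  qed
  then obtain X where X: "\<And>j. j < q \<Longrightarrow> X j \<subseteq> G j \<and> card (X j) \<le> 2 * t \<and>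
      (\<forall>x\<in>G j - X j. N x \<inter> (G j - X j) = {})" by metis
  let ?A = "\<lambda>j. G j - X j"
  have "V - (\<Union>j<q. ?A j) \<subseteq> K \<union> W \<union> Z \<union> (\<Union>j<q. X j)"
  proof
    fix v assume v: "v \<in> V - (\<Union>j<q. ?A j)"
    show "v \<in> K \<union> W \<union> Z \<union> (\<Union>j<q. X j)"
    proof (rule ccontr)
      assume n: "v \<notin> K \<union> W \<union> Z \<union> (\<Union>j<q. X j)"
      then have "ty v < q" "v \<in> G (ty v)" using ty[of v] v by (auto simp: G_def)
      then show False using n v by auto
    qed
  qed
  moreover have "finite (X j)" if "j < q" for j
    using X[OF that] by (auto simp: G_def intro: finite_subset[OF _ finite_V])
  ultimately have "card (V - (\<Union>j<q. ?A j)) \<le> card (K \<union> W \<union> Z \<union> (\<Union>j<q. X j))"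
    using finK fins by (intro card_mono) auto
  also have "\<dots> \<le> card K + card W + card Z + card (\<Union>j<q. X j)"
    by (meson add_mono card_Un_le le_refl le_trans)
  also have "card (\<Union>j<q. X j) \<le> (\<Sum>j<q. card (X j))" by (intro card_UN_le) simp
  also have "\<dots> \<le> q * (2 * t)" using sum_bounded_above[of "{..<q}" "\<lambda>j. card (X j)" "2 * t"] X by simp
  finally have c: "card (V - (\<Union>j<q. ?A j)) \<le> q * M + t * 2 ^ (q * M) + card Z + 2 * t * q"
    using cK cW by (simp add: algebra_simps)
  show ?thesis
  proof (rule exI[of _ ?A], rule exI[of _ "card Z"], intro conjI)
    show "\<forall>j<q. ?A j \<subseteq> V \<and> (\<forall>x\<in>?A j. N x \<inter> ?A j = {})"
    proof (intro allI impI conjI)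
      fix j assume "j < q"
      then show "\<forall>x\<in>?A j. N x \<inter> ?A j = {}" using X by blast
    qed (auto simp: G_def)
    show "\<forall>i<q. \<forall>j<q. i \<noteq> j \<longrightarrow> ?A i \<inter> ?A j = {}" by (auto simp: G_def)
  qed (use c cZ in \<open>simp_all add: L_def\<close>)
qed

definition layers :: "'a set \<Rightarrow> ('a \<Rightarrow> 'a set) \<Rightarrow> nat \<Rightarrow> (nat \<Rightarrow> 'a set) \<Rightarrow> nat \<Rightarrow> bool" where
  "layers V N q A d \<longleftrightarrow>
     (\<forall>j<q. A j \<subseteq> V \<and> card V \<le> q * card (A j) + q * d \<and>
        (\<forall>x\<in>A j. N x \<inter> A j = {} \<and> card (V - A j - N x) \<le> d)) \<and>
     (\<forall>i<q. \<forall>j<q. i \<noteq> j \<longrightarrow> A i \<inter> A j = {})"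

text \<open>Independence bounds every class by n / q + 1, so the others cannot make up for a small
  one, and all have size about n / q. A vertex of \<open>A j\<close> has no neighbour in
  \<open>A j\<close> but at least about n - n / q elsewhere, hence misses little there.\<close>

lemma (in sgraph) layersI:
  assumes dd: "dense_degrees q V N" and q: "1 \<le> q"
    and A: "\<And>j. j < q \<Longrightarrow> A j \<subseteq> V \<and> (\<forall>x\<in>A j. N x \<inter> A j = {})"
    and disj: "\<And>i j. i < q \<Longrightarrow> j < q \<Longrightarrow> i \<noteq> j \<Longrightarrow> A i \<inter> A j = {}"
  shows "layers V N q A (card (V - (\<Union>j<q. A j)) + q)"
proof -
  define l where "l = card (V - (\<Union>j<q. A j))"
  have finA: "finite (A j)" if "j < q" for j using A[OF that] finite_subset finite_V by blast
  have sub: "(\<Union>j<q. A j) \<subseteq> V" using A by auto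
  have "card (\<Union>j<q. A j) = (\<Sum>j<q. card (A j))"
    using finA disj by (intro card_UN_disjoint) auto
  moreover have "card (\<Union>j<q. A j) + l = card V"
    unfolding l_def using card_Diff_subset[OF _ sub] finA card_mono[OF finite_V sub] by simp
  ultimately have tot: "(\<Sum>j<q. card (A j)) + l = card V" by simp
  have up: "q * card (A j) \<le> card V + q" if "j < q" for j
    using independent_small[OF dd] A[OF that] by blast
  have lo: "card V \<le> q * card (A j) + q * l + q * (q - 1)" if j: "j < q" for j
  proof -
    have "q * (\<Sum>i\<in>{..<q} - {j}. card (A i)) \<le> (\<Sum>i\<in>{..<q} - {j}. card V + q)"
      unfolding sum_distrib_left using up by (intro sum_mono) auto
    also have "\<dots> = (q - 1) * (card V + q)" using j by simp
    finally have a: "q * (\<Sum>i\<in>{..<q} - {j}. card (A i)) \<le> (q - 1) * (card V + q)" .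
    have "(\<Sum>i<q. card (A i)) = card (A j) + (\<Sum>i\<in>{..<q} - {j}. card (A i))"
      using j by (simp add: sum.remove)
    then have "card V = card (A j) + (\<Sum>i\<in>{..<q} - {j}. card (A i)) + l" using tot by simp
    then have "q * card V = q * card (A j) + q * (\<Sum>i\<in>{..<q} - {j}. card (A i)) + q * l"
      by (metis add_mult_distrib2)
    moreover have "q * card V = (q - 1) * card V + card V" using q by (cases q) auto
    moreover have "(q - 1) * (card V + q) = (q - 1) * card V + q * (q - 1)"
      by (metis add_mult_distrib2 mult.commute)
    ultimately show ?thesis using a by linarith
  qed
  have miss: "card (V - A j - N x) \<le> l + q" if j: "j < q" and x: "x \<in> A j" for j x
  proof -
    have "card (V - A j - N x) = card V - card (A j) - card (N x)"
      using A[OF j] x finA[OF j] N_subset by (subst card_Diff_subset; (subst card_Diff_subset)?) auto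
    moreover have "card (A j) + card (N x) \<le> card V"
      using card_mono[OF finite_V, of "A j \<union> N x"] A[OF j] x finA[OF j] N_subset
      by (subst card_Un_disjoint[symmetric]) auto
    ultimately have "card (V - A j - N x) + card (A j) + card (N x) = card V" by simp
    then have "q * card (V - A j - N x) + q * card (A j) + q * card (N x) = q * card V"
      by (metis add_mult_distrib2)
    moreover have "q * card V \<le> q * card (N x) + card V + q"
      using dd A[OF j] x by (auto simp: dense_degrees_def)
    ultimately have "q * card (V - A j - N x) \<le> q * l + q * (q - 1) + q"
      using lo[OF j] by linarith
    also have "\<dots> = q * (l + q)" using q by (cases q) (auto simp: algebra_simps)
    finally show ?thesis using q by simp
  qed
  have "card V \<le> q * card (A j) + q * (l + q)" if j: "j < q" for j
  proof -
    have "q * (q - 1) \<le> q * q" by simp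
    then show ?thesis using lo[OF j] by (simp add: algebra_simps)
  qed
  then show ?thesis unfolding layers_def l_def[symmetric] using A disj miss by blast
qed

text \<open>As \<open>E\<close> is arbitrary, the defect \<open>d\<close> can be made any small
  fraction of \<open>card V\<close>.\<close>

lemma layers_exist:
  assumes q: "1 \<le> q" and t: "1 \<le> t"
  shows "\<exists>n0. \<forall>V (N :: 'a \<Rightarrow> 'a set). sgraph V N \<longrightarrow> n0 \<le> card V \<longrightarrow> dense_degrees q V N \<longrightarrow>
    \<not> config N q t k \<longrightarrow> (\<exists>A d. layers V N q A d \<and> E * (d + 1) \<le> card V)"
proof -
  define L where "L = k + t"
  \<comment> \<open>This makes \<open>Z\<close> at most about n / (2 E); the other half of n / E
    absorbs the constants.\<close>
  define D where "D = 2 * E * L"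
  define M where "M = 2 * t * (D + L) + k"
  define c1 where "c1 = q * M * (t * 2 ^ (q * M) + q * M) + M * q"
  define c2 where "c2 = q * M + t * 2 ^ (q * M) + 2 * t * q + q + 1"
  obtain n1 where n1: "\<And>V N. sgraph V (N :: 'a \<Rightarrow> 'a set) \<Longrightarrow> n1 \<le> card V \<Longrightarrow> dense_degrees q V N \<Longrightarrow>
    \<exists>P. blowup N q M P \<and> (\<Union>i<q. P i) \<subseteq> V"
    using blowup_exists[of q q M] q by blast
  show ?thesis
  proof (intro exI[of _ "n1 + c1 + 2 * E * c2"] allI impI)
    fix V and N :: "'a \<Rightarrow> 'a set"
    assume G: "sgraph V N" and n: "n1 + c1 + 2 * E * c2 \<le> card V" and dd: "dense_degrees q V N"
      and nc: "\<not> config N q t k"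
    interpret sgraph V N by fact
    obtain P where P: "blowup N q M P" "(\<Union>i<q. P i) \<subseteq> V" using n1[OF G _ dd] n by auto
    have "M = 2 * t * (D + (k + t)) + k" by (simp add: M_def L_def)
    from layers_of_blowup[OF P q nc dd this] obtain A z where
      A0: "\<forall>j<q. A j \<subseteq> V \<and> (\<forall>x\<in>A j. N x \<inter> A j = {})"
      "\<forall>i<q. \<forall>j<q. i \<noteq> j \<longrightarrow> A i \<inter> A j = {}"
      and l: "card (V - (\<Union>j<q. A j)) \<le> q * M + t * 2 ^ (q * M) + z + 2 * t * q"
      and z: "(D + L) * z \<le> card V * L + c1"
      unfolding L_def c1_def add.assoc by blast
    have A: "\<And>j. j < q \<Longrightarrow> A j \<subseteq> V \<and> (\<forall>x\<in>A j. N x \<inter> A j = {})"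
      "\<And>i j. i < q \<Longrightarrow> j < q \<Longrightarrow> i \<noteq> j \<Longrightarrow> A i \<inter> A j = {}" using A0 by auto
    let ?d = "card (V - (\<Union>j<q. A j)) + q"
    have "1 \<le> L" using t by (simp add: L_def)
    then have "c1 \<le> c1 * L" by simp
    moreover have "(D + L) * z = L * (2 * E * z) + L * z" by (simp add: D_def algebra_simps)
    moreover have "L * (card V + c1) = card V * L + c1 * L" by (simp add: algebra_simps)
    ultimately have "L * (2 * E * z) \<le> L * (card V + c1)" using z by linarith
    then have "2 * E * z \<le> card V + c1" using \<open>1 \<le> L\<close> by simp
    moreover have "?d + 1 \<le> z + c2" using l by (simp add: c2_def)
    then have "2 * E * (?d + 1) \<le> 2 * E * z + 2 * E * c2"
      using mult_le_mono2[of "?d + 1" "z + c2" "2 * E"] by (simp add: algebra_simps)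
    ultimately have "2 * E * (?d + 1) \<le> 2 * card V" using n by linarith
    then have "E * (?d + 1) \<le> card V" by simp
    then show "\<exists>A d. layers V N q A d \<and> E * (d + 1) \<le> card V"
      using layersI[OF dd q, of A] A by blast
  qed
qed

section \<open>Exceptional vertices\<close>

definition type_error :: "nat \<Rightarrow> nat \<Rightarrow> nat" where
  "type_error q t = q * q * (q * t) * (1 + 2 ^ (q * t))"

definition count_error :: "nat \<Rightarrow> nat \<Rightarrow> nat" where
  "count_error q t = q * t * t + q * (q * t * (q * t)) + q * q + 4 * t * q * q * (q + 1)"

text \<open>One summand for each kind of argument in which \<open>card V\<close> absorbs multiples
  of \<open>g\<close>: making neighbourhoods popular, bounding \<open>bad\<close> by
  \<open>q * t\<close>, comparing degree sums, and leaving common neighbours of a matching inside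
  the classes. \<open>type_error\<close> stems from \<open>popular_neighbourhoods\<close>,
  \<open>count_error\<close> from \<open>bad_degrees_ge\<close>.\<close>

definition scale :: "nat \<Rightarrow> nat \<Rightarrow> nat" where
  "scale q t = 3 * q * 2 ^ (q * t) + (q * q * t + type_error q t + 1) +
     (count_error q t + 2 * type_error q t + 1) + q * (2 * t * (count_error q t + 3) + 4)"

text \<open>The threshold \<open>g\<close> lies between the scales \<open>d\<close> and \<open>card V\<close>: multiples of \<open>d\<close> are absorbed
  by \<open>g\<close>, and multiples of \<open>g\<close> by \<open>card V\<close>.\<close>

locale layered = sgraph V N for V :: "'a set" and N +
  fixes A :: "nat \<Rightarrow> 'a set" and q t k d g :: nat
  assumes layers: "layers V N q A d"
    and dense: "dense_degrees q V N"
    and no_config: "\<not> config N q t k"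
    and q_ge: "1 \<le> q" and t_ge: "1 \<le> t"
    and g_ge: "q * k * d + k + t * d + d + t + q + 1 \<le> g"
    and V_large: "scale q t * g \<le> card V"
begin

lemma A_V: "j < q \<Longrightarrow> A j \<subseteq> V" and A_indep: "j < q \<Longrightarrow> x \<in> A j \<Longrightarrow> N x \<inter> A j = {}"
  and A_large: "j < q \<Longrightarrow> card V \<le> q * card (A j) + q * d"
  and A_miss: "j < q \<Longrightarrow> x \<in> A j \<Longrightarrow> card (V - A j - N x) \<le> d"
  and A_disjoint: "i < q \<Longrightarrow> j < q \<Longrightarrow> i \<noteq> j \<Longrightarrow> A i \<inter> A j = {}"
  using layers unfolding layers_def by blast+

lemma finite_A: "j < q \<Longrightarrow> finite (A j)"
  using A_V finite_subset finite_V by blast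

lemma A_miss_A:
  assumes "i < q" "j < q" "i \<noteq> j" "x \<in> A j" "S \<subseteq> A i"
  shows "card (S - N x) \<le> d"
proof -
  have "S - N x \<subseteq> V - A j - N x" using A_V[of i] A_disjoint[of i j] assms by blast
  then have "card (S - N x) \<le> card (V - A j - N x)" by (intro card_mono) auto
  then show ?thesis using A_miss assms by fastforce
qed

lemma card_A_ge:
  assumes "q * (X + d) \<le> card V" "j < q"
  shows "X \<le> card (A j)"
proof -
  have "q * (X + d) \<le> q * (card (A j) + d)"
    using A_large[OF assms(2)] assms(1) by (simp only: distrib_left)
  then show ?thesis using q_ge by simp
qed

lemma scale_bound:
  assumes "a \<le> scale q t" shows "a * g \<le> card V"
  using V_large mult_le_mono1[OF assms, of g] by linarith

text \<open>At most \<open>q * k\<close> vertices are chosen before class \<open>r\<close>, and each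
  misses at most \<open>d\<close> vertices of \<open>S r\<close>.\<close>

lemma greedy_blowup:
  assumes "\<And>j. j < q \<Longrightarrow> S j \<subseteq> A j \<and> q * k * d + k \<le> card (S j)"
  shows "\<exists>C. blowup N q k C \<and> (\<forall>j<q. C j \<subseteq> S j)"
proof -
  have "\<exists>C. blowup N r k C \<and> (\<forall>j<r. C j \<subseteq> S j)" if "r \<le> q" for r
    using that
  proof (induction r)
    case 0
    then show ?case by (auto simp: blowup_def)
  next
    case (Suc r)
    then obtain C where C: "blowup N r k C" "\<forall>j<r. C j \<subseteq> S j" by auto
    define U where "U = (\<Union>j<r. C j)"
    have cU: "card U = r * k" using card_blowup[OF C(1)] by (simp add: U_def)
    have finU: "finite U" using C(1) by (auto simp: U_def blowup_def)
    have Sr: "S r \<subseteq> A r" "q * k * d + k \<le> card (S r)" "r < q"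
      using assms[of r] Suc.prems by auto
    have "card (S r - N x) \<le> d" if "x \<in> U" for x
    proof -
      obtain j where j: "j < r" "x \<in> C j" using \<open>x \<in> U\<close> by (auto simp: U_def)
      then have "x \<in> A j" using C(2) assms[of j] Sr by fastforce
      then show ?thesis using A_miss_A[of r j x "S r"] Sr j by simp
    qed
    then have "card (S r) \<le> card (S r \<inter> (\<Inter>x\<in>U. N x)) + card U * d"
      using finU Sr finite_A by (intro card_Int_complements) (auto intro: finite_subset)
    moreover have "card U * d \<le> q * k * d" using Sr(3) cU by simp
    ultimately have "k \<le> card (S r \<inter> (\<Inter>x\<in>U. N x))" using Sr(2) by linarith
    then obtain D where D: "D \<subseteq> S r \<inter> (\<Inter>x\<in>U. N x)" "card D = k" "finite D"
      using subset_of_card by metis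
    let ?C = "C(r := D)"
    have CN: "D \<subseteq> N x" if "x \<in> C j" "j < r" for x j
      using D(1) that by (auto simp: U_def)
    have "blowup N (Suc r) k ?C"
      unfolding blowup_def
    proof (intro conjI allI impI ballI)
      fix i assume "i < Suc r"
      then show "finite (?C i)" "card (?C i) = k" using C(1) D by (auto simp: less_Suc_eq blowup_def)
    next
      fix i j y assume ij: "i < Suc r" "j < Suc r" "i \<noteq> j" and y: "y \<in> ?C i"
      consider "i = r" "j < r" | "i < r" "j = r" | "i < r" "j < r" using ij by linarith
      then show "?C j \<subseteq> N y"
      proof cases
        case 1
        then have "C j \<subseteq> N y" using CN[of _ j] y N_sym by auto
        then show ?thesis using 1 by auto
      next
        case 2 then show ?thesis using CN[of y i] y by auto
      next
        case 3 then show ?thesis using C(1) ij y by (auto simp: blowup_def)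
      qed
    qed
    moreover have "\<forall>j<Suc r. ?C j \<subseteq> S j" using C(2) D(1) by (auto simp: less_Suc_eq)
    ultimately show ?case by blast
  qed
  then show ?thesis by blast
qed

text \<open>The source of all contradictions below. The matching may lie anywhere; all that counts
  is that its vertices have many common neighbours in each class other than
  \<open>j0\<close>.\<close>

lemma no_matching_extension:
  assumes j0: "j0 < q"
    and uw: "inj_on u {..<t}" "inj_on w {..<t}" "u ` {..<t} \<inter> w ` {..<t} = {}"
      "\<And>i. i < t \<Longrightarrow> w i \<in> N (u i)"
    and S: "\<And>j. j < q \<Longrightarrow> j \<noteq> j0 \<Longrightarrow>
      q * k * d + k \<le> card (A j \<inter> (\<Inter>x\<in>u ` {..<t} \<union> w ` {..<t}. N x))"
  shows False
proof -
  define U where "U = u ` {..<t} \<union> w ` {..<t}"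
  have cU: "finite U" "card U \<le> 2 * t" using card_Un_le[of "u ` {..<t}" "w ` {..<t}"]
      card_image_le[of "{..<t}" u] card_image_le[of "{..<t}" w] by (auto simp: U_def)
  \<comment> \<open>Towards \<open>C j0\<close> a configuration asks for disjointness from the
    matching instead of adjacency.\<close>
  define S where "S j = (if j = j0 then A j - U else A j \<inter> (\<Inter>x\<in>U. N x))" for j
  have "q * (3 * g + d) \<le> q * 4 * g" using g_ge by simp
  also have "\<dots> \<le> card V" by (rule scale_bound) (simp add: scale_def algebra_simps)
  finally have "3 * g \<le> card (A j0)" using card_A_ge j0 by blast
  moreover have "card (A j0) \<le> card (A j0 - U) + card U"
    using diff_card_le_card_Diff[OF cU(1), of "A j0"] by linarith
  ultimately have "q * k * d + k \<le> card (A j0 - U)" using cU(2) g_ge by linarith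
  then have "S j \<subseteq> A j \<and> q * k * d + k \<le> card (S j)" if "j < q" for j
    using assms(6)[OF that] by (auto simp: S_def U_def)
  from greedy_blowup[of S, OF this] obtain C where C: "blowup N q k C" "\<forall>j<q. C j \<subseteq> S j" by auto
  have "config N q t k"
  proof (rule configI[OF C(1) j0 uw(1-3)])
    show "(u ` {..<t} \<union> w ` {..<t}) \<inter> C j0 = {}"
    proof -
      have "C j0 \<subseteq> S j0" using C(2) j0 by simp
      then show ?thesis by (auto simp: S_def U_def)
    qed
    show "C j \<subseteq> N x" if "j < q" "j \<noteq> j0" "x \<in> u ` {..<t} \<union> w ` {..<t}" for j x
    proof -
      have "C j \<subseteq> S j" using C(2) that(1) by simp
      then show ?thesis using that by (auto simp: S_def U_def)
    qed
  qed (rule uw)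
  then show False using no_config by simp
qed

text \<open>Match \<open>T\<close> with distinct neighbours in \<open>A j0\<close>. These partners
  destroy at most \<open>t * d\<close> common neighbours in each other class, which \<open>g\<close>
  covers.\<close>

lemma no_common_neighbours:
  assumes j0: "j0 < q" and T: "finite T" "card T = t" "T \<inter> A j0 = {}"
    and TA: "\<And>v. v \<in> T \<Longrightarrow> t \<le> card (N v \<inter> A j0)"
    and S: "\<And>j. j < q \<Longrightarrow> j \<noteq> j0 \<Longrightarrow> g \<le> card (A j \<inter> (\<Inter>v\<in>T. N v))"
  shows False
proof -
  obtain f where f: "inj_on f T" "\<forall>v\<in>T. f v \<in> N v \<inter> A j0"
    using distinct_representatives[of T "\<lambda>v. N v \<inter> A j0"] T TA by auto
  obtain u where u: "bij_betw u {..<t} T"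
    using T bij_betw_iff_card[of "{..<t}" T] by auto
  have uT: "u ` {..<t} = T" "inj_on u {..<t}" using u by (auto simp: bij_betw_def)
  have fu: "(f \<circ> u) ` {..<t} = f ` T" using uT(1) by (metis image_comp)
  show False
  proof (rule no_matching_extension[OF j0 uT(2), of "f \<circ> u"])
    show "inj_on (f \<circ> u) {..<t}" using uT f(1) by (intro comp_inj_on) auto
    show "u ` {..<t} \<inter> (f \<circ> u) ` {..<t} = {}" unfolding fu uT(1) using f(2) T(3) by auto
    show "(f \<circ> u) i \<in> N (u i)" if "i < t" for i using f(2) uT(1) that by auto
    fix j assume j: "j < q" "j \<noteq> j0"
    let ?S = "A j \<inter> (\<Inter>v\<in>T. N v)"
    have "card ?S \<le> card (?S \<inter> (\<Inter>x\<in>f ` T. N x)) + card (f ` T) * d"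
      using f(2) j0 j T(1) finite_A by (intro card_Int_complements A_miss_A[of j j0]) auto
    moreover have "card (f ` T) = t" using f(1) T(2) by (simp add: card_image)
    moreover have "?S \<inter> (\<Inter>x\<in>f ` T. N x) = A j \<inter> (\<Inter>x\<in>u ` {..<t} \<union> (f \<circ> u) ` {..<t}. N x)"
      unfolding fu uT(1) by auto
    ultimately have "card ?S \<le> card (A j \<inter> (\<Inter>x\<in>u ` {..<t} \<union> (f \<circ> u) ` {..<t}. N x)) + t * d"
      by simp
    then show "q * k * d + k \<le> card (A j \<inter> (\<Inter>x\<in>u ` {..<t} \<union> (f \<circ> u) ` {..<t}. N x))"
      using S[OF j] g_ge by linarith
  qed
qed

section \<open>Exceptional vertices and their neighbourhood types\<close>

definition bad :: "'a set" where
  "bad = {v \<in> V. \<forall>j<q. g \<le> card (N v \<inter> A j)}"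

lemma bad_V: "bad \<subseteq> V" and finite_bad [simp]: "finite bad"
  by (auto simp: bad_def)

lemma bad_A: "j < q \<Longrightarrow> bad \<inter> A j = {}"
  using A_indep g_ge by (force simp: bad_def)

definition rest :: "'a set" where
  "rest = V - (\<Union>j<q. A j)"

lemma card_split:
  assumes "X \<subseteq> V"
  shows "card X = card (X \<inter> rest) + (\<Sum>j<q. card (X \<inter> A j))"
proof -
  have fin: "finite X" using assms finite_subset finite_V by blast
  have "card (X \<inter> (\<Union>j<q. A j)) = (\<Sum>j<q. card (X \<inter> A j))"
    unfolding Int_UN_distrib using fin A_disjoint by (intro card_UN_disjoint) auto
  moreover have "X = (X \<inter> rest) \<union> (X \<inter> (\<Union>j<q. A j))" using assms by (auto simp: rest_def)
  then have "card X = card (X \<inter> rest) + card (X \<inter> (\<Union>j<q. A j))"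
    using fin by (subst card_Un_disjoint[symmetric]) (auto simp: rest_def)
  ultimately show ?thesis by simp
qed

lemma card_rest: "card rest \<le> q * d"
proof -
  have "q * card V = q * card rest + (\<Sum>j<q. q * card (A j))"
    using card_split[of V] A_V
    by (simp add: rest_def Int_absorb1 Int_absorb2 sum_distrib_left algebra_simps)
  moreover have "(\<Sum>j<q. card V) \<le> (\<Sum>j<q. q * card (A j) + q * d)"
    using A_large by (intro sum_mono) auto
  ultimately have "q * card rest \<le> q * (q * d)" by (simp add: sum.distrib)
  then show ?thesis using q_ge by simp
qed

text \<open>For each class, sort the vertices by their neighbourhood in \<open>B\<close> and pick a largest
  neighbourhood that occurs often; \<open>y j\<close> is the number of vertices of \<open>B\<close> it misses. If all but one of
  these sets had \<open>t\<close> common vertices, these would be matched vertices of a configuration.\<close>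

lemma popular_neighbourhoods:
  assumes B: "B \<subseteq> bad" and c: "card B = c" "c \<le> q * t"
  shows "\<exists>y. (\<forall>j0<q. c + 1 + y j0 \<le> t + (\<Sum>j<q. y j)) \<and>
    q * (\<Sum>v\<in>B. card (N v)) + card V * (\<Sum>j<q. y j) \<le> q * c * card V + type_error q t * g"
proof -
  have finB: "finite B" using B finite_subset finite_bad by blast
  have BV: "B \<subseteq> V" using B bad_V by blast
  define fibre where "fibre j Z = {u \<in> A j. N u \<inter> B = Z}" for j Z
  define popular where "popular j = {Z \<in> Pow B. g \<le> card (fibre j Z)}" for j
  have "(2::nat) ^ c \<le> 2 ^ (q * t)" using c by simp
  then have two: "2 ^ c * g \<le> 2 ^ (q * t) * g" by (rule mult_le_mono1)
  have Abig: "2 ^ c * g + 1 \<le> card (A j)" if "j < q" for j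
  proof -
    have "(1::nat) \<le> 2 ^ (q * t)" by simp
    then have "1 * g \<le> 2 ^ (q * t) * g" by (rule mult_le_mono1)
    then have "2 ^ c * g + 1 + d \<le> 3 * (2 ^ (q * t) * g)" using two g_ge by linarith
    then have "q * (2 ^ c * g + 1 + d) \<le> q * (3 * (2 ^ (q * t) * g))" by (rule mult_le_mono2)
    also have "\<dots> = 3 * q * 2 ^ (q * t) * g" by simp
    also have "\<dots> \<le> card V" by (rule scale_bound) (simp add: scale_def)
    finally show ?thesis using card_A_ge that by blast
  qed
  have "\<exists>Y\<in>popular j. \<forall>Z\<in>popular j. card Z \<le> card Y" if j: "j < q" for j
  proof -
    have "\<exists>Z\<in>Pow B. g < card {x \<in> A j. N x \<inter> B = Z}"
      using Abig[OF j] finB c(1) finite_A[OF j]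
      by (intro pigeonhole_fibre) (auto simp: card_Pow mult.commute)
    then obtain Z where "Z \<in> Pow B" "g < card (fibre j Z)" by (auto simp: fibre_def)
    then have "Z \<in> popular j" by (simp add: popular_def)
    then have ne: "popular j \<noteq> {}" by blast
    have fin: "finite (popular j)" using finB by (simp add: popular_def)
    have "Max (card ` popular j) \<in> card ` popular j" using ne fin by (intro Max_in) auto
    then obtain Y where "Y \<in> popular j" "card Y = Max (card ` popular j)" by auto
    then show ?thesis using fin by (intro bexI[of _ Y]) auto
  qed
  then obtain Y where Y: "\<And>j. j < q \<Longrightarrow> Y j \<in> popular j \<and> (\<forall>Z\<in>popular j. card Z \<le> card (Y j))"
    by metis
  have YB: "Y j \<subseteq> B" and Yg: "g \<le> card (fibre j (Y j))" if "j < q" for j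
    using Y[OF that] by (auto simp: popular_def)
  define y where "y j = c - card (Y j)" for j
  have yc: "card (Y j) + y j = c" "card (B - Y j) = y j" if "j < q" for j
    using card_mono[OF finB YB[OF that]] c(1) YB[OF that] finB
    by (auto simp: y_def card_Diff_subset finite_subset)
  \<comment> \<open>A vertex of \<open>B\<close> outside \<open>I\<close> is missed by some
    \<open>Y j\<close> with \<open>j\<close> different from \<open>j0\<close>, and \<open>I\<close>
    has fewer than \<open>t\<close> vertices, since \<open>t\<close> of them would have
    \<open>g\<close> common neighbours in every class other than \<open>j0\<close>.\<close>
  have first: "c + 1 + y j0 \<le> t + (\<Sum>j<q. y j)" if j0: "j0 < q" for j0
  proof -
    define J where "J = {..<q} - {j0}"
    define I where "I = B \<inter> (\<Inter>j\<in>J. Y j)"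
    have "card I < t"
    proof (rule ccontr)
      assume "\<not> card I < t"
      then obtain T where T: "T \<subseteq> I" "card T = t" "finite T"
        using subset_of_card[of t I] by auto
      show False
      proof (rule no_common_neighbours[OF j0 T(3,2)])
        have "T \<subseteq> bad" using T(1) B by (auto simp: I_def)
        then show "T \<inter> A j0 = {}" using bad_A[OF j0] by blast
        show "t \<le> card (N v \<inter> A j0)" if "v \<in> T" for v
        proof -
          have "g \<le> card (N v \<inter> A j0)" using that \<open>T \<subseteq> bad\<close> j0 by (auto simp: bad_def)
          then show ?thesis using g_ge by linarith
        qed
        fix j assume j: "j < q" "j \<noteq> j0"
        then have "T \<subseteq> Y j" using T(1) by (auto simp: I_def J_def)
        then have "fibre j (Y j) \<subseteq> A j \<inter> (\<Inter>v\<in>T. N v)"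
          using N_sym by (auto simp: fibre_def)
        then show "g \<le> card (A j \<inter> (\<Inter>v\<in>T. N v))"
          using Yg[OF j(1)] card_mono[of "A j \<inter> (\<Inter>v\<in>T. N v)" "fibre j (Y j)"] finite_A[OF j(1)]
          by fastforce
      qed
    qed
    moreover have "card B \<le> card (I \<union> (\<Union>j\<in>J. B - Y j))"
      using finB by (intro card_mono) (auto simp: I_def J_def)
    moreover have "card (I \<union> (\<Union>j\<in>J. B - Y j)) \<le> card I + card (\<Union>j\<in>J. B - Y j)"
      by (rule card_Un_le)
    moreover have "card (\<Union>j\<in>J. B - Y j) \<le> (\<Sum>j\<in>J. card (B - Y j))"
      by (rule card_UN_le) (simp add: J_def)
    moreover have "(\<Sum>j\<in>J. card (B - Y j)) = (\<Sum>j\<in>J. y j)"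
      using yc by (intro sum.cong) (auto simp: J_def)
    moreover have "(\<Sum>j<q. y j) = y j0 + (\<Sum>j\<in>J. y j)"
      using j0 by (simp add: J_def sum.remove)
    ultimately show ?thesis using c(1) by linarith
  qed
  \<comment> \<open>At most \<open>2 ^ c * g\<close> vertices of \<open>A j\<close> have an
    unpopular neighbourhood in \<open>B\<close>; all others have at most
    \<open>card (Y j) = c - y j\<close> neighbours there.\<close>
  have class_sum: "(\<Sum>u\<in>A j. card (N u \<inter> B)) + card (A j) * y j \<le> card (A j) * c + 2 ^ c * g * c"
    if j: "j < q" for j
  proof -
    define X where "X = {u \<in> A j. N u \<inter> B \<notin> popular j}"
    have cX: "card X \<le> 2 ^ c * g"
    proof (rule ccontr)
      assume "\<not> ?thesis"
      then have "\<exists>Z\<in>Pow B. g < card {x \<in> X. N x \<inter> B = Z}"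
        using finB c(1) finite_A[OF j]
        by (intro pigeonhole_fibre) (auto simp: X_def card_Pow mult.commute)
      then obtain Z where Z: "Z \<subseteq> B" "g < card {x \<in> X. N x \<inter> B = Z}" by auto
      have "card {x \<in> X. N x \<inter> B = Z} \<le> card (fibre j Z)"
        using finite_A[OF j] by (intro card_mono) (auto simp: X_def fibre_def)
      then have "Z \<in> popular j" using Z by (simp add: popular_def)
      then have "{x \<in> X. N x \<inter> B = Z} = {}" by (auto simp: X_def)
      then show False using Z(2) by (metis card.empty not_less0)
    qed
    have "(\<Sum>u\<in>A j. card (N u \<inter> B)) \<le> (\<Sum>u\<in>A j. card (Y j) + (if u \<in> X then c else 0))"
    proof (rule sum_mono)
      fix u assume u: "u \<in> A j"
      show "card (N u \<inter> B) \<le> card (Y j) + (if u \<in> X then c else 0)"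
      proof (cases "u \<in> X")
        case True
        have "card (N u \<inter> B) \<le> card B" using finB by (intro card_mono) auto
        then show ?thesis using True c(1) by simp
      next
        case False
        then show ?thesis using u Y[OF j] by (auto simp: X_def)
      qed
    qed
    also have "\<dots> = card (A j) * card (Y j) + card X * c"
    proof -
      have "A j \<inter> {u. u \<in> X} = X" by (auto simp: X_def)
      then show ?thesis using finite_A[OF j] by (simp add: sum.distrib sum.If_cases)
    qed
    also have "card X * c \<le> 2 ^ c * g * c" using cX by simp
    finally have "(\<Sum>u\<in>A j. card (N u \<inter> B)) \<le> card (A j) * card (Y j) + 2 ^ c * g * c" by simp
    moreover have "card (A j) * card (Y j) + card (A j) * y j = card (A j) * c"
      using yc[OF j] by (metis add_mult_distrib2)
    ultimately show ?thesis by linarith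
  qed
  define Ys where "Ys = (\<Sum>j<q. y j)"
  have Ys: "Ys \<le> q * c"
    using sum_bounded_above[of "{..<q}" y c] by (simp add: Ys_def y_def)
  have "(\<Sum>v\<in>B. card (N v)) = (\<Sum>v\<in>B. card (N v \<inter> rest)) + (\<Sum>v\<in>B. \<Sum>j<q. card (N v \<inter> A j))"
    using card_split[OF N_subset] by (simp add: sum.distrib)
  also have "(\<Sum>v\<in>B. card (N v \<inter> rest)) \<le> c * card rest"
    using sum_bounded_above[of B "\<lambda>v. card (N v \<inter> rest)" "card rest"] c(1)
    by (simp add: card_mono rest_def)
  also have "(\<Sum>v\<in>B. \<Sum>j<q. card (N v \<inter> A j)) = (\<Sum>j<q. \<Sum>v\<in>B. card (N v \<inter> A j))"
    by (rule sum.swap)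
  also have "\<dots> = (\<Sum>j<q. \<Sum>u\<in>A j. card (N u \<inter> B))"
    using finB finite_A by (intro sum.cong refl sum_card_N_swap) auto
  finally have deg: "(\<Sum>v\<in>B. card (N v)) \<le> c * card rest + (\<Sum>j<q. \<Sum>u\<in>A j. card (N u \<inter> B))"
    by simp
  have "(\<Sum>j<q. (\<Sum>u\<in>A j. card (N u \<inter> B)) + card (A j) * y j) \<le>
      (\<Sum>j<q. card (A j) * c + 2 ^ c * g * c)"
    using class_sum by (intro sum_mono) auto
  then have "(\<Sum>j<q. \<Sum>u\<in>A j. card (N u \<inter> B)) + (\<Sum>j<q. card (A j) * y j) \<le>
      (\<Sum>j<q. card (A j)) * c + q * (2 ^ c * g * c)"
    by (simp add: sum.distrib sum_distrib_right)
  moreover have "card V * c = c * card rest + (\<Sum>j<q. card (A j)) * c"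
    using card_split[of V] A_V by (simp add: rest_def Int_absorb1 Int_absorb2 algebra_simps)
  ultimately have "(\<Sum>v\<in>B. card (N v)) + (\<Sum>j<q. card (A j) * y j) \<le> card V * c + q * (2 ^ c * g * c)"
    using deg by linarith
  then have "q * ((\<Sum>v\<in>B. card (N v)) + (\<Sum>j<q. card (A j) * y j)) \<le> q * (card V * c + q * (2 ^ c * g * c))"
    by (rule mult_le_mono2)
  then have e1: "q * (\<Sum>v\<in>B. card (N v)) + (\<Sum>j<q. q * card (A j) * y j) \<le> q * c * card V + q * q * c * (2 ^ c * g)"
    by (simp add: sum_distrib_left algebra_simps)
  \<comment> \<open>Replaces \<open>q * card (A j)\<close> by \<open>card V\<close>; the loss
    \<open>q * d * Ys\<close> is charged to \<open>g\<close>.\<close>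
  have "(\<Sum>j<q. card V * y j) \<le> (\<Sum>j<q. (q * card (A j) + q * d) * y j)"
    using A_large by (intro sum_mono mult_le_mono1) auto
  then have e2: "card V * Ys \<le> (\<Sum>j<q. q * card (A j) * y j) + q * d * Ys"
    by (simp add: Ys_def sum_distrib_left algebra_simps sum.distrib)
  have "q * d * Ys \<le> q * d * (q * c)" using Ys by simp
  also have "\<dots> \<le> q * g * (q * c)" using g_ge by simp
  also have "\<dots> = q * q * c * g" by simp
  finally have e3: "q * d * Ys \<le> q * q * c * g" .
  have "q * q * c * g + q * q * c * (2 ^ c * g) \<le> q * q * c * g + q * q * c * (2 ^ (q * t) * g)"
    using two by simp
  also have "\<dots> = q * q * c * ((1 + 2 ^ (q * t)) * g)" by (simp add: algebra_simps)
  also have "\<dots> \<le> q * q * (q * t) * ((1 + 2 ^ (q * t)) * g)" using c(2) by (intro mult_le_mono) auto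
  also have "\<dots> = type_error q t * g" by (simp add: type_error_def algebra_simps)
  finally have "q * (\<Sum>v\<in>B. card (N v)) + card V * Ys \<le> q * c * card V + type_error q t * g"
    using e1 e2 e3 by linarith
  then show ?thesis using first unfolding Ys_def by blast
qed

text \<open>For \<open>q * t\<close> exceptional vertices, summing the first inequality over all
  \<open>j0\<close> gives q (q t + 1) + Y <= q t + q Y, hence Y > q t for the total number Y of
  misses. Then q times their degree sum lies below what the minimum degree demands, by n up to
  errors.\<close>

lemma card_bad_less: "card bad < q * t"
proof (rule ccontr)
  assume "\<not> ?thesis"
  then obtain B where B: "B \<subseteq> bad" "card B = q * t" using subset_of_card[of "q * t" bad] by auto
  from popular_neighbourhoods[OF B le_refl] obtain y where
    y: "\<forall>j0<q. q * t + 1 + y j0 \<le> t + (\<Sum>j<q. y j)"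
    and e: "q * (\<Sum>v\<in>B. card (N v)) + card V * (\<Sum>j<q. y j) \<le> q * (q * t) * card V + type_error q t * g"
    by blast
  define Y where "Y = (\<Sum>j<q. y j)"
  have "(\<Sum>j0<q. q * t + 1 + y j0) \<le> (\<Sum>j0<q. t + Y)"
    using y by (intro sum_mono) (auto simp: Y_def)
  moreover have "(\<Sum>j0<q. q * t + 1 + y j0) = q * (q * t + 1) + Y"
    by (simp only: sum.distrib Y_def sum_constant card_lessThan of_nat_id distrib_left)
  ultimately have "q * (q * t + 1) + Y \<le> q * (t + Y)" by simp
  have "q * t + 1 \<le> Y"
  proof (rule ccontr)
    assume "\<not> ?thesis"
    then have "Y \<le> q * t" by simp
    obtain r where r: "q = Suc r" using q_ge by (cases q) auto
    have "r * Y \<le> r * (q * t)" using \<open>Y \<le> q * t\<close> by simp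
    moreover have "q * (q * t + 1) + Y \<le> q * t + r * Y + Y"
      using \<open>q * (q * t + 1) + Y \<le> q * (t + Y)\<close> unfolding r by (simp add: algebra_simps)
    moreover have "q * (q * t + 1) = r * (q * t) + q * t + q" unfolding r by (simp add: algebra_simps)
    ultimately show False using q_ge by linarith
  qed
  then have "card V * (q * t + 1) \<le> card V * Y" by (rule mult_le_mono2)
  moreover have "(\<Sum>v\<in>B. q * card V) \<le> (\<Sum>v\<in>B. q * card (N v) + (card V + q))"
    using dense B(1) bad_V by (intro sum_mono) (force simp: dense_degrees_def)
  then have "q * (q * t) * card V \<le> q * (\<Sum>v\<in>B. card (N v)) + q * t * (card V + q)"
    using B(2) by (simp add: sum.distrib sum_distrib_left algebra_simps)
  ultimately have "card V \<le> q * q * t + type_error q t * g"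
    using e unfolding Y_def by (simp add: algebra_simps)
  also have "q * q * t \<le> q * q * t * g" using g_ge by simp
  finally have "card V < q * q * t * g + type_error q t * g + g" using g_ge by linarith
  also have "\<dots> = (q * q * t + type_error q t + 1) * g" by (simp add: algebra_simps)
  also have "\<dots> \<le> card V" by (rule scale_bound) (simp add: scale_def)
  finally show False by simp
qed

end

text \<open>Cauchy-Schwarz, from the squares of \<open>int q * a j - S\<close>.\<close>

lemma square_of_sum_le:
  fixes a :: "nat \<Rightarrow> int"
  shows "(\<Sum>j<q. a j)\<^sup>2 \<le> int q * (\<Sum>j<q. (a j)\<^sup>2)"
proof (cases "q = 0")
  case False
  define S where "S = (\<Sum>j<q. a j)"
  have "0 \<le> (\<Sum>j<q. (int q * a j - S)\<^sup>2)" by (intro sum_nonneg) auto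
  also have "\<dots> = (\<Sum>j<q. (int q)\<^sup>2 * (a j)\<^sup>2 - 2 * int q * S * a j + S\<^sup>2)"
    by (intro sum.cong refl) (simp add: power2_eq_square algebra_simps)
  also have "\<dots> = (int q)\<^sup>2 * (\<Sum>j<q. (a j)\<^sup>2) - 2 * int q * S * S + int q * S\<^sup>2"
    by (simp add: sum.distrib sum_subtractf S_def flip: sum_distrib_left)
  also have "\<dots> = int q * (int q * (\<Sum>j<q. (a j)\<^sup>2) - S\<^sup>2)"
    by (simp add: power2_eq_square algebra_simps)
  finally show ?thesis using False by (simp add: S_def zero_le_mult_iff)
qed simp

section \<open>Classes of the remaining vertices and the degree count\<close>

context layered begin

text \<open>For a vertex of \<open>A j\<close> the choice is forced (\<open>cls_A\<close>), for
  other vertices outside \<open>bad\<close> any admissible class will do, and on \<open>bad\<close>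
  the value is arbitrary.\<close>

definition cls :: "'a \<Rightarrow> nat" where
  "cls v = (SOME j. j < q \<and> card (N v \<inter> A j) < g)"

lemma cls:
  assumes "v \<in> V - bad"
  shows "cls v < q" "card (N v \<inter> A (cls v)) < g"
proof -
  have "\<exists>j. j < q \<and> card (N v \<inter> A j) < g" using assms by (force simp: bad_def)
  from someI_ex[OF this] show "cls v < q" "card (N v \<inter> A (cls v)) < g"
    by (simp_all add: cls_def)
qed

text \<open>A vertex of \<open>A j\<close> misses at most \<open>d\<close> vertices of any other
  class, so it has at least \<open>g\<close> neighbours there.\<close>

lemma cls_A:
  assumes "j < q" "x \<in> A j"
  shows "cls x = j"
proof (rule ccontr)
  assume ne: "cls x \<noteq> j"
  have x: "x \<in> V - bad" using assms A_V bad_A by blast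
  have "q * (2 * g + d) \<le> q * 4 * g" using g_ge by simp
  also have "\<dots> \<le> card V" by (rule scale_bound) (simp add: scale_def algebra_simps)
  finally have "2 * g \<le> card (A (cls x))" using card_A_ge cls[OF x] by blast
  moreover have "card (A (cls x) - N x) \<le> d"
    using A_miss_A[of "cls x" j x] ne assms cls[OF x] by simp
  moreover have "card (A (cls x)) = card (A (cls x) - N x) + card (N x \<inter> A (cls x))"
    using finite_A[OF cls(1)[OF x]] by (metis Int_commute card_Diff_subset_Int card_mono
        finite_Int inf_le1 le_add_diff_inverse2)
  ultimately show False using cls(2)[OF x] g_ge by linarith
qed

text \<open>The vertex \<open>v\<close> has at most about n / q non-neighbours, and those in
  \<open>A (cls v)\<close> already account for nearly all of them.\<close>

lemma cls_miss:
  assumes v: "v \<in> V - bad" and i: "i < q" "i \<noteq> cls v"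
  shows "card (A i - N v) \<le> 3 * g"
proof -
  let ?A = "A (cls v)"
  note c = cls[OF v]
  have "A i - N v \<subseteq> V - (?A \<union> N v)" using A_V A_disjoint[of i "cls v"] i c by blast
  then have "card (A i - N v) \<le> card (V - (?A \<union> N v))" by (intro card_mono) auto
  moreover have "card (V - (?A \<union> N v)) + card (?A \<union> N v) = card V"
    using A_V[OF c(1)] N_subset[of v] finite_A[OF c(1)]
    by (subst card_Diff_subset) (auto simp: card_mono)
  moreover have "card (?A \<union> N v) + card (N v \<inter> ?A) = card ?A + card (N v)"
    using card_Un_Int[of ?A "N v"] finite_A[OF c(1)] by (simp add: Int_commute)
  ultimately have "card (A i - N v) + card ?A + card (N v) \<le> card V + g" using c(2) by linarith
  then have "q * (card (A i - N v) + card ?A + card (N v)) \<le> q * (card V + g)" by (rule mult_le_mono2)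
  then have "q * card (A i - N v) + q * card ?A + q * card (N v) \<le> q * card V + q * g"
    by (simp add: algebra_simps)
  moreover have "q * card V \<le> q * card (N v) + card V + q"
    using dense v by (simp add: dense_degrees_def)
  ultimately have "q * card (A i - N v) \<le> q + q * d + q * g" using A_large[OF c(1)] by linarith
  also have "\<dots> = q * (1 + d + g)" by (simp add: algebra_simps)
  finally have "card (A i - N v) \<le> 1 + d + g"
    by (subst (asm) nat_mult_le_cancel1) (use q_ge in auto)
  then show ?thesis using g_ge by linarith
qed

definition part :: "nat \<Rightarrow> 'a set" where
  "part j = {v \<in> V - bad. cls v = j}"

lemma part_V: "part j \<subseteq> V" and finite_part [simp]: "finite (part j)"
  by (auto simp: part_def)

lemma part_cover:
  assumes j: "j < q"
  shows "\<exists>X\<subseteq>part j. card X \<le> 2 * t \<and> (\<forall>x\<in>part j - X. N x \<inter> (part j - X) = {})"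
proof (rule cover_if_no_matching[OF part_V])
  fix u w assume uw: "inj_on u {..<t}" "inj_on w {..<t}" "u ` {..<t} \<inter> w ` {..<t} = {}"
    "u ` {..<t} \<union> w ` {..<t} \<subseteq> part j" "\<And>i. i < t \<Longrightarrow> w i \<in> N (u i)"
  show False
  proof (rule no_matching_extension[OF j uw(1-3,5)])
    fix i assume i: "i < q" "i \<noteq> j"
    let ?U = "u ` {..<t} \<union> w ` {..<t}"
    have "q * (g + 2 * t * (3 * g) + d) \<le> q * (2 * t * 3 + 4) * g"
      using g_ge by (simp add: algebra_simps)
    also have "\<dots> \<le> card V" by (rule scale_bound) (simp add: scale_def algebra_simps)
    finally have "g + 2 * t * (3 * g) \<le> card (A i)" using card_A_ge i by blast
    moreover have "card (A i) \<le> card (A i \<inter> (\<Inter>x\<in>?U. N x)) + card ?U * (3 * g)"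
      using uw(4) i finite_A by (intro card_Int_complements cls_miss) (auto simp: part_def)
    moreover have "card ?U \<le> 2 * t" using card_Un_le[of "u ` {..<t}" "w ` {..<t}"]
      card_image_le[of "{..<t}" u] card_image_le[of "{..<t}" w] by auto
    then have "card ?U * (3 * g) \<le> 2 * t * (3 * g)" by (rule mult_le_mono1)
    ultimately have "g \<le> card (A i \<inter> (\<Inter>x\<in>?U. N x))" by linarith
    then show "q * k * d + k \<le> card (A i \<inter> (\<Inter>x\<in>?U. N x))" using g_ge by linarith
  qed
qed

lemma part_degree:
  assumes v: "v \<in> part j" and j: "j < q"
  shows "card (N v \<inter> part j) \<le> (q + 1) * g"
proof -
  have vc: "v \<in> V - bad" "cls v = j" using v by (auto simp: part_def)
  have "part j \<subseteq> A j \<union> rest"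
  proof
    fix x assume x: "x \<in> part j"
    show "x \<in> A j \<union> rest" using x cls_A[of _ x] by (auto simp: part_def rest_def)
  qed
  then have "N v \<inter> part j \<subseteq> (N v \<inter> A j) \<union> rest" by blast
  then have "card (N v \<inter> part j) \<le> card ((N v \<inter> A j) \<union> rest)"
    by (intro card_mono) (auto simp: rest_def)
  also have "\<dots> \<le> card (N v \<inter> A j) + card rest" by (rule card_Un_le)
  also have "\<dots> \<le> g + q * d" using cls(2)[OF vc(1)] card_rest vc(2) by simp
  also have "\<dots> \<le> g + q * g" using g_ge by simp
  finally show ?thesis by simp
qed

text \<open>Every edge inside the part meets the cover \<open>X\<close>, so the sum is at most twice
  the sum over \<open>X\<close>: at most \<open>2 * t\<close> vertices of internal degree at most
  \<open>(q + 1) * g\<close>. The result is of order \<open>g\<close>, not n.\<close>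

lemma part_edges:
  assumes j: "j < q"
  shows "(\<Sum>v\<in>part j. card (N v \<inter> part j)) \<le> 4 * t * (q + 1) * g"
proof -
  obtain X where X: "X \<subseteq> part j" "card X \<le> 2 * t" "\<forall>x\<in>part j - X. N x \<inter> (part j - X) = {}"
    using part_cover[OF j] by blast
  have finX: "finite X" using X(1) finite_part finite_subset by blast
  have "(\<Sum>v\<in>part j - X. card (N v \<inter> part j)) = (\<Sum>v\<in>part j - X. card (N v \<inter> X))"
  proof (intro sum.cong refl arg_cong[of _ _ card])
    fix v assume "v \<in> part j - X"
    then show "N v \<inter> part j = N v \<inter> X" using X(1,3) by blast
  qed
  also have "\<dots> = (\<Sum>v\<in>X. card (N v \<inter> (part j - X)))"
    using finX by (intro sum_card_N_swap) auto
  also have "\<dots> \<le> (\<Sum>v\<in>X. card (N v \<inter> part j))"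
    by (intro sum_mono card_mono) auto
  finally have "(\<Sum>v\<in>part j. card (N v \<inter> part j)) \<le> 2 * (\<Sum>v\<in>X. card (N v \<inter> part j))"
    using sum.subset_diff[OF X(1) finite_part, of "\<lambda>v. card (N v \<inter> part j)"] by linarith
  also have "(\<Sum>v\<in>X. card (N v \<inter> part j)) \<le> card X * ((q + 1) * g)"
    using sum_bounded_above[of X "\<lambda>v. card (N v \<inter> part j)" "(q + 1) * g"] part_degree j X(1) by auto
  also have "\<dots> \<le> 2 * t * ((q + 1) * g)" using X(2) by (rule mult_le_mono1)
  finally show ?thesis by (simp add: algebra_simps)
qed

lemma parts_partition:
  "V - bad = (\<Union>j<q. part j)" "i \<noteq> j \<Longrightarrow> part i \<inter> part j = {}"
  using cls(1) by (auto simp: part_def)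

lemma sum_parts: "(\<Sum>v\<in>V - bad. f v) = (\<Sum>j<q. \<Sum>v\<in>part j. f v)"
  unfolding parts_partition(1) using parts_partition(2) by (intro sum.UNION_disjoint) auto

lemma card_parts: "(\<Sum>j<q. card (part j)) = card V - card bad"
  using sum_parts[of "\<lambda>_. 1::nat"] bad_V by (simp add: card_Diff_subset)

text \<open>The second sum counts the edges between \<open>bad\<close> and the remaining vertices,
  seen from \<open>bad\<close>; they enter the degree sum from both sides.\<close>

lemma degree_sum_le:
  "(\<Sum>v\<in>V. card (N v)) \<le> (\<Sum>v\<in>bad. card (N v)) + (\<Sum>v\<in>bad. card (N v - bad)) +
     (\<Sum>j<q. \<Sum>v\<in>part j. card (N v \<inter> part j) + (card V - card bad - card (part j)))"
proof -
  let ?W = "V - bad"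
  have "(\<Sum>v\<in>V. card (N v)) = (\<Sum>v\<in>?W. card (N v)) + (\<Sum>v\<in>bad. card (N v))"
    using sum.subset_diff[OF bad_V finite_V] by simp
  moreover have "(\<Sum>v\<in>?W. card (N v)) = (\<Sum>v\<in>?W. card (N v \<inter> bad)) + (\<Sum>v\<in>?W. card (N v - bad))"
    unfolding sum.distrib[symmetric] by (intro sum.cong refl card_Int_Diff) auto
  moreover have "(\<Sum>v\<in>?W. card (N v \<inter> bad)) = (\<Sum>v\<in>bad. card (N v \<inter> ?W))"
    by (intro sum_card_N_swap) auto
  moreover have "N v \<inter> ?W = N v - bad" for v using N_subset by blast
  moreover have "(\<Sum>v\<in>?W. card (N v - bad)) \<le>
      (\<Sum>j<q. \<Sum>v\<in>part j. card (N v \<inter> part j) + (card V - card bad - card (part j)))"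
    unfolding sum_parts
  proof (intro sum_mono)
    fix j v assume "j \<in> {..<q}" "v \<in> part j"
    have "N v - bad \<subseteq> (N v \<inter> part j) \<union> (V - bad - part j)" using N_subset by blast
    then have "card (N v - bad) \<le> card ((N v \<inter> part j) \<union> (V - bad - part j))"
      by (intro card_mono) auto
    also have "\<dots> \<le> card (N v \<inter> part j) + card (V - bad - part j)" by (rule card_Un_le)
    also have "part j \<subseteq> V - bad" by (auto simp: part_def)
    then have "card (V - bad - part j) = card V - card bad - card (part j)"
      using bad_V by (simp add: card_Diff_subset)
    finally show "card (N v - bad) \<le> card (N v \<inter> part j) + (card V - card bad - card (part j))" .
  qed
  ultimately show ?thesis by simp
qed

lemma card_part_le: "card (part j) \<le> card V - card bad"
  using card_mono[of "V - bad" "part j"] bad_V by (auto simp: part_def card_Diff_subset)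

lemma sum_cross:
  "int (\<Sum>j<q. card (part j) * (card V - card bad - card (part j))) =
     (int (card V) - int (card bad))\<^sup>2 - (\<Sum>j<q. (int (card (part j)))\<^sup>2)"
proof -
  let ?n = "int (card V) - int (card bad)"
  have b: "card bad \<le> card V" using bad_V by (simp add: card_mono)
  have "int (\<Sum>j<q. card (part j) * (card V - card bad - card (part j))) =
      (\<Sum>j<q. int (card (part j)) * ?n - (int (card (part j)))\<^sup>2)"
  proof -
    have "int (card V - card bad - card (part j)) = ?n - int (card (part j))" for j
      using b card_part_le[of j] by linarith
    then show ?thesis by (simp add: power2_eq_square right_diff_distrib)
  qed
  also have "\<dots> = int (\<Sum>j<q. card (part j)) * ?n - (\<Sum>j<q. (int (card (part j)))\<^sup>2)"
    by (simp add: sum_subtractf sum_distrib_right)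
  also have "int (\<Sum>j<q. card (part j)) = ?n" using card_parts b by (simp add: of_nat_diff)
  finally show ?thesis by (simp add: power2_eq_square)
qed

text \<open>The hypothesis bounds q times the degree sum from below by roughly that of K_{t-1} v T.
  With b exceptional vertices, Cauchy-Schwarz on the part sizes bounds the degree sum from above by
  (1 - 1/q) (n - b)^2 plus twice the degrees in \<open>bad\<close>, up to errors. The terms in n^2
  cancel, and the comparison of the linear ones is the claim.\<close>

lemma bad_degrees_ge:
  assumes "int q * (int t - 1) * (2 * int (card V) - int t) +
      (int q - 1) * (int (card V) - int t + 1)\<^sup>2 - (int q)\<^sup>2 \<le> int q * int (\<Sum>v\<in>V. card (N v))"
  shows "2 * int (card V) * ((int t - 1) + (int q - 1) * int (card bad)) \<le>
      2 * int q * int (\<Sum>v\<in>bad. card (N v)) + int (count_error q t * g)"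
proof -
  define n b DB where "n = int (card V)" and "b = int (card bad)" and "DB = int (\<Sum>v\<in>bad. card (N v))"
  define tt qq where "tt = int t" and "qq = int q"
  have pos: "1 \<le> qq" "1 \<le> tt" using q_ge t_ge by (simp_all add: tt_def qq_def)
  have "(\<Sum>v\<in>bad. card (N v - bad)) \<le> (\<Sum>v\<in>bad. card (N v))"
    by (intro sum_mono card_mono) auto
  moreover have "(\<Sum>j<q. \<Sum>v\<in>part j. card (N v \<inter> part j) + (card V - card bad - card (part j))) =
      (\<Sum>j<q. \<Sum>v\<in>part j. card (N v \<inter> part j)) + (\<Sum>j<q. card (part j) * (card V - card bad - card (part j)))"
    by (simp add: sum.distrib)
  moreover have "(\<Sum>j<q. \<Sum>v\<in>part j. card (N v \<inter> part j)) \<le> q * (4 * t * (q + 1) * g)"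
    using sum_bounded_above[of "{..<q}" "\<lambda>j. \<Sum>v\<in>part j. card (N v \<inter> part j)" "4 * t * (q + 1) * g"]
      part_edges by simp
  ultimately have "(\<Sum>v\<in>V. card (N v)) \<le> 2 * (\<Sum>v\<in>bad. card (N v)) + q * (4 * t * (q + 1) * g) +
      (\<Sum>j<q. card (part j) * (card V - card bad - card (part j)))"
    using degree_sum_le by linarith
  then have "int (\<Sum>v\<in>V. card (N v)) \<le> 2 * DB + int (q * (4 * t * (q + 1) * g)) +
      int (\<Sum>j<q. card (part j) * (card V - card bad - card (part j)))"
    unfolding DB_def by linarith
  then have "int (\<Sum>v\<in>V. card (N v)) \<le> 2 * DB + int (q * (4 * t * (q + 1) * g)) +
      (n - b)\<^sup>2 - (\<Sum>j<q. (int (card (part j)))\<^sup>2)"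
    unfolding sum_cross n_def b_def by linarith
  then have "qq * int (\<Sum>v\<in>V. card (N v)) \<le> qq * (2 * DB + int (q * (4 * t * (q + 1) * g)) +
      (n - b)\<^sup>2 - (\<Sum>j<q. (int (card (part j)))\<^sup>2))"
    using pos by (intro mult_left_mono) auto
  moreover have "(n - b)\<^sup>2 \<le> qq * (\<Sum>j<q. (int (card (part j)))\<^sup>2)"
  proof -
    have "card bad \<le> card V" using bad_V by (simp add: card_mono)
    then have "(\<Sum>j<q. int (card (part j))) = n - b"
      using card_parts unfolding n_def b_def by (metis of_nat_diff of_nat_sum)
    then show ?thesis using square_of_sum_le[of "\<lambda>j. int (card (part j))" q] by (simp add: qq_def)
  qed
  ultimately have "qq * (tt - 1) * (2 * n - tt) + (qq - 1) * (n - tt + 1)\<^sup>2 - qq\<^sup>2 \<le>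
      2 * qq * DB + int (4 * t * q * q * (q + 1) * g) + (qq - 1) * (n - b)\<^sup>2"
    using assms unfolding n_def tt_def qq_def by (simp add: algebra_simps)
  moreover have "(qq - 1) * (n - tt + 1)\<^sup>2 - (qq - 1) * (n - b)\<^sup>2 =
      2 * n * ((qq - 1) * (b - tt + 1)) + (qq - 1) * (tt - 1)\<^sup>2 - (qq - 1) * b\<^sup>2"
    by (simp add: power2_eq_square algebra_simps)
  moreover have "0 \<le> (qq - 1) * (tt - 1)\<^sup>2" using pos by simp
  moreover have "qq * (tt - 1) * (2 * n - tt) = 2 * n * (qq * (tt - 1)) - qq * tt * tt + qq * tt"
    by (simp add: algebra_simps)
  moreover have "2 * n * (qq * (tt - 1)) + 2 * n * ((qq - 1) * (b - tt + 1)) =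
      2 * n * ((tt - 1) + (qq - 1) * b)"
    by (simp add: algebra_simps)
  moreover have "(qq - 1) * b\<^sup>2 \<le> qq * (qq * tt * (qq * tt))"
  proof (rule mult_mono)
    have "b \<le> qq * tt" using card_bad_less
      unfolding b_def qq_def tt_def of_nat_mult[symmetric] by linarith
    then show "b\<^sup>2 \<le> qq * tt * (qq * tt)"
      unfolding power2_eq_square by (intro mult_mono) (auto simp: b_def qq_def tt_def)
  qed (use pos in \<open>auto simp: b_def\<close>)
  moreover have "0 \<le> qq * tt" using pos by simp
  moreover have "int (4 * t * q * q * (q + 1) * g) + qq * tt * tt + qq * (qq * tt * (qq * tt)) + qq\<^sup>2
     \<le> int (count_error q t * g)"
  proof -
    have "1 \<le> g" using g_ge by simp
    then have "(q * t * t + q * (q * t * (q * t)) + q * q) * 1 \<le> (q * t * t + q * (q * t * (q * t)) + q * q) * g"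
      by (rule mult_le_mono2)
    then have "4 * t * q * q * (q + 1) * g + (q * t * t + q * (q * t * (q * t)) + q * q) \<le> count_error q t * g"
      by (simp add: count_error_def algebra_simps)
    then have "int (4 * t * q * q * (q + 1) * g + (q * t * t + q * (q * t * (q * t)) + q * q)) \<le> int (count_error q t * g)"
      by (simp only: of_nat_le_iff)
    then show ?thesis by (simp add: qq_def tt_def power2_eq_square)
  qed
  ultimately have "2 * n * ((tt - 1) + (qq - 1) * b) \<le> 2 * qq * DB + int (count_error q t * g)"
    by linarith
  then show ?thesis by (simp add: n_def tt_def qq_def DB_def b_def)
qed

end

section \<open>Structure under the edge condition\<close>

locale dense_layered = layered +
  assumes many_edges: "int q * (int t - 1) * (2 * int (card V) - int t) +
      (int q - 1) * (int (card V) - int t + 1)\<^sup>2 - (int q)\<^sup>2 \<le> int q * int (\<Sum>v\<in>V. card (N v))"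
begin

lemmas bad_degrees = bad_degrees_ge[OF many_edges]

lemma errors_small: "count_error q t * g + 2 * (type_error q t * g) < card V"
proof -
  have "count_error q t * g + 2 * (type_error q t * g) < (count_error q t + 2 * type_error q t + 1) * g"
    using g_ge by (simp add: algebra_simps)
  also have "\<dots> \<le> card V" by (rule scale_bound) (simp add: scale_def)
  finally show ?thesis .
qed

text \<open>For b exceptional vertices, \<open>bad_degrees\<close> demands that q times their degree
  sum be at least n (q b - (b + 1 - t)) up to errors, while \<open>popular_neighbourhoods\<close>
  permits n (q b - Y). If b >= t, the latter also gives Y >= b + 1 - t, which is one short of a
  contradiction; but then some \<open>y j\<close> is positive, and using this \<open>j\<close> as
  \<open>j0\<close> gains the missing one.\<close>

lemma card_bad_le: "card bad < t"
proof (rule ccontr)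
  assume "\<not> ?thesis"
  then have bt: "t \<le> card bad" by simp
  from popular_neighbourhoods[OF subset_refl refl less_imp_le[OF card_bad_less]] obtain y where
    y: "\<And>j. j < q \<Longrightarrow> card bad + 1 + y j \<le> t + (\<Sum>j<q. y j)"
    and e: "q * (\<Sum>v\<in>bad. card (N v)) + card V * (\<Sum>j<q. y j) \<le> q * card bad * card V + type_error q t * g"
    by blast
  define Y where "Y = (\<Sum>j<q. y j)"
  have "1 \<le> Y" using y[of 0] bt q_ge by (simp add: Y_def)
  then obtain j where "j < q" "1 \<le> y j"
    unfolding Y_def by (metis (no_types, lifting) less_one linorder_not_le lessThan_iff sum.neutral)
  then have "card bad + 2 \<le> t + Y" using y[of j] by (simp add: Y_def)
  then have "int (card bad) + 2 - int t \<le> int Y" by linarith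
  then have "int (card V) * (int (card bad) + 2 - int t) \<le> int (card V) * int Y"
    by (intro mult_left_mono) auto
  moreover have "int (q * (\<Sum>v\<in>bad. card (N v)) + card V * Y) \<le> int (q * card bad * card V + type_error q t * g)"
    using e unfolding Y_def by (simp only: of_nat_le_iff)
  then have "int q * int (\<Sum>v\<in>bad. card (N v)) + int (card V) * int Y \<le>
      int q * int (card bad) * int (card V) + int (type_error q t * g)"
    by simp
  ultimately have "2 * int (card V) * ((int t - 1) + (int q - 1) * int (card bad)) +
      2 * (int (card V) * (int (card bad) + 2 - int t)) \<le>
      2 * (int q * int (card bad) * int (card V)) + 2 * int (type_error q t * g) + int (count_error q t * g)"
    using bad_degrees by linarith
  then have "2 * int (card V) \<le> 2 * int (type_error q t * g) + int (count_error q t * g)"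
    by (simp add: algebra_simps)
  then show False using errors_small by linarith
qed

text \<open>Degrees are at most n, so the demand of \<open>bad_degrees\<close> needs at least
  \<open>t - 1\<close> exceptional vertices. With exactly \<open>t - 1\<close> it is (t - 1) n up to
  errors, which leaves no room for a smaller degree.\<close>

lemma bad_structure:
  shows card_bad: "card bad = t - 1"
    and bad_full: "v \<in> bad \<Longrightarrow> card V \<le> card (N v) + count_error q t * g"
proof -
  let ?n = "int (card V)" and ?b = "int (card bad)"
  have deg: "card (N v) \<le> card V" for v using N_subset by (intro card_mono) auto
  have "(\<Sum>v\<in>bad. card (N v)) \<le> card bad * card V"
    using sum_bounded_above[of bad "\<lambda>v. card (N v)" "card V"] deg by simp
  then have "int (\<Sum>v\<in>bad. card (N v)) \<le> ?b * ?n" by (metis of_nat_le_iff of_nat_mult)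
  then have "int q * int (\<Sum>v\<in>bad. card (N v)) \<le> int q * (?b * ?n)" by (intro mult_left_mono) auto
  then have "2 * ?n * ((int t - 1) + (int q - 1) * ?b) \<le> 2 * (int q * (?b * ?n)) + int (count_error q t * g)"
    using bad_degrees by linarith
  then have "2 * ?n * (int t - 1 - ?b) \<le> int (count_error q t * g)" by (simp add: algebra_simps)
  moreover have ce: "int (count_error q t * g) < ?n" using errors_small by linarith
  ultimately have "2 * ?n * (int t - 1 - ?b) < 2 * ?n * 1" by linarith
  then have "int t - 1 - ?b < 1" by (rule mult_left_less_imp_less) simp
  then have "int t - 1 \<le> ?b" by simp
  with card_bad_le show cb: "card bad = t - 1" by linarith
  show "card V \<le> card (N v) + count_error q t * g" if v: "v \<in> bad"
  proof -
    have cb': "card (bad - {v}) = t - 2" using v cb by (simp add: card_Diff_singleton)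
    have t2: "2 \<le> t" using v cb by (cases "t = 1") (use t_ge in auto)
    have "(\<Sum>v\<in>bad - {v}. card (N v)) \<le> (t - 2) * card V"
      using sum_bounded_above[of "bad - {v}" "\<lambda>v. card (N v)" "card V"] deg cb' by simp
    then have "(\<Sum>v\<in>bad. card (N v)) \<le> card (N v) + (t - 2) * card V"
      using v by (simp add: sum.remove)
    then have "int (\<Sum>v\<in>bad. card (N v)) \<le> int (card (N v) + (t - 2) * card V)"
      by (simp only: of_nat_le_iff)
    also have "\<dots> = int (card (N v)) + (int t - 2) * ?n" using t2 by (simp add: of_nat_diff)
    finally have "int (\<Sum>v\<in>bad. card (N v)) \<le> int (card (N v)) + (int t - 2) * ?n" .
    then have "int q * int (\<Sum>v\<in>bad. card (N v)) \<le> int q * (int (card (N v)) + (int t - 2) * ?n)"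
      by (intro mult_left_mono) auto
    moreover have "?b = int t - 1" using cb t_ge by simp
    ultimately have "2 * ?n * ((int t - 1) + (int q - 1) * (int t - 1)) \<le>
        2 * (int q * (int (card (N v)) + (int t - 2) * ?n)) + int (count_error q t * g)"
      using bad_degrees by simp
    then have "2 * int q * ?n \<le> 2 * int q * int (card (N v)) + int (count_error q t * g)"
      by (simp add: algebra_simps)
    also have "int (count_error q t * g) \<le> 2 * int q * int (count_error q t * g)"
      using q_ge by (simp add: mult_le_cancel_right1 not_less)
    finally have "2 * int q * ?n \<le> 2 * int q * int (card (N v) + count_error q t * g)"
      by (simp add: algebra_simps)
    then have "?n \<le> int (card (N v) + count_error q t * g)"
      using q_ge by (simp add: mult_le_cancel_left)
    then show ?thesis by linarith
  qed
qed

text \<open>An edge inside a part completes a matching of \<open>t - 1\<close> edges from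
  \<open>bad\<close> into \<open>A j\<close>. By \<open>bad_full\<close> the exceptional vertices
  cost few common neighbours, so this matching would extend to a configuration.\<close>

lemma part_independent:
  assumes j: "j < q" and xy: "x \<in> part j" "y \<in> part j"
  shows "y \<notin> N x"
proof
  assume adj: "y \<in> N x"
  let ?m = "(count_error q t + 3) * g"
  have xyB: "x \<notin> bad" "y \<notin> bad" "x \<noteq> y" using xy adj by (auto simp: part_def)
  \<comment> \<open>The partners avoid \<open>x\<close> and \<open>y\<close>, as one of these may
    lie in \<open>A j\<close>.\<close>
  have "\<exists>w. inj_on w bad \<and> (\<forall>v\<in>bad. w v \<in> (N v \<inter> A j) - {x, y})"
  proof (rule distinct_representatives)
    fix v assume "v \<in> bad"
    then have "g \<le> card (N v \<inter> A j)" using j by (auto simp: bad_def)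
    moreover have "card (N v \<inter> A j) - card {x, y} \<le> card ((N v \<inter> A j) - {x, y})"
      by (rule diff_card_le_card_Diff) simp
    moreover have "card {x, y} \<le> 2" by (simp add: card_insert_if)
    ultimately have "card bad \<le> card ((N v \<inter> A j) - {x, y})"
      using g_ge card_bad q_ge by linarith
    then show "finite ((N v \<inter> A j) - {x, y}) \<and> card bad \<le> card ((N v \<inter> A j) - {x, y})" by simp
  qed simp
  then obtain f where f: "inj_on f bad" "\<And>v. v \<in> bad \<Longrightarrow> f v \<in> (N v \<inter> A j) - {x, y}" by blast
  obtain b where b: "bij_betw b {..<t - 1} bad"
    using card_bad bij_betw_iff_card[of "{..<t - 1}" bad] by auto
  have bim: "b ` {..<t - 1} = bad" and binj: "inj_on b {..<t - 1}" using b by (auto simp: bij_betw_def)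
  define u where "u = b(t - 1 := x)"
  define w where "w = (f \<circ> b)(t - 1 := y)"
  have tS: "{..<t} = insert (t - 1) {..<t - 1}" using t_ge by auto
  have uim: "u ` {..<t} = insert x bad" unfolding tS u_def using bim by auto
  have wim: "w ` {..<t} = insert y (f ` bad)" unfolding tS w_def bim[symmetric] by auto
  show False
  proof (rule no_matching_extension[OF j])
    show "inj_on u {..<t}" unfolding tS u_def using binj bim xyB
      by (auto simp: inj_on_def)
    have "inj_on (f \<circ> b) {..<t - 1}" using binj f(1) bim by (intro comp_inj_on) auto
    moreover have "y \<notin> (f \<circ> b) ` {..<t - 1}" unfolding image_comp[symmetric] bim using f(2) by auto
    ultimately show "inj_on w {..<t}" unfolding tS w_def
      by (auto simp: inj_on_def)
    have "f ` bad \<subseteq> A j - {x, y}" using f(2) by auto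
    then show "u ` {..<t} \<inter> w ` {..<t} = {}" unfolding uim wim using bad_A[OF j] xyB by auto
    show "w i \<in> N (u i)" if "i < t" for i
    proof (cases "i = t - 1")
      case True then show ?thesis using adj by (simp add: u_def w_def)
    next
      case False
      then have "b i \<in> bad" using that bim by auto
      then show ?thesis using False f(2) by (simp add: u_def w_def)
    qed
    fix i assume i: "i < q" "i \<noteq> j"
    let ?U = "u ` {..<t} \<union> w ` {..<t}"
    have cU: "card ?U \<le> 2 * t" using card_Un_le[of "u ` {..<t}" "w ` {..<t}"]
      card_image_le[of "{..<t}" u] card_image_le[of "{..<t}" w] by auto
    have miss: "card (A i - N v) \<le> ?m" if "v \<in> ?U" for v
    proof -
      consider "v \<in> {x, y}" | "v \<in> bad" | "v \<in> f ` bad" using \<open>v \<in> ?U\<close> unfolding uim wim by auto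
      then show ?thesis
      proof cases
        case 1
        then have "card (A i - N v) \<le> 3 * g" using xy i by (intro cls_miss) (auto simp: part_def)
        then show ?thesis by (simp add: algebra_simps)
      next
        case 2
        have "A i - N v \<subseteq> V - N v" using A_V[OF i(1)] by auto
        then have "card (A i - N v) \<le> card (V - N v)" by (intro card_mono) auto
        also have "\<dots> = card V - card (N v)" using N_subset by (intro card_Diff_subset) auto
        also have "\<dots> \<le> count_error q t * g" using bad_full[OF 2] by simp
        finally show ?thesis by (simp add: algebra_simps)
      next
        case 3
        then have "v \<in> A j" using f(2) by auto
        then have "card (A i - N v) \<le> d" using A_miss_A[of i j v] i j by simp
        then show ?thesis using g_ge by (simp add: algebra_simps)
      qed
    qed
    have "q * (g + 2 * t * ?m + d) \<le> q * (2 * t * (count_error q t + 3) + 4) * g"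
      using g_ge by (simp add: algebra_simps)
    also have "\<dots> \<le> card V" by (rule scale_bound) (simp add: scale_def)
    finally have "g + 2 * t * ?m \<le> card (A i)" using card_A_ge i by blast
    moreover have "card (A i) \<le> card (A i \<inter> (\<Inter>x\<in>?U. N x)) + card ?U * ?m"
      using miss finite_A[OF i(1)] by (intro card_Int_complements) auto
    moreover have "card ?U * ?m \<le> 2 * t * ?m" using cU by (rule mult_le_mono1)
    ultimately have "g \<le> card (A i \<inter> (\<Inter>x\<in>?U. N x))" by linarith
    then show "q * k * d + k \<le> card (A i \<inter> (\<Inter>x\<in>?U. N x))" using g_ge by linarith
  qed
qed

end

section \<open>The extremal degree sum\<close>

definition turan_part :: "nat \<Rightarrow> nat \<Rightarrow> nat \<Rightarrow> nat" where
  "turan_part q M j = M div q + (if j < M mod q then 1 else 0)"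

lemma turan_part_Suc:
  assumes "j < q"
  shows "turan_part q (Suc M) j = turan_part q M j + (if j = M mod q then 1 else 0)"
  using assms by (auto simp: turan_part_def div_Suc mod_Suc)

lemma card_mod_class:
  assumes "j < q"
  shows "card {v \<in> {..<M}. v mod q = j} = turan_part q M j"
proof (induction M)
  case 0
  then show ?case by (simp add: turan_part_def)
next
  case (Suc M)
  have "{v \<in> {..<Suc M}. v mod q = j} =
      (if j = M mod q then insert M {v \<in> {..<M}. v mod q = j} else {v \<in> {..<M}. v mod q = j})"
    by (auto simp: less_Suc_eq)
  then show ?case using Suc turan_part_Suc[OF assms, of M] by (cases "j = M mod q") auto
qed

text \<open>The degree sum of the Turan graph on \<open>M\<close> vertices is M^2 minus
  this.\<close>

definition turan_squares :: "nat \<Rightarrow> nat \<Rightarrow> int" where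
  "turan_squares q M = (\<Sum>j<q. (int (turan_part q M j))\<^sup>2)"

lemma sum_turan_part: "1 \<le> q \<Longrightarrow> (\<Sum>j<q. turan_part q M j) = M"
proof (induction M)
  case (Suc M)
  have "(\<Sum>j<q. turan_part q (Suc M) j) = (\<Sum>j<q. turan_part q M j + (if j = M mod q then 1 else 0))"
    using turan_part_Suc by (intro sum.cong) auto
  then show ?case using Suc by (simp add: sum.distrib)
qed (simp add: turan_part_def)

lemma turan_squares_Suc:
  assumes "1 \<le> q"
  shows "turan_squares q (Suc M) = turan_squares q M + 2 * int (M div q) + 1"
proof -
  have "turan_squares q (Suc M) = (\<Sum>j<q. (int (turan_part q M j))\<^sup>2 +
      (if j = M mod q then 2 * int (M div q) + 1 else 0))"
    unfolding turan_squares_def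
  proof (intro sum.cong refl)
    fix j assume "j \<in> {..<q}"
    moreover have "turan_part q M (M mod q) = M div q" by (simp add: turan_part_def)
    ultimately show "(int (turan_part q (Suc M) j))\<^sup>2 =
        (int (turan_part q M j))\<^sup>2 + (if j = M mod q then 2 * int (M div q) + 1 else 0)"
      using turan_part_Suc[of j q M] by (auto simp: power2_eq_square algebra_simps)
  qed
  then show ?thesis using assms by (simp add: sum.distrib turan_squares_def)
qed

text \<open>For integral \<open>f\<close> every product is nonnegative, so this converts the sum of
  squares into a measure of imbalance. It both evaluates \<open>turan_squares\<close>, where all
  products vanish, and compares other part sizes with it.\<close>

lemma sum_balance:
  fixes a :: "nat \<Rightarrow> nat" and f :: int
  assumes "(\<Sum>j<q. a j) = M"
  shows "(\<Sum>j<q. (int (a j) - f) * (int (a j) - f - 1)) =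
    (\<Sum>j<q. (int (a j))\<^sup>2) - (2 * f + 1) * int M + int q * (f * (f + 1))"
proof -
  have "(\<Sum>j<q. (int (a j) - f) * (int (a j) - f - 1)) =
      (\<Sum>j<q. (int (a j))\<^sup>2 - (2 * f + 1) * int (a j) + f * (f + 1))"
    by (intro sum.cong refl) (simp add: power2_eq_square algebra_simps)
  also have "\<dots> = (\<Sum>j<q. (int (a j))\<^sup>2) - (2 * f + 1) * (\<Sum>j<q. int (a j)) + int q * (f * (f + 1))"
    by (simp add: sum.distrib sum_subtractf flip: sum_distrib_left)
  also have "(\<Sum>j<q. int (a j)) = int M" unfolding assms[symmetric] by simp
  finally show ?thesis .
qed

lemma turan_squares_eq:
  assumes "1 \<le> q"
  shows "turan_squares q M = (2 * int (M div q) + 1) * int M - int q * (int (M div q) * (int (M div q) + 1))"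
proof -
  have "(\<Sum>j<q. (int (turan_part q M j) - int (M div q)) * (int (turan_part q M j) - int (M div q) - 1)) = 0"
    by (intro sum.neutral) (auto simp: turan_part_def)
  then show ?thesis
    using sum_balance[OF sum_turan_part[OF assms, of M], of "int (M div q)"]
    by (simp add: turan_squares_def)
qed

text \<open>For M = q f + r with remainder r, the left side is exactly M^2 + r (q - r).\<close>

lemma turan_squares_le:
  assumes "1 \<le> q"
  shows "int q * turan_squares q M \<le> (int M)\<^sup>2 + (int q)\<^sup>2"
proof -
  define f r Q where "f = int (M div q)" and "r = int (M mod q)" and "Q = int q"
  have M: "int M = Q * f + r" unfolding f_def r_def Q_def
    by (metis mult_div_mod_eq of_nat_add of_nat_mult)
  have r: "0 \<le> r" "r \<le> Q" using assms mod_less_divisor[of q M] unfolding r_def Q_def by auto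
  have "Q * turan_squares q M = (int M)\<^sup>2 - r\<^sup>2 + Q * r"
    unfolding turan_squares_eq[OF assms] M f_def[symmetric] Q_def[symmetric]
    by (simp add: power2_eq_square algebra_simps)
  moreover have "Q * r \<le> Q\<^sup>2" using r by (simp add: power2_eq_square mult_left_mono)
  moreover have "0 \<le> r\<^sup>2" by simp
  ultimately show ?thesis unfolding Q_def by linarith
qed

lemma bij_betw_of_equal_fibres:
  fixes col :: "'a \<Rightarrow> 'c" and col' :: "'b \<Rightarrow> 'c"
  assumes fin: "finite V" "finite V'"
    and eq: "\<And>i. card {x \<in> V. col x = i} = card {y \<in> V'. col' y = i}"
  shows "\<exists>f. bij_betw f V V' \<and> (\<forall>x\<in>V. col' (f x) = col x)"
proof -
  have "\<exists>h. bij_betw h {x \<in> V. col x = i} {y \<in> V'. col' y = i}" for i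
    using eq[of i] fin by (subst bij_betw_iff_card) auto
  then obtain h where h: "\<And>i. bij_betw (h i) {x \<in> V. col x = i} {y \<in> V'. col' y = i}" by metis
  define f where "f x = h (col x) x" for x
  have f: "f x \<in> V' \<and> col' (f x) = col x" if "x \<in> V" for x
    using bij_betw_apply[OF h[of "col x"], of x] that by (simp add: f_def)
  have "inj_on f V"
  proof (rule inj_onI)
    fix x y assume xy: "x \<in> V" "y \<in> V" "f x = f y"
    then have c: "col x = col y" using f by metis
    then have "h (col x) x = h (col x) y" using xy by (simp add: f_def)
    then show "x = y" using bij_betw_imp_inj_on[OF h[of "col x"]] xy c by (auto dest: inj_onD)
  qed
  moreover have "f ` V = V'"
  proof (intro equalityI subsetI)
    fix y assume y: "y \<in> V'"
    then have "y \<in> h (col' y) ` {x \<in> V. col x = col' y}"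
      using bij_betw_imp_surj_on[OF h[of "col' y"]] by auto
    then obtain x where "y = h (col' y) x" "x \<in> V" "col x = col' y" by blast
    then have "y = f x" "x \<in> V" by (simp_all add: f_def)
    then show "y \<in> f ` V" by blast
  qed (use f in auto)
  ultimately show ?thesis using f by (auto simp: bij_betw_def)
qed

text \<open>A copy of \<open>K\<^sub>b \<or> T\<^bsub>M,q\<^esub>\<close>: the vertices coloured \<open>q\<close> form \<open>K\<^sub>b\<close>, the colours below \<open>q\<close>
  are the parts of the Turan graph.\<close>

definition turan_join :: "'a set \<Rightarrow> ('a \<Rightarrow> 'a set) \<Rightarrow> nat \<Rightarrow> nat \<Rightarrow> bool" where
  "turan_join V N b q \<longleftrightarrow> (\<exists>col. (\<forall>x\<in>V. col x \<le> q) \<and> card {x \<in> V. col x = q} = b \<and>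
     (\<forall>j<q. card {x \<in> V. col x = j} = turan_part q (card V - b) j) \<and>
     (\<forall>x\<in>V. \<forall>y\<in>V. y \<in> N x \<longleftrightarrow> x \<noteq> y \<and> (col x \<noteq> col y \<or> col x = q)))"

lemma turan_join_iso:
  assumes V: "finite V" "turan_join V N b q" and V': "finite V'" "turan_join V' N' b q"
    and card: "card V = card V'"
  shows "\<exists>f. bij_betw f V V' \<and> (\<forall>x\<in>V. \<forall>y\<in>V. y \<in> N x \<longleftrightarrow> f y \<in> N' (f x))"
proof -
  obtain col where c: "\<forall>x\<in>V. col x \<le> q" "card {x \<in> V. col x = q} = b"
    "\<forall>j<q. card {x \<in> V. col x = j} = turan_part q (card V - b) j"
    "\<forall>x\<in>V. \<forall>y\<in>V. y \<in> N x \<longleftrightarrow> x \<noteq> y \<and> (col x \<noteq> col y \<or> col x = q)"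
    using V(2) unfolding turan_join_def by blast
  obtain col' where c': "\<forall>x\<in>V'. col' x \<le> q" "card {x \<in> V'. col' x = q} = b"
    "\<forall>j<q. card {x \<in> V'. col' x = j} = turan_part q (card V' - b) j"
    "\<forall>x\<in>V'. \<forall>y\<in>V'. y \<in> N' x \<longleftrightarrow> x \<noteq> y \<and> (col' x \<noteq> col' y \<or> col' x = q)"
    using V'(2) unfolding turan_join_def by blast
  have "card {x \<in> V. col x = i} = card {y \<in> V'. col' y = i}" for i
  proof -
    consider "i < q" | "i = q" | "q < i" by linarith
    then show ?thesis
    proof cases
      case 3
      then have "{x \<in> V. col x = i} = {}" "{y \<in> V'. col' y = i} = {}" using c(1) c'(1) by auto
      then show ?thesis by (simp only: card.empty)
    qed (use c c' card in auto)
  qed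
  then obtain f where f: "bij_betw f V V'" "\<forall>x\<in>V. col' (f x) = col x"
    using bij_betw_of_equal_fibres[OF V(1) V'(1), of col col'] by blast
  have "y \<in> N x \<longleftrightarrow> f y \<in> N' (f x)" if "x \<in> V" "y \<in> V" for x y
  proof -
    have "f x \<in> V'" "f y \<in> V'" "f x = f y \<longleftrightarrow> x = y"
      using f(1) that by (auto simp: bij_betw_def inj_on_def)
    moreover have "col' (f x) = col x" "col' (f y) = col y" using f(2) that by auto
    ultimately show ?thesis using c(4) c'(4) that by simp
  qed
  then show ?thesis using f(1) by blast
qed

text \<open>Twice the number of edges of \<open>K\<^sub>b \<or> T\<^bsub>n-b,q\<^esub>\<close>.\<close>

definition degree_target :: "nat \<Rightarrow> nat \<Rightarrow> nat \<Rightarrow> int" where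
  "degree_target q b n = int b * (int n - 1) + int n * int (n - b) - turan_squares q (n - b)"

text \<open>The increment is twice the degree of a vertex added to a smallest part. Half of it is
  therefore the degree below which the progressive induction deletes.\<close>

lemma degree_target_Suc:
  assumes "1 \<le> q" "b \<le> n"
  shows "degree_target q b (Suc n) = degree_target q b n + 2 * (int n - int ((n - b) div q))"
  using turan_squares_Suc[OF assms(1), of "n - b"] assms(2)
  by (simp add: degree_target_def Suc_diff_le of_nat_diff algebra_simps)

context sgraph
begin

lemma sum_colour_classes:
  fixes h :: "'a \<Rightarrow> 'c :: comm_monoid_add"
  assumes col: "\<And>x. x \<in> V \<Longrightarrow> col x \<le> (q :: nat)"
  shows "(\<Sum>x\<in>V. h x) = (\<Sum>x | x \<in> V \<and> col x = q. h x) + (\<Sum>j<q. \<Sum>x | x \<in> V \<and> col x = j. h x)"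
proof -
  have "(\<Sum>x\<in>V. h x) = (\<Sum>j\<in>insert q {..<q}. \<Sum>x | x \<in> V \<and> col x = j. h x)"
    using col by (intro sum.group[symmetric]) (auto simp: le_less)
  then show ?thesis by simp
qed

text \<open>The summand is the degree \<open>x\<close> would have if colour \<open>q\<close> were a
  clique, all other colours independent, and all differently coloured pairs adjacent.\<close>

lemma colour_degrees:
  fixes col :: "'a \<Rightarrow> nat"
  assumes col: "\<And>x. x \<in> V \<Longrightarrow> col x \<le> q" and b: "card {x \<in> V. col x = q} = b"
  shows "(\<Sum>x\<in>V. int (if col x = q then card V - 1 else card V - card {y \<in> V. col y = col x})) =
      int b * (int (card V) - 1) + int (card V) * int (card V - b) - (\<Sum>j<q. (int (card {x \<in> V. col x = j}))\<^sup>2)"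
    and "(\<Sum>j<q. card {x \<in> V. col x = j}) = card V - b"
proof -
  define P where "P j = {x \<in> V. col x = j}" for j
  have P: "finite (P j)" "P j \<subseteq> V" "card (P j) \<le> card V" for j by (auto simp: P_def intro: card_mono)
  have split: "(\<Sum>x\<in>V. h x) = (\<Sum>x\<in>P q. h x) + (\<Sum>j<q. \<Sum>x\<in>P j. h x)" for h :: "'a \<Rightarrow> int"
    unfolding P_def by (rule sum_colour_classes[OF col])
  have "card V = b + (\<Sum>j<q. card (P j))"
    using sum_colour_classes[of col q "\<lambda>_. 1::nat", OF col] b by (simp add: P_def)
  then show part: "(\<Sum>j<q. card {x \<in> V. col x = j}) = card V - b" by (simp add: P_def)
  have "(\<Sum>x\<in>P q. int (if col x = q then card V - 1 else card V - card {y \<in> V. col y = col x})) =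
      int b * (int (card V) - 1)"
  proof (cases "V = {}")
    case False
    then have "1 \<le> card V" by (simp add: Suc_leI card_gt_0_iff)
    then show ?thesis using b by (simp add: P_def of_nat_diff)
  qed (use b in \<open>simp add: P_def\<close>)
  moreover have "(\<Sum>x\<in>P j. int (if col x = q then card V - 1 else card V - card {y \<in> V. col y = col x})) =
      int (card V) * int (card (P j)) - (int (card (P j)))\<^sup>2" if "j < q" for j
  proof -
    have "(\<Sum>x\<in>P j. int (if col x = q then card V - 1 else card V - card {y \<in> V. col y = col x})) =
        (\<Sum>x\<in>P j. int (card V - card (P j)))"
      using that by (intro sum.cong) (auto simp: P_def)
    then show ?thesis using P(3)[of j] by (simp add: of_nat_diff power2_eq_square algebra_simps)
  qed
  moreover have "(\<Sum>j<q. int (card (P j))) = int (card V - b)" using part by (simp add: P_def flip: of_nat_sum)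
  ultimately show "(\<Sum>x\<in>V. int (if col x = q then card V - 1 else card V - card {y \<in> V. col y = col x})) =
      int b * (int (card V) - 1) + int (card V) * int (card V - b) - (\<Sum>j<q. (int (card {x \<in> V. col x = j}))\<^sup>2)"
    unfolding split P_def[symmetric]
    by (simp add: sum_subtractf flip: sum_distrib_left)
qed

lemma turan_join_degree_sum:
  assumes "turan_join V N b q"
  shows "int (\<Sum>x\<in>V. card (N x)) = degree_target q b (card V)"
proof -
  obtain col where c: "\<forall>x\<in>V. col x \<le> q" "card {x \<in> V. col x = q} = b"
    "\<forall>j<q. card {x \<in> V. col x = j} = turan_part q (card V - b) j"
    "\<forall>x\<in>V. \<forall>y\<in>V. y \<in> N x \<longleftrightarrow> x \<noteq> y \<and> (col x \<noteq> col y \<or> col x = q)"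
    using assms unfolding turan_join_def by blast
  have "card (N x) = (if col x = q then card V - 1 else card V - card {y \<in> V. col y = col x})"
    if x: "x \<in> V" for x
  proof (cases "col x = q")
    case True
    then have "N x = V - {x}" using c(4) x N_subset by auto
    then show ?thesis using x True by simp
  next
    case False
    then have "N x = V - {y \<in> V. col y = col x}" using c(4) x N_subset[of x] by (auto; metis)
    then show ?thesis using False by (simp add: card_Diff_subset)
  qed
  then have "int (\<Sum>x\<in>V. card (N x)) =
      (\<Sum>x\<in>V. int (if col x = q then card V - 1 else card V - card {y \<in> V. col y = col x}))"
    by (simp add: of_nat_sum)
  also have "\<dots> = int b * (int (card V) - 1) + int (card V) * int (card V - b) -
      (\<Sum>j<q. (int (card {x \<in> V. col x = j}))\<^sup>2)"
    using c(1,2) by (intro colour_degrees) auto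
  also have "(\<Sum>j<q. (int (card {x \<in> V. col x = j}))\<^sup>2) = turan_squares q (card V - b)"
    using c(3) by (simp add: turan_squares_def)
  finally show ?thesis by (simp add: degree_target_def)
qed

text \<open>With \<open>f = \<lfloor>M/q\<rfloor>\<close>, every term of \<open>\<Sum> (a\<^sub>j - f) (a\<^sub>j - f - 1)\<close> is nonnegative, and
  it vanishes iff the part sizes \<open>a\<^sub>j\<close> are balanced.\<close>

lemma turan_joinI:
  fixes col :: "'a \<Rightarrow> nat"
  assumes q: "1 \<le> q" and col: "\<And>x. x \<in> V \<Longrightarrow> col x \<le> q" and b: "card {x \<in> V. col x = q} = b"
    and indep: "\<And>x y. x \<in> V \<Longrightarrow> y \<in> V \<Longrightarrow> y \<in> N x \<Longrightarrow> col x \<noteq> col y \<or> col x = q"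
    and many: "degree_target q b (card V) \<le> int (\<Sum>x\<in>V. card (N x))"
  shows "turan_join V N b q"
proof -
  define P where "P j = {x \<in> V. col x = j}" for j
  define M f where "M = card V - b" and "f = M div q"
  \<comment> \<open>The largest neighbourhood the colouring permits. Equality of degree sums will
    force \<open>N x = full x\<close> and balanced parts at the same time.\<close>
  define full where "full x = (if col x = q then V - {x} else V - P (col x))" for x
  have finf: "finite (full x)" for x by (simp add: full_def)
  have Nfull: "N x \<subseteq> full x" if x: "x \<in> V" for x
  proof
    fix y assume y: "y \<in> N x"
    then have "y \<in> V" "y \<noteq> x" using N_subset by auto
    then show "y \<in> full x" using indep[OF x \<open>y \<in> V\<close> y] by (auto simp: full_def P_def)
  qed
  have cfull: "card (full x) = (if col x = q then card V - 1 else card V - card {y \<in> V. col y = col x})"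
    if "x \<in> V" for x
    using that by (simp add: full_def P_def card_Diff_subset)
  have "(\<Sum>x\<in>V. int (card (full x))) =
      (\<Sum>x\<in>V. int (if col x = q then card V - 1 else card V - card {y \<in> V. col y = col x}))"
    using cfull by simp
  then have sumfull: "int (\<Sum>x\<in>V. card (full x)) =
      int b * (int (card V) - 1) + int (card V) * int M - (\<Sum>j<q. (int (card (P j)))\<^sup>2)"
    using colour_degrees(1)[of col q, OF col b] by (simp add: P_def M_def)
  have sumP: "(\<Sum>j<q. card (P j)) = M"
    using colour_degrees(2)[of col q, OF col b] by (simp add: P_def M_def)
  have le: "(\<Sum>x\<in>V. card (N x)) \<le> (\<Sum>x\<in>V. card (full x))"
    using Nfull finf by (intro sum_mono card_mono)
  have fin0: "0 \<le> (int (card (P j)) - int f) * (int (card (P j)) - int f - 1)" for j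
    by (cases "card (P j) \<le> f") (auto intro: mult_nonpos_nonpos)
  have bal: "(\<Sum>j<q. (int (card (P j)) - int f) * (int (card (P j)) - int f - 1)) =
      (\<Sum>j<q. (int (card (P j)))\<^sup>2) - turan_squares q M"
    using sum_balance[OF sumP, of "int f"] turan_squares_eq[OF q, of M] by (simp add: f_def)
  moreover have "0 \<le> (\<Sum>j<q. (int (card (P j)) - int f) * (int (card (P j)) - int f - 1))"
    using fin0 by (intro sum_nonneg) auto
  moreover have "(\<Sum>j<q. (int (card (P j)))\<^sup>2) \<le> turan_squares q M"
    using many le sumfull unfolding degree_target_def M_def[symmetric] by linarith
  ultimately have zero: "(\<Sum>j<q. (int (card (P j)) - int f) * (int (card (P j)) - int f - 1)) = 0"
    and sq: "(\<Sum>j<q. (int (card (P j)))\<^sup>2) = turan_squares q M" by linarith+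
  have "int (\<Sum>x\<in>V. card (full x)) \<le> int (\<Sum>x\<in>V. card (N x))"
    using many sumfull sq unfolding degree_target_def M_def[symmetric] by linarith
  then have "(\<Sum>x\<in>V. card (full x)) \<le> (\<Sum>x\<in>V. card (N x))" by (simp only: of_nat_le_iff)
  then have "(\<Sum>x\<in>V. card (full x)) = (\<Sum>x\<in>V. card (N x))" using le by simp
  then have N_eq: "N x = full x" if x: "x \<in> V" for x
    using sum_mono_inv[of "\<lambda>x. card (N x)" V "\<lambda>x. card (full x)"] Nfull finf x
    by (metis card_mono card_subset_eq finite_V)
  have vals: "card (P j) = f \<or> card (P j) = f + 1" if "j < q" for j
  proof -
    have "(int (card (P j)) - int f) * (int (card (P j)) - int f - 1) = 0"
      using zero fin0 that by (subst (asm) sum_nonneg_eq_0_iff) auto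
    then show ?thesis by auto
  qed
  define J where "J = {j \<in> {..<q}. card (P j) = f + 1}"
  have "M = (\<Sum>j<q. f + (if j \<in> J then 1 else 0))"
    unfolding sumP[symmetric] using vals by (intro sum.cong) (auto simp: J_def)
  also have "\<dots> = q * f + card J"
  proof -
    have "{..<q} \<inter> {j. j \<in> J} = J" by (auto simp: J_def)
    then show ?thesis by (simp add: sum.distrib sum.If_cases)
  qed
  finally have cJ: "card J = M mod q" using mult_div_mod_eq[of q M] unfolding f_def by linarith
  have Jle: "M mod q < q" using q by simp
  have "card {j \<in> {..<q}. card (P j) = i} = card {j \<in> {..<q}. turan_part q M j = i}" for i
  proof -
    have t: "{j \<in> {..<q}. turan_part q M j = i} =
        (if i = f + 1 then {..<M mod q} else if i = f then {..<q} - {..<M mod q} else {})"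
      using Jle by (auto simp: turan_part_def f_def)
    have p: "{j \<in> {..<q}. card (P j) = i} = (if i = f + 1 then J else if i = f then {..<q} - J else {})"
      using vals by (auto simp: J_def)
    have "J \<subseteq> {..<q}" by (auto simp: J_def)
    then show ?thesis unfolding t p using cJ Jle by (simp add: card_Diff_subset finite_subset)
  qed
  \<comment> \<open>\<open>turan_join\<close> prescribes which parts are the larger ones, so the
    colours have to be permuted.\<close>
  then obtain s where s: "bij_betw s {..<q} {..<q}" "\<forall>j\<in>{..<q}. turan_part q M (s j) = card (P j)"
    using bij_betw_of_equal_fibres[of "{..<q}" "{..<q}" "\<lambda>j. card (P j)" "turan_part q M"] by blast
  define col' where "col' x = (if col x = q then q else s (col x))" for x
  have slt: "s j < q" if "j < q" for j using bij_betw_apply[OF s(1)] that by simp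
  have sinj: "s i = s j \<longleftrightarrow> i = j" if "i < q" "j < q" for i j
    using bij_betw_imp_inj_on[OF s(1)] that by (auto simp: inj_on_def)
  have colq: "col x < q \<or> col x = q" if "x \<in> V" for x using col[OF that] by auto
  show ?thesis
    unfolding turan_join_def
  proof (intro exI[of _ col'] conjI ballI allI impI)
    fix x assume "x \<in> V"
    then show "col' x \<le> q" using colq[of x] slt[of "col x"] by (auto simp: col'_def)
  next
    have "col' x = q \<longleftrightarrow> col x = q" if "x \<in> V" for x
      using colq[OF that] slt[of "col x"] by (auto simp: col'_def)
    then have "{x \<in> V. col' x = q} = {x \<in> V. col x = q}" by blast
    then show "card {x \<in> V. col' x = q} = b" using b by simp
  next
    fix j assume j: "j < q"
    then have "j \<in> s ` {..<q}" using bij_betw_imp_surj_on[OF s(1)] by simp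
    then obtain i where i: "i < q" "s i = j" by auto
    have "col' x = j \<longleftrightarrow> col x = i" if "x \<in> V" for x
      using colq[OF that] sinj[of "col x" i] i j by (auto simp: col'_def)
    then have "{x \<in> V. col' x = j} = P i" unfolding P_def by blast
    then show "card {x \<in> V. col' x = j} = turan_part q (card V - b) j"
      using s(2) i by (auto simp: M_def)
  next
    fix x y assume xy: "x \<in> V" "y \<in> V"
    have "y \<in> N x \<longleftrightarrow> x \<noteq> y \<and> (col x \<noteq> col y \<or> col x = q)"
      unfolding N_eq[OF xy(1)] using xy by (auto simp: full_def P_def)
    moreover have "col' x \<noteq> col' y \<or> col' x = q \<longleftrightarrow> col x \<noteq> col y \<or> col x = q"
      using colq[OF xy(1)] colq[OF xy(2)] slt[of "col x"] slt[of "col y"] sinj[of "col x" "col y"]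
      by (auto simp: col'_def)
    ultimately show "y \<in> N x \<longleftrightarrow> x \<noteq> y \<and> (col' x \<noteq> col' y \<or> col' x = q)" by blast
  qed
qed

end

section \<open>Progressive induction\<close>

context dense_layered
begin

lemma turan_join_if_dense:
  assumes "degree_target q (t - 1) (card V) \<le> int (\<Sum>v\<in>V. card (N v))"
  shows "turan_join V N (t - 1) q"
proof -
  define col where "col x = (if x \<in> bad then q else cls x)" for x
  have colq: "col x = q \<longleftrightarrow> x \<in> bad" if "x \<in> V" for x
    using cls(1)[of x] that by (auto simp: col_def)
  then have cb: "{x \<in> V. col x = q} = bad" using bad_V by blast
  show ?thesis
  proof (rule turan_joinI[of q col])
    show "1 \<le> q" by (rule q_ge)
    show "col x \<le> q" if "x \<in> V" for x using cls(1)[of x] that by (auto simp: col_def)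
    show "card {x \<in> V. col x = q} = t - 1" unfolding cb by (rule card_bad)
    show "col x \<noteq> col y \<or> col x = q" if xy: "x \<in> V" "y \<in> V" "y \<in> N x" for x y
    proof (rule ccontr)
      assume n: "\<not> ?thesis"
      then have "x \<notin> bad" "y \<notin> bad" using colq xy by metis+
      then have "x \<in> part (cls x)" "y \<in> part (cls x)" "cls x < q"
        using n xy cls(1)[of x] by (auto simp: col_def part_def)
      then show False using part_independent xy(3) by blast
    qed
  qed (rule assms)
qed

end

text \<open>Brings the target into the form of \<open>many_edges\<close>, free of
  \<open>div\<close>; the term q^2 pays for the rounding of the part sizes.\<close>

lemma degree_target_ge:
  assumes q: "1 \<le> q" and t: "1 \<le> t" "t \<le> n"
  shows "int q * (int t - 1) * (2 * int n - int t) + (int q - 1) * (int n - int t + 1)\<^sup>2 - (int q)\<^sup>2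
    \<le> int q * degree_target q (t - 1) n"
proof -
  have M: "int (n - (t - 1)) = int n - int t + 1" using t by linarith
  have "int q * degree_target q (t - 1) n = int q * (int t - 1) * (int n - 1) +
      int q * int n * (int n - int t + 1) - int q * turan_squares q (n - (t - 1))"
    using t unfolding degree_target_def M by (simp add: of_nat_diff algebra_simps)
  moreover have "int q * turan_squares q (n - (t - 1)) \<le> (int n - int t + 1)\<^sup>2 + (int q)\<^sup>2"
    using turan_squares_le[OF q, of "n - (t - 1)"] unfolding M .
  moreover have "int q * (int t - 1) * (int n - 1) + int q * int n * (int n - int t + 1) =
      int q * (int t - 1) * (2 * int n - int t) + int q * (int n - int t + 1)\<^sup>2"
    by (simp add: power2_eq_square algebra_simps)
  ultimately show ?thesis by (simp add: left_diff_distrib)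
qed

text \<open>The degree bound is the minimum degree of K_{t-1} v T on \<open>card V\<close> vertices,
  attained in a largest part.\<close>

lemma turan_join_if_min_degree:
  assumes q: "1 \<le> q" and t: "1 \<le> t"
  shows "\<exists>n0. \<forall>V (N :: 'a \<Rightarrow> 'a set). sgraph V N \<longrightarrow> n0 \<le> card V \<longrightarrow> \<not> config N q t k \<longrightarrow>
    (\<forall>v\<in>V. card V \<le> card (N v) + 1 + (card V - t) div q) \<longrightarrow>
    degree_target q (t - 1) (card V) \<le> int (\<Sum>v\<in>V. card (N v)) \<longrightarrow> turan_join V N (t - 1) q"
proof -
  \<comment> \<open>With g = G (d + 1) the condition \<open>g_ge\<close> holds for every
    \<open>d\<close>. So \<open>G\<close> can enter the factor \<open>E\<close> of
    \<open>layers_exist\<close> before \<open>d\<close> is known, and \<open>scale q t * g\<close>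
    fits into \<open>V\<close>.\<close>
  define G where "G = q * k + k + 2 * t + q + 2"
  obtain n1 where n1: "\<And>V N. sgraph V (N :: 'a \<Rightarrow> 'a set) \<Longrightarrow> n1 \<le> card V \<Longrightarrow> dense_degrees q V N \<Longrightarrow>
    \<not> config N q t k \<Longrightarrow> \<exists>A d. layers V N q A d \<and> scale q t * G * (d + 1) \<le> card V"
    using layers_exist[OF q t, of k "scale q t * G"] by blast
  show ?thesis
  proof (intro exI[of _ "n1 + t"] allI impI)
    fix V and N :: "'a \<Rightarrow> 'a set"
    assume sg: "sgraph V N" and n: "n1 + t \<le> card V" and nc: "\<not> config N q t k"
      and md: "\<forall>v\<in>V. card V \<le> card (N v) + 1 + (card V - t) div q"
      and many: "degree_target q (t - 1) (card V) \<le> int (\<Sum>v\<in>V. card (N v))"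
    have dd: "dense_degrees q V N"
      unfolding dense_degrees_def
    proof
      fix v assume "v \<in> V"
      then have "q * card V \<le> q * (card (N v) + 1 + (card V - t) div q)"
        using md mult_le_mono2 by blast
      moreover have "q * ((card V - t) div q) \<le> card V" by (meson diff_le_self le_trans times_div_less_eq_dividend)
      ultimately show "q * card V \<le> q * card (N v) + card V + q" by (simp add: algebra_simps)
    qed
    obtain A d where A: "layers V N q A d" "scale q t * G * (d + 1) \<le> card V"
      using n1[OF sg _ dd nc] n by auto
    have "int q * (int t - 1) * (2 * int (card V) - int t) + (int q - 1) * (int (card V) - int t + 1)\<^sup>2 - (int q)\<^sup>2
        \<le> int q * degree_target q (t - 1) (card V)"
      using degree_target_ge[OF q t] n by simp
    also have "\<dots> \<le> int q * int (\<Sum>v\<in>V. card (N v))" using many by (intro mult_left_mono) auto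
    finally have me: "int q * (int t - 1) * (2 * int (card V) - int t) +
        (int q - 1) * (int (card V) - int t + 1)\<^sup>2 - (int q)\<^sup>2 \<le> int q * int (\<Sum>v\<in>V. card (N v))" .
    interpret dense_layered V N A q t k d "G * (d + 1)"
    proof (intro dense_layered.intro layered.intro layered_axioms.intro dense_layered_axioms.intro)
      show "q * k * d + k + t * d + d + t + q + 1 \<le> G * (d + 1)"
        by (simp add: G_def algebra_simps)
      show "scale q t * (G * (d + 1)) \<le> card V" using A(2) by (simp only: mult.assoc)
    qed (fact sg A(1) dd nc q t me)+
    show "turan_join V N (t - 1) q" using many by (rule turan_join_if_dense)
  qed
qed

lemma config_mono:
  assumes "config N' q t k" "\<And>x. N' x \<subseteq> N x"
  shows "config N q t k"
proof -
  from assms(1) obtain C u w j0 where c: "blowup N' q k C" "j0 < q" "inj_on u {..<t}" "inj_on w {..<t}"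
    "u ` {..<t} \<inter> w ` {..<t} = {}" "(u ` {..<t} \<union> w ` {..<t}) \<inter> C j0 = {}"
    "\<forall>i<t. w i \<in> N' (u i)"
    "\<forall>j<q. j \<noteq> j0 \<longrightarrow> (\<forall>x\<in>u ` {..<t} \<union> w ` {..<t}. C j \<subseteq> N' x)"
    unfolding config_def by (elim exE conjE)
  show ?thesis
  proof (rule configI)
    show "blowup N q k C" using c(1) assms(2) unfolding blowup_def by (meson subset_trans)
    show "w i \<in> N (u i)" if "i < t" for i using c(7) assms(2) that by blast
    show "C j \<subseteq> N x" if "j < q" "j \<noteq> j0" "x \<in> u ` {..<t} \<union> w ` {..<t}" for j x
      using c(8) assms(2) that by (meson subset_trans)
  qed (fact c)+
qed

definition delete_vertex :: "('a \<Rightarrow> 'a set) \<Rightarrow> 'a \<Rightarrow> 'a \<Rightarrow> 'a set" where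
  "delete_vertex N v x = (if x = v then {} else N x - {v})"

lemma (in sgraph) sgraph_delete_vertex: "sgraph (V - {v}) (delete_vertex N v)"
  using N_subset N_sym by unfold_locales (auto simp: delete_vertex_def split: if_splits)

lemma (in sgraph) degree_sum_delete_vertex:
  assumes "v \<in> V"
  shows "(\<Sum>x\<in>V. card (N x)) = (\<Sum>x\<in>V - {v}. card (delete_vertex N v x)) + 2 * card (N v)"
proof -
  have "card (N x) = card (delete_vertex N v x) + card (N x \<inter> {v})" if "x \<in> V - {v}" for x
    using that card_Int_Diff[of "N x" "{v}"] by (simp add: delete_vertex_def)
  then have "(\<Sum>x\<in>V - {v}. card (N x)) =
      (\<Sum>x\<in>V - {v}. card (delete_vertex N v x)) + (\<Sum>x\<in>V - {v}. card (N x \<inter> {v}))"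
    by (simp add: sum.distrib)
  moreover have "(\<Sum>x\<in>V - {v}. card (N x \<inter> {v})) = card (N v \<inter> (V - {v}))"
    using sum_card_N_swap[of "V - {v}" "{v}"] by simp
  moreover have "N v \<inter> (V - {v}) = N v" using N_subset[of v] by auto
  ultimately show ?thesis using assms by (simp add: sum.remove)
qed

text \<open>Deleting a vertex of too small degree increases the excess of the degree sum over its target,
  so that starting from many more vertices than \<open>n1\<close> the excess would outgrow what \<open>n1\<close> vertices allow.\<close>

lemma turan_join_if_many_edges:
  assumes q: "1 \<le> q" and t: "1 \<le> t"
  shows "\<exists>n0. \<forall>V (N :: 'a \<Rightarrow> 'a set). sgraph V N \<longrightarrow> n0 \<le> card V \<longrightarrow> \<not> config N q t k \<longrightarrow>
    degree_target q (t - 1) (card V) \<le> int (\<Sum>v\<in>V. card (N v)) \<longrightarrow> turan_join V N (t - 1) q"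
proof -
  obtain n0 where n0: "\<And>V N. sgraph V (N :: 'a \<Rightarrow> 'a set) \<Longrightarrow> n0 \<le> card V \<Longrightarrow> \<not> config N q t k \<Longrightarrow>
    (\<forall>v\<in>V. card V \<le> card (N v) + 1 + (card V - t) div q) \<Longrightarrow>
    degree_target q (t - 1) (card V) \<le> int (\<Sum>v\<in>V. card (N v)) \<Longrightarrow> turan_join V N (t - 1) q"
    using turan_join_if_min_degree[OF q t, of k] by blast
  define n1 where "n1 = n0 + t"
  define T where "T = degree_target q (t - 1)"
  \<comment> \<open>A bound for the excess over the target that any graph on \<open>n1\<close>
    vertices can have.\<close>
  define E where "E = int (n1 * n1) + \<bar>T n1\<bar>"
  \<comment> \<open>The excess is negative, or the graph is extremal, or the excess is at most
    \<open>E - (n - n1)\<close>. Undoing a deletion lowers the excess by at least 2. An extremal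
    smaller graph has excess 0, so it leads to the first case; otherwise the first or third case
    persists. Once \<open>n - n1\<close> exceeds \<open>E\<close>, a nonnegative excess leaves only
    the second case.\<close>
  have main: "int (\<Sum>v\<in>V. card (N v)) < T n \<or> turan_join V N (t - 1) q \<or>
      int (\<Sum>v\<in>V. card (N v)) + int (n - n1) \<le> T n + E"
    if "n1 \<le> n" "sgraph V N" "card V = n" "\<not> config N q t k" for n V and N :: "'a \<Rightarrow> 'a set"
    using that
  proof (induction n arbitrary: V N rule: dec_induct)
    case base
    interpret sgraph V N by fact
    have "(\<Sum>v\<in>V. card (N v)) \<le> card V * card V"
      using sum_bounded_above[of V "\<lambda>v. card (N v)" "card V"] N_subset by (simp add: card_mono)
    then have "int (\<Sum>v\<in>V. card (N v)) \<le> int (n1 * n1)" using base by (simp only: of_nat_le_iff)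
    then show ?case using abs_ge_minus_self[of "T n1"] unfolding E_def by linarith
  next
    case (step n)
    interpret sgraph V N by fact
    show ?case
    proof (cases "\<forall>v\<in>V. card V \<le> card (N v) + 1 + (card V - t) div q")
      case True
      then show ?thesis using n0[OF step.prems(1) _ step.prems(3)] step by (auto simp: n1_def T_def not_less)
    next
      case False
      then obtain v where v: "v \<in> V" "card (N v) + 1 + (card V - t) div q < card V" by auto
      have "card (V - {v}) = n" using v(1) step.prems by simp
      moreover have "\<not> config (delete_vertex N v) q t k"
      proof
        assume "config (delete_vertex N v) q t k"
        moreover have "delete_vertex N v x \<subseteq> N x" for x by (auto simp: delete_vertex_def)
        ultimately show False using config_mono step.prems(3) by blast
      qed
      ultimately have IH: "int (\<Sum>x\<in>V - {v}. card (delete_vertex N v x)) < T n \<or>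
          turan_join (V - {v}) (delete_vertex N v) (t - 1) q \<or>
          int (\<Sum>x\<in>V - {v}. card (delete_vertex N v x)) + int (n - n1) \<le> T n + E"
        using step.IH sgraph_delete_vertex by blast
      have "turan_join (V - {v}) (delete_vertex N v) (t - 1) q \<Longrightarrow>
          int (\<Sum>x\<in>V - {v}. card (delete_vertex N v x)) = T n"
        using sgraph.turan_join_degree_sum[OF sgraph_delete_vertex] \<open>card (V - {v}) = n\<close>
        by (simp add: T_def)
      then have S': "int (\<Sum>x\<in>V - {v}. card (delete_vertex N v x)) \<le> T n \<or>
          int (\<Sum>x\<in>V - {v}. card (delete_vertex N v x)) + int (n - n1) \<le> T n + E"
        using IH by auto
      have "t - 1 \<le> n" using step.hyps by (simp add: n1_def)
      define m where "m = (n - (t - 1)) div q"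
      have T: "T (Suc n) = T n + 2 * (int n - int m)"
        using \<open>t - 1 \<le> n\<close> unfolding m_def T_def by (rule degree_target_Suc[OF q])
      have m: "(Suc n - t) div q = m"
        unfolding m_def using t step.hyps by (intro arg_cong2[of _ _ _ _ "(div)"] refl) (simp add: n1_def)
      have "card (N v) + m < n" using v(2) unfolding step.prems(2) m by simp
      then have "int (card (N v)) + 1 \<le> int n - int m" by linarith
      then have d: "T n + 2 * int (card (N v)) + 2 \<le> T (Suc n)" unfolding T by simp
      have S: "int (\<Sum>x\<in>V. card (N x)) = int (\<Sum>x\<in>V - {v}. card (delete_vertex N v x)) + 2 * int (card (N v))"
        using degree_sum_delete_vertex[OF v(1)] by simp
      have n: "int (Suc n - n1) = int (n - n1) + 1" using step.hyps by simp
      define S1 S2 where "S1 = int (\<Sum>v\<in>V. card (N v))"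
        and "S2 = int (\<Sum>x\<in>V - {v}. card (delete_vertex N v x))"
      note S = S[folded S1_def S2_def]
      from S'[folded S2_def] show ?thesis
      proof
        assume "S2 \<le> T n"
        then have "S1 < T (Suc n)" using d S by linarith
        then show ?thesis unfolding S1_def by blast
      next
        assume "S2 + int (n - n1) \<le> T n + E"
        then have "S1 + int (Suc n - n1) \<le> T (Suc n) + E"
          using d S n by linarith
        then show ?thesis unfolding S1_def by blast
      qed
    qed
  qed
  show ?thesis
  proof (intro exI[of _ "n1 + nat E + 1"] allI impI)
    fix V and N :: "'a \<Rightarrow> 'a set"
    assume V: "sgraph V N" "n1 + nat E + 1 \<le> card V" "\<not> config N q t k"
      "degree_target q (t - 1) (card V) \<le> int (\<Sum>v\<in>V. card (N v))"
    have "0 \<le> E" by (simp add: E_def)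
    then show "turan_join V N (t - 1) q" using main[OF _ V(1) refl V(3)] V(2,4) unfolding T_def by linarith
  qed
qed

section \<open>Powers of cycles\<close>

definition power_cycle :: "nat \<Rightarrow> nat \<Rightarrow> nat graph" where
  "power_cycle k p = graph_power (cycle_graph k) p"

abbreviation step_rel :: "nat \<Rightarrow> (nat \<times> nat) set" where
  "step_rel k \<equiv> {(x, y). {x, y} \<in> edges (cycle_graph k)}"

lemma step_rel_iff:
  assumes "1 \<le> k"
  shows "(x, y) \<in> step_rel k \<longleftrightarrow> x < k \<and> y < k \<and> (y = Suc x mod k \<or> x = Suc y mod k)"
  using assms by (auto simp: cycle_graph_def doubleton_eq_iff)

lemma graph_dist_le_iff:
  "graph_dist G u v \<le> enat p \<longleftrightarrow> (\<exists>l\<le>p. (u, v) \<in> {(x, y). {x, y} \<in> edges G} ^^ l)"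
proof -
  \<comment> \<open>A strict bound on an infimum unfolds to a witness by
    \<open>Inf_less_iff\<close>.\<close>
  have "graph_dist G u v \<le> enat p \<longleftrightarrow> graph_dist G u v < enat (Suc p)"
    by (cases "graph_dist G u v") auto
  also have "\<dots> \<longleftrightarrow> (\<exists>l\<le>p. (u, v) \<in> {(x, y). {x, y} \<in> edges G} ^^ l)"
    unfolding graph_dist_def Inf_less_iff by (auto simp: less_Suc_eq_le)
  finally show ?thesis .
qed

lemma step_rel_walk_offset:
  assumes "1 \<le> k" "u < k" "(u, v) \<in> step_rel k ^^ l"
  shows "\<exists>d. \<bar>d\<bar> \<le> int l \<and> int v = (int u + d) mod int k"
  using assms(3)
proof (induction l arbitrary: v)
  case 0
  then show ?case using assms(2) by (intro exI[of _ 0]) simp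
next
  case (Suc l)
  then obtain w where w: "(u, w) \<in> step_rel k ^^ l" "(w, v) \<in> step_rel k" by auto
  from Suc.IH[OF w(1)] obtain d where d: "\<bar>d\<bar> \<le> int l" "int w = (int u + d) mod int k" by auto
  have vw: "v < k" "w < k" and "v = Suc w mod k \<or> w = Suc v mod k"
    using w(2) unfolding step_rel_iff[OF assms(1)] by auto
  from this(3) show ?case
  proof
    assume "v = Suc w mod k"
    then have "int v = (int w + 1) mod int k" by (simp add: zmod_int add.commute)
    also have "\<dots> = (int u + (d + 1)) mod int k" unfolding d(2) by (simp add: mod_simps add.assoc)
    finally show ?thesis using d(1) by (intro exI[of _ "d + 1"]) auto
  next
    assume "w = Suc v mod k"
    then have "int w = (int v + 1) mod int k" by (simp add: zmod_int add.commute)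
    then have "(int w - 1) mod int k = int v mod int k" by (simp add: mod_simps)
    then have "int v = (int w - 1) mod int k" using vw by simp
    also have "\<dots> = (int u + (d - 1)) mod int k" unfolding d(2) by (simp add: mod_simps algebra_simps)
    finally show ?thesis using d(1) by (intro exI[of _ "d - 1"]) auto
  qed
qed

lemma step_rel_walk:
  assumes "1 \<le> k" "u < k"
  shows "(u, (u + l) mod k) \<in> step_rel k ^^ l" "((u + l) mod k, u) \<in> step_rel k ^^ l"
proof -
  have s: "((u + l) mod k, (u + Suc l) mod k) \<in> step_rel k"
    "((u + Suc l) mod k, (u + l) mod k) \<in> step_rel k" for l
    unfolding step_rel_iff[OF assms(1)] using assms(1) by (auto simp: mod_Suc_eq)
  show "(u, (u + l) mod k) \<in> step_rel k ^^ l"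
  proof (induction l)
    case (Suc l)
    then show ?case using s(1)[of l] by (rule relpow_Suc_I)
  qed (use assms in simp)
  show "((u + l) mod k, u) \<in> step_rel k ^^ l"
  proof (induction l)
    case (Suc l)
    show ?case using s(2)[of l] Suc by (rule relpow_Suc_I2)
  qed (use assms in simp)
qed

lemma verts_power_cycle: "verts (power_cycle k p) = {..<k}"
  by (simp add: power_cycle_def graph_power_def cycle_graph_def)

text \<open>The alternatives are the two ways around the cycle. A walk of length at most
  \<open>p\<close> has an integer displacement of absolute value below \<open>k\<close>, hence wraps
  around at most once.\<close>

lemma edges_power_cycle_iff:
  assumes "p < k" "u < v" "v < k"
  shows "{u, v} \<in> edges (power_cycle k p) \<longleftrightarrow> v \<le> u + p \<or> u + k \<le> v + p"
proof -
  have k: "1 \<le> k" using assms by simp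
  have walk: "(\<exists>l\<le>p. (x, y) \<in> step_rel k ^^ l) \<longleftrightarrow> (v \<le> u + p \<or> u + k \<le> v + p)"
    if xy: "(x, y) = (u, v) \<or> (x, y) = (v, u)" for x y
  proof
    assume "\<exists>l\<le>p. (x, y) \<in> step_rel k ^^ l"
    then obtain l where l: "l \<le> p" "(x, y) \<in> step_rel k ^^ l" by auto
    have xyk: "x < k" "y < k" using xy assms by auto
    then obtain d where d: "\<bar>d\<bar> \<le> int l" "int y = (int x + d) mod int k"
      using step_rel_walk_offset[OF k _ l(2)] xyk by blast
    define c where "c = (int x + d) div int k"
    have eq: "int x + d = c * int k + int y" unfolding c_def d(2) by (simp add: mult.commute)
    have lt: "\<bar>d\<bar> < int k" using d(1) l(1) assms(1) by simp
    have "c < 2"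
    proof (rule ccontr)
      assume "\<not> ?thesis"
      then have "2 * int k \<le> c * int k" by (intro mult_right_mono) auto
      then show False using eq lt xyk by linarith
    qed
    moreover have "- 2 < c"
    proof (rule ccontr)
      assume "\<not> ?thesis"
      then have "c * int k \<le> - 2 * int k" by (intro mult_right_mono) auto
      then show False using eq lt xyk by linarith
    qed
    ultimately have "c = 0 \<or> c = 1 \<or> c = -1" by linarith
    then show "v \<le> u + p \<or> u + k \<le> v + p" using xy d(1) l(1) assms eq by auto
  next
    assume "v \<le> u + p \<or> u + k \<le> v + p"
    then show "\<exists>l\<le>p. (x, y) \<in> step_rel k ^^ l"
    proof
      assume a: "v \<le> u + p"
      then have "(u + (v - u)) mod k = v" using assms by simp
      then show ?thesis using step_rel_walk[OF k, of u "v - u"] xy a assms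
        by (intro exI[of _ "v - u"]) auto
    next
      assume a: "u + k \<le> v + p"
      have "v + (u + k - v) = u + k" using assms by simp
      then have "(v + (u + k - v)) mod k = u" using assms by simp
      then show ?thesis using step_rel_walk[OF k, of v "u + k - v"] xy a assms
        by (intro exI[of _ "u + k - v"]) auto
    qed
  qed
  have "{u, v} \<in> edges (power_cycle k p) \<longleftrightarrow>
      (\<exists>x y. {u, v} = {x, y} \<and> x < k \<and> y < k \<and> x \<noteq> y \<and> graph_dist (cycle_graph k) x y \<le> enat p)"
    by (simp add: power_cycle_def graph_power_def cycle_graph_def)
  also have "\<dots> \<longleftrightarrow> (\<exists>x y. ((x, y) = (u, v) \<or> (x, y) = (v, u)) \<and> (\<exists>l\<le>p. (x, y) \<in> step_rel k ^^ l))"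
    using assms unfolding graph_dist_le_iff doubleton_eq_iff by (intro ex_cong1) auto
  also have "\<dots> \<longleftrightarrow> v \<le> u + p \<or> u + k \<le> v + p"
  proof
    assume "v \<le> u + p \<or> u + k \<le> v + p"
    then have "\<exists>l\<le>p. (u, v) \<in> step_rel k ^^ l" using walk[of u v] by simp
    then show "\<exists>x y. ((x, y) = (u, v) \<or> (x, y) = (v, u)) \<and> (\<exists>l\<le>p. (x, y) \<in> step_rel k ^^ l)"
      by blast
  qed (use walk in metis)
  finally show ?thesis .
qed

lemma edge_power_cycleE:
  assumes "e \<in> edges (power_cycle k p)"
  obtains u v where "e = {u, v}" "u < v" "v < k"
proof -
  obtain x y where "e = {x, y}" "x < k" "y < k" "x \<noteq> y"
    using assms by (auto simp: power_cycle_def graph_power_def cycle_graph_def)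
  then show ?thesis using that[of x y] that[of y x] by (cases "x < y") (auto simp: insert_commute)
qed

text \<open>The arcs \<open>i, \<dots>, i + p\<close> starting in an independent set are disjoint.\<close>

lemma independent_power_cycle:
  assumes "p < k" "I \<subseteq> {..<k}"
    and indep: "\<And>u v. u \<in> I \<Longrightarrow> v \<in> I \<Longrightarrow> {u, v} \<notin> edges (power_cycle k p)"
  shows "card I * (p + 1) \<le> k"
proof -
  have eq: "i = j \<and> a = b"
    if ij: "i \<in> I" "j \<in> I" "i \<le> j" "a \<le> p" "b \<le> p" "(i + a) mod k = (j + b) mod k" for i j a b
  proof -
    have lt: "i < k" "j < k" using ij assms(2) by auto
    have "i + a = j + b \<or> i + a + k = j + b \<or> i + a = j + b + k"
    proof -
      have m: "x mod k = (if x < k then x else x - k)" if "x < 2 * k" for x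
        using that by (auto simp: mod_if)
      show ?thesis using ij(6) m[of "i + a"] m[of "j + b"] lt ij assms(1) by (auto split: if_splits)
    qed
    moreover have "\<not> (j \<le> i + p \<or> i + k \<le> j + p)" if "i \<noteq> j"
      using indep[OF ij(1,2)] edges_power_cycle_iff[OF assms(1), of i j] that ij lt by auto
    ultimately show ?thesis using ij lt assms(1) by (cases "i = j") auto
  qed
  have "inj_on (\<lambda>(i, a). (i + a) mod k) (I \<times> {..p})"
  proof (rule inj_onI, clarify)
    fix i a j b assume "i \<in> I" "a \<le> p" "j \<in> I" "b \<le> p" "(i + a) mod k = (j + b) mod k"
    then show "i = j \<and> a = b" using eq[of i j a b] eq[of j i b a] by (cases "i \<le> j") auto
  qed
  moreover have "(\<lambda>(i, a). (i + a) mod k) ` (I \<times> {..p}) \<subseteq> {..<k}" using assms(1) by auto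
  ultimately have "card (I \<times> {..p}) \<le> card {..<k}" by (intro card_inj_on_le) auto
  then show ?thesis by (simp add: card_cartesian_product)
qed

text \<open>Cut the cycle into \<open>t\<close> blocks of length \<open>q + 1\<close> followed by \<open>s - t\<close> blocks of length \<open>q\<close> and
  colour every block \<open>0, 1, 2, \<dots>\<close>, except that a \<open>q\<close> is replaced by \<open>0\<close>. Only these recoloured
  vertices conflict, each with the start of the next block.\<close>

definition block_colour :: "nat \<Rightarrow> nat \<Rightarrow> nat \<Rightarrow> nat" where
  "block_colour q t x = (if x < t * (q + 1) then (if x mod (q + 1) = q then 0 else x mod (q + 1))
     else (x - t * (q + 1)) mod q)"

lemma block_colour_less: "1 \<le> q \<Longrightarrow> block_colour q t x < q"
  by (auto simp: block_colour_def less_Suc_eq_le dest: le_neq_implies_less)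
     (metis Suc_leI le_neq_implies_less less_Suc_eq_le mod_less_divisor zero_less_Suc)

text \<open>The cases distinguish long blocks (below \<open>X\<close>) from short ones. The second
  alternative of the conclusion occurs only when \<open>s = t\<close>: then the last long block
  closes the cycle and the next block starts at 0.\<close>

lemma block_colour_conflict:
  fixes k s q t p x y :: nat
  assumes k: "k = s * q + t" and t: "1 \<le> t" "t \<le> s" and p: "p < q"
    and xy: "x < y" "y < k" "y \<le> x + p \<or> x + k \<le> y + p"
    and col: "block_colour q t x = block_colour q t y"
  shows "\<exists>i<t. (x = i * (q + 1) + q \<and> y = Suc x) \<or> (x = 0 \<and> y = i * (q + 1) + q \<and> Suc y = k)"
proof -
  define Q X where "Q = q + 1" and "X = t * Q"
  obtain e where e: "s = t + e" using t(2) le_Suc_ex by blast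
  have kX: "k = X + e * q" unfolding k e X_def Q_def by (simp add: algebra_simps)
  have QX: "Q \<le> X" using t(1) unfolding X_def by (cases t) auto
  have low: "\<exists>i a. z = i * Q + a \<and> a \<le> q \<and> i < t \<and> block_colour q t z = (if a = q then 0 else a)"
    if "z < X" for z
  proof (intro exI conjI)
    show "z = z div Q * Q + z mod Q" by simp
    have "z mod Q < Q" by (simp add: Q_def)
    then show "z mod Q \<le> q" by (simp add: Q_def)
    show "z div Q < t" using that by (simp add: X_def less_mult_imp_div_less)
    show "block_colour q t z = (if z mod Q = q then 0 else z mod Q)"
      using that by (simp add: block_colour_def X_def Q_def)
  qed
  have high: "block_colour q t z = (z - X) mod q" if "X \<le> z" for z
    using that by (simp add: block_colour_def X_def Q_def not_less)
  consider "y < X" | "x < X" "X \<le> y" | "X \<le> x" using xy(1) by linarith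
  then show ?thesis
  proof cases
    case 1
    obtain i a where i: "x = i * Q + a" "a \<le> q" "i < t" "block_colour q t x = (if a = q then 0 else a)"
      using low[of x] 1 xy(1) by auto
    obtain j b where j: "y = j * Q + b" "b \<le> q" "j < t" "block_colour q t y = (if b = q then 0 else b)"
      using low[of y] 1 by auto
    have ab: "a = b \<or> (a = q \<and> b = 0) \<or> (a = 0 \<and> b = q)" using i(4) j(4) col by (auto split: if_splits)
    from xy(3) show ?thesis
    proof
      assume short: "y \<le> x + p"
      have "j < i + 2"
      proof (rule ccontr)
        assume "\<not> ?thesis"
        then have "(i + 2) * Q \<le> j * Q" by (intro mult_le_mono1) simp
        then have "i * Q + 2 * Q \<le> j * Q" by (simp add: algebra_simps)
        then show False using short i j p by (simp add: Q_def)
      qed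
      moreover have "i \<le> j"
      proof (rule ccontr)
        assume "\<not> ?thesis"
        then have "(j + 1) * Q \<le> i * Q" by (intro mult_le_mono1) simp
        then have "j * Q + Q \<le> i * Q" by (simp add: algebra_simps)
        then show False using xy(1) i j by (simp add: Q_def)
      qed
      ultimately consider "j = i" | "j = i + 1" by linarith
      then show ?thesis
      proof cases
        case 1
        then show ?thesis using ab i j short xy(1) p by auto
      next
        case 2
        then have "j * Q = i * Q + Q" by simp
        then have "a = q \<and> b = 0" using ab i(1) j(1) short p by (auto simp: Q_def)
        then show ?thesis using i j \<open>j * Q = i * Q + Q\<close>
          by (intro exI[of _ i]) (simp add: Q_def)
      qed
    next
      assume wrap: "x + k \<le> y + p"
      have "e = 0"
      proof (rule ccontr)
        assume "e \<noteq> 0"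
        then have "q \<le> e * q" by simp
        then show False using wrap kX 1 p by linarith
      qed
      then have kX: "k = X" using kX by simp
      have "x < p" using wrap kX 1 by linarith
      then have "i = 0"
        using i(1) p by (cases i) (auto simp: Q_def)
      have "t = Suc j"
      proof (rule ccontr)
        assume "t \<noteq> Suc j"
        then have "(j + 2) * Q \<le> X" unfolding X_def using j(3) by (intro mult_le_mono1) simp
        then have "j * Q + 2 * Q \<le> X" by (simp add: algebra_simps)
        then show False using wrap kX j p by (simp add: Q_def)
      qed
      then have "X = j * Q + Q" by (simp add: X_def)
      then have "a = 0 \<and> b = q" using ab wrap kX i(1) j(1) \<open>i = 0\<close> \<open>x < p\<close> p by (auto simp: Q_def)
      then show ?thesis using i j \<open>i = 0\<close> \<open>X = j * Q + Q\<close> kX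
        by (intro exI[of _ j]) (simp add: Q_def)
    qed
  next
    case 2
    obtain i a where i: "x = i * Q + a" "a \<le> q" "i < t" "block_colour q t x = (if a = q then 0 else a)"
      using low[of x] 2 by auto
    define c where "c = y - X"
    have y: "y = X + c" using 2 by (simp add: c_def)
    have cc: "block_colour q t y = c mod q" using high 2 by (simp add: c_def)
    from xy(3) show ?thesis
    proof
      assume short: "y \<le> x + p"
      have "t = Suc i"
      proof (rule ccontr)
        assume "t \<noteq> Suc i"
        then have "(i + 2) * Q \<le> X" unfolding X_def using i(3) by (intro mult_le_mono1) simp
        then have "i * Q + 2 * Q \<le> X" by (simp add: algebra_simps)
        then show False using short y i p by (simp add: Q_def)
      qed
      then have X: "X = i * Q + Q" by (simp add: X_def)
      then have "c < a" "c < q" using short y i p by (auto simp: Q_def)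
      then have "a = q" "c = 0" using cc i(4) col by (auto split: if_splits)
      then show ?thesis using i y X by (intro exI[of _ i]) (simp add: Q_def)
    next
      assume wrap: "x + k \<le> y + p"
      then have xp: "x < p" using xy(2) by linarith
      then have "i = 0" using i(1) p by (cases i) (auto simp: Q_def)
      then have cx: "block_colour q t x = x" using i xp p by auto
      define z where "z = k - y"
      have z: "1 \<le> z" "x + z \<le> p" "c + z = e * q" using wrap xy(2) kX y by (auto simp: z_def)
      have "(c + z) mod q = 0" using z(3) by simp
      moreover have "c mod q = x" using col cx cc by simp
      ultimately have "(x + z) mod q = 0" by (metis mod_add_left_eq)
      then show ?thesis using z p by simp
    qed
  next
    case 3
    define c d where "c = x - X" and "d = y - X"
    have cd: "x = X + c" "y = X + d" using 3 xy(1) by (auto simp: c_def d_def)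
    have "c mod q = d mod q" using high[of x] high[of y] 3 xy(1) col by (simp add: c_def d_def)
    from xy(3) show ?thesis
    proof
      assume "y \<le> x + p"
      then have "d - c < q" "c < d" using cd p xy(1) by auto
      moreover have "(d - c) mod q = 0" using \<open>c mod q = d mod q\<close> \<open>c < d\<close>
        by (metis less_imp_le mod_eq_dvd_iff_nat dvd_imp_mod_0)
      ultimately show ?thesis by simp
    next
      assume "x + k \<le> y + p"
      then show ?thesis using cd QX xy(2) p 3 by (simp add: Q_def)
    qed
  qed
qed

section \<open>Embedding the cycle power into a configuration\<close>

definition swap0 :: "nat \<Rightarrow> nat \<Rightarrow> nat" where
  "swap0 j0 j = (if j = 0 then j0 else if j = j0 then 0 else j)"

text \<open>Each conflicting pair of the block colouring is sent to a matching edge, all other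
  vertices to the class of their colour, with colours 0 and \<open>j0\<close> interchanged. The
  matched vertices belong to the class of colour 0, so adjacent vertices of different colours are
  adjacent there too.\<close>

lemma power_cycle_embeds_in_config:
  assumes sg: "sgraph V N" and conf: "config N q t k"
    and k: "k = s * q + t" and t: "1 \<le> t" "t \<le> s" and p: "p < q" and q: "2 \<le> q"
  shows "\<exists>\<phi>. inj_on \<phi> {..<k} \<and> \<phi> ` {..<k} \<subseteq> V \<and>
    (\<forall>x y. x < y \<longrightarrow> y < k \<longrightarrow> y \<le> x + p \<or> x + k \<le> y + p \<longrightarrow> \<phi> y \<in> N (\<phi> x))"
proof -
  interpret sgraph V N by fact
  from conf obtain C u w j0 where C: "blowup N q k C" and j0: "j0 < q" and uw: "inj_on u {..<t}" "inj_on w {..<t}"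
    "u ` {..<t} \<inter> w ` {..<t} = {}" "(u ` {..<t} \<union> w ` {..<t}) \<inter> C j0 = {}"
    and wu: "\<forall>i<t. w i \<in> N (u i)"
    and U: "\<forall>j<q. j \<noteq> j0 \<longrightarrow> (\<forall>x\<in>u ` {..<t} \<union> w ` {..<t}. C j \<subseteq> N x)"
    unfolding config_def by (elim exE conjE)
  have sw: "swap0 j0 j < q" "swap0 j0 j = j0 \<longleftrightarrow> j = 0" if "j < q" for j
    using that j0 q by (auto simp: swap0_def)
  have swinj: "swap0 j0 i = swap0 j0 j \<longleftrightarrow> i = j" for i j by (auto simp: swap0_def)
  \<comment> \<open>Classes of size \<open>k\<close> allow one bijection from all of
    \<open>{..<k}\<close> per colour, however many vertices have that colour.\<close>
  have "\<exists>e. bij_betw e {..<k} (C (swap0 j0 j))" if "j < q" for j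
    using C sw(1)[OF that] by (subst bij_betw_iff_card) (auto simp: blowup_def)
  then obtain e where e: "\<And>j. j < q \<Longrightarrow> bij_betw (e j) {..<k} (C (swap0 j0 j))" by metis
  define Cl where "Cl j = (if j = 0 then C j0 \<union> (u ` {..<t} \<union> w ` {..<t}) else C (swap0 j0 j))" for j
  have adj: "b \<in> N a" if ij: "i < q" "j < q" "i \<noteq> j" and ab: "a \<in> Cl i" "b \<in> Cl j" for i j a b
  proof -
    have *: "b \<in> N a" if ij: "i < q" "j < q" "i \<noteq> j" "j \<noteq> 0" and ab: "a \<in> Cl i" "b \<in> Cl j" for i j a b
    proof -
      have b: "b \<in> C (swap0 j0 j)" using ab(2) ij by (simp add: Cl_def)
      consider "a \<in> C (swap0 j0 i)" | "i = 0" "a \<in> u ` {..<t} \<union> w ` {..<t}"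
        using ab(1) by (auto simp: Cl_def swap0_def split: if_splits)
      then show ?thesis
      proof cases
        case 1
        then show ?thesis using C b ij sw(1)[OF ij(1)] sw(1)[OF ij(2)] swinj[of i j] unfolding blowup_def by blast
      next
        case 2
        then show ?thesis using U b sw[OF ij(2)] ij by blast
      qed
    qed
    show ?thesis
    proof (cases "j = 0")
      case True
      then have "a \<in> N b" using *[of j i b a] ij ab by simp
      then show ?thesis by (rule N_sym)
    qed (use * that in blast)
  qed
  \<comment> \<open>\<open>z i\<close> ends long block \<open>i\<close> and \<open>z' i\<close>
    starts the next block; \<open>mod k\<close> takes effect only if the last long block closes the
    cycle.\<close>
  define z z' where "z i = i * (q + 1) + q" and "z' i = Suc (z i) mod k" for i
  have zX: "Suc (z i) \<le> t * (q + 1)" if "i < t" for i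
  proof -
    have "(i + 1) * (q + 1) \<le> t * (q + 1)" using that by (intro mult_le_mono1) simp
    then show ?thesis by (simp add: z_def)
  qed
  have Xk: "t * (q + 1) \<le> k" using k t(2) by simp
  have kpos: "0 < k" using k t by simp
  have zk: "z i < k" "z' i < k" if "i < t" for i using zX[OF that] Xk kpos by (auto simp: z'_def)
  have zinj: "inj_on z {..<t}"
    by (rule inj_onI) (simp only: z_def add_right_cancel mult_cancel2, simp)
  have z'inj: "inj_on z' {..<t}"
  proof (rule inj_onI)
    fix i j assume ij: "i \<in> {..<t}" "j \<in> {..<t}" "z' i = z' j"
    have m: "Suc (z l) mod k = (if Suc (z l) = k then 0 else Suc (z l))" if "l < t" for l
      using zX[OF that] Xk by auto
    then have "z i = z j" using ij m[of i] m[of j] by (auto simp: z'_def split: if_splits)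
    then show "i = j" using zinj ij by (auto dest: inj_onD)
  qed
  have z'mod: "z' i = 0 \<or> z' i = Suc i * (q + 1)" if "i < t" for i
    using zX[OF that] Xk by (cases "Suc (z i) = k") (auto simp: z'_def z_def)
  have z'mod0: "z' i mod (q + 1) = 0" if "i < t" for i
    using z'mod[OF that] by (metis mod_0 mod_mult_self2_is_0)
  have zmod: "z i mod (q + 1) = q" for i unfolding z_def by (subst mod_mult_self3) simp
  have zz': "z i \<noteq> z' j" if "j < t" for i j
  proof
    assume "z i = z' j"
    then have "z i mod (q + 1) = 0" using z'mod0[OF that] by simp
    then show False using zmod[of i] q by simp
  qed
  have bcz: "block_colour q t (z i) = 0" if "i < t" for i
  proof -
    have "z i < t * (q + 1)" using zX[OF that] by simp
    then show ?thesis using zmod[of i] by (simp add: block_colour_def)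
  qed
  have bcz': "block_colour q t (z' i) = 0" if "i < t" for i
  proof -
    have "z' i mod (q + 1) = 0" by (rule z'mod0[OF that])
    moreover have "z' i \<le> t * (q + 1)" using zX[OF that] mod_less_eq_dividend[of "Suc (z i)" k]
      unfolding z'_def by linarith
    ultimately show ?thesis using q by (auto simp: block_colour_def)
  qed
  define \<phi> where "\<phi> x = (if x \<in> z ` {..<t} then u (inv_into {..<t} z x)
    else if x \<in> z' ` {..<t} then w (inv_into {..<t} z' x) else e (block_colour q t x) x)" for x
  have \<phi>z: "\<phi> (z i) = u i" "\<phi> (z' i) = w i" if "i < t" for i
    using that zz' inv_into_f_f[OF zinj, of i] inv_into_f_f[OF z'inj, of i]
    by (auto simp: \<phi>_def) (metis image_eqI lessThan_iff)+
  have bcq: "block_colour q t x < q" for x using block_colour_less[of q t x] q by simp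
  have \<phi>e: "\<phi> x = e (block_colour q t x) x" "\<phi> x \<in> C (swap0 j0 (block_colour q t x))"
    if "x < k" "x \<notin> z ` {..<t}" "x \<notin> z' ` {..<t}" for x
  proof -
    show "\<phi> x = e (block_colour q t x) x" using that by (simp add: \<phi>_def)
    then show "\<phi> x \<in> C (swap0 j0 (block_colour q t x))"
      using bij_betw_apply[OF e[OF bcq]] that by simp
  qed
  have kinds: "(\<exists>i<t. x = z i) \<or> (\<exists>i<t. x = z' i) \<or> (x \<notin> z ` {..<t} \<and> x \<notin> z' ` {..<t})" for x
    by auto
  have place: "\<phi> x \<in> Cl (block_colour q t x)" if "x < k" for x
    using kinds[of x]
  proof (elim disjE exE conjE)
    assume "x \<notin> z ` {..<t}" "x \<notin> z' ` {..<t}"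
    then show ?thesis using \<phi>e(2)[of x] that by (auto simp: Cl_def swap0_def)
  qed (auto simp: Cl_def \<phi>z bcz bcz')
  have inj: "inj_on \<phi> {..<k}"
  proof (rule inj_onI)
    fix x y assume xy: "x \<in> {..<k}" "y \<in> {..<k}" "\<phi> x = \<phi> y"
    have bc: "block_colour q t x = block_colour q t y"
    proof (rule ccontr)
      assume "block_colour q t x \<noteq> block_colour q t y"
      then have "\<phi> y \<in> N (\<phi> x)"
        by (rule adj[OF bcq bcq _ place place]) (use xy in auto)
      then show False using xy(3) by simp
    qed
    have *: "x = y" if x: "x \<in> {..<k}" and y: "y \<in> {..<k}" and eq: "\<phi> x = \<phi> y"
      and bc: "block_colour q t x = block_colour q t y" and yz: "y \<notin> z ` {..<t}" "y \<notin> z' ` {..<t}" for x y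
    proof -
      have y': "\<phi> y \<in> C (swap0 j0 (block_colour q t y))" using \<phi>e(2) y yz by simp
      show ?thesis
        using kinds[of x]
      proof (elim disjE exE conjE)
        fix i assume i: "i < t" "x = z i"
        then have "u i \<in> C j0" using y' eq bc bcz \<phi>z by (simp add: swap0_def)
        then show ?thesis using uw(4) i by blast
      next
        fix i assume i: "i < t" "x = z' i"
        then have "w i \<in> C j0" using y' eq bc bcz' \<phi>z by (simp add: swap0_def)
        then show ?thesis using uw(4) i by blast
      next
        assume "x \<notin> z ` {..<t}" "x \<notin> z' ` {..<t}"
        then have "e (block_colour q t x) x = e (block_colour q t x) y"
          using \<phi>e(1)[of x] \<phi>e(1)[of y] x y yz eq bc by simp
        then show ?thesis using bij_betw_imp_inj_on[OF e[OF bcq]] x y by (auto dest: inj_onD)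
      qed
    qed
    show "x = y"
      using kinds[of x]
    proof (elim disjE exE conjE)
      fix i assume i: "i < t" "x = z i"
      show ?thesis
        using kinds[of y]
      proof (elim disjE exE conjE)
        fix j assume j: "j < t" "y = z j"
        then have "u i = u j" using i xy(3) \<phi>z by simp
        then show ?thesis using uw(1) i j by (auto dest: inj_onD)
      next
        fix j assume j: "j < t" "y = z' j"
        then have "u i = w j" using i xy(3) \<phi>z by simp
        then show ?thesis using uw(3) i j by blast
      qed (use * xy bc in blast)
    next
      fix i assume i: "i < t" "x = z' i"
      show ?thesis
        using kinds[of y]
      proof (elim disjE exE conjE)
        fix j assume j: "j < t" "y = z' j"
        then have "w i = w j" using i xy(3) \<phi>z by simp
        then show ?thesis using uw(2) i j by (auto dest: inj_onD)
      next
        fix j assume j: "j < t" "y = z j"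
        then have "w i = u j" using i xy(3) \<phi>z by simp
        then show ?thesis using uw(3) i j by blast
      qed (use * xy bc in blast)
    next
      assume "x \<notin> z ` {..<t}" "x \<notin> z' ` {..<t}"
      then show ?thesis using *[of y x] xy bc by simp
    qed
  qed
  have edge: "\<phi> y \<in> N (\<phi> x)" if xy: "x < y" "y < k" "y \<le> x + p \<or> x + k \<le> y + p" for x y
  proof (cases "block_colour q t x = block_colour q t y")
    case False
    then show ?thesis using adj[OF bcq bcq _ place place] xy by simp
  next
    case True
    from block_colour_conflict[OF k t p xy True] obtain i where i: "i < t"
      "(x = z i \<and> y = z' i) \<or> (x = z' i \<and> y = z i)"
      using xy(2) by (auto simp: z_def z'_def)
    then show ?thesis using \<phi>z wu N_sym by auto
  qed
  \<comment> \<open>A configuration does not mention \<open>V\<close>; a vertex lies in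
    \<open>V\<close> because it has a neighbour, here one in a class of another colour, which exists
    as \<open>q\<close> is at least 2.\<close>
  have "\<phi> x \<in> V" if "x < k" for x
  proof -
    define j where "j = (if block_colour q t x = 0 then 1 else 0 :: nat)"
    have "card (C (swap0 j0 j)) = k" using C sw(1)[of j] q by (auto simp: blowup_def j_def)
    then obtain b where "b \<in> C (swap0 j0 j)" using kpos by fastforce
    then have "b \<in> Cl j" by (auto simp: Cl_def swap0_def j_def)
    then have "b \<in> N (\<phi> x)" using adj[OF bcq _ _ place[OF that], of j b] q by (auto simp: j_def)
    then show ?thesis using N_in_V by blast
  qed
  then show ?thesis using inj edge by (intro exI[of _ \<phi>]) auto
qed

section \<open>Edge sets and neighbourhood functions\<close>

definition nbh :: "'a graph \<Rightarrow> 'a \<Rightarrow> 'a set" where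
  "nbh G v = {u. {u, v} \<in> edges G}"

lemma sgraph_nbh:
  assumes "simple_graph G"
  shows "sgraph (verts G) (nbh G)"
proof
  show "finite (verts G)" using assms by (simp add: simple_graph_def)
  show "nbh G v \<subseteq> verts G" for v using assms by (force simp: simple_graph_def nbh_def)
  show "v \<in> nbh G u" if "u \<in> nbh G v" for u v using that by (simp add: nbh_def insert_commute)
  show "v \<notin> nbh G v" for v using assms by (force simp: simple_graph_def nbh_def)
qed

lemma sum_card_nbh:
  assumes G: "simple_graph G"
  shows "(\<Sum>v\<in>verts G. card (nbh G v)) = 2 * card (edges G)"
proof -
  have fin: "finite (verts G)" and E: "\<And>e. e \<in> edges G \<Longrightarrow> e \<subseteq> verts G \<and> card e = 2"
    using G by (auto simp: simple_graph_def)
  have finE: "finite (edges G)" using fin E by (meson PowI finite_Pow_iff finite_subset subsetI)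
  have "card (nbh G v) = card {e \<in> edges G. v \<in> e}" for v
  proof (rule bij_betw_same_card)
    show "bij_betw (\<lambda>u. {u, v}) (nbh G v) {e \<in> edges G. v \<in> e}"
      unfolding bij_betw_def
    proof
      show "inj_on (\<lambda>u. {u, v}) (nbh G v)" by (auto simp: inj_on_def doubleton_eq_iff)
      show "(\<lambda>u. {u, v}) ` nbh G v = {e \<in> edges G. v \<in> e}"
      proof (intro equalityI subsetI)
        fix e assume e: "e \<in> {e \<in> edges G. v \<in> e}"
        then obtain a b where "e = {a, b}" using E[of e] by (auto simp: card_2_iff)
        then have "e = {a, v} \<or> e = {b, v}" using e by auto
        then show "e \<in> (\<lambda>u. {u, v}) ` nbh G v" using e by (auto simp: nbh_def)
      qed (auto simp: nbh_def)
    qed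
  qed
  then have "(\<Sum>v\<in>verts G. card (nbh G v)) = (\<Sum>v\<in>verts G. card {e \<in> edges G. v \<in> e})" by simp
  also have "\<dots> = 2 * card (edges G)"
  proof (rule sum_multicount[OF fin finE], intro ballI)
    fix e assume e: "e \<in> edges G"
    then have "{v \<in> verts G. v \<in> e} = e" using E by auto
    then show "card {v \<in> verts G. v \<in> e} = 2" using E[OF e] by simp
  qed
  finally show ?thesis .
qed

lemma graph_iso_if_nbh:
  assumes G: "simple_graph G" and H: "simple_graph H" and f: "bij_betw f (verts G) (verts H)"
    and N: "\<And>x y. x \<in> verts G \<Longrightarrow> y \<in> verts G \<Longrightarrow> y \<in> nbh G x \<longleftrightarrow> f y \<in> nbh H (f x)"
  shows "graph_iso G H"
  unfolding graph_iso_def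
proof (intro exI[of _ f] conjI f equalityI subsetI)
  fix e assume e: "e \<in> edges H"
  then obtain a b where ab: "e = {a, b}" "a \<in> verts H" "b \<in> verts H"
    using H by (auto simp: simple_graph_def card_2_iff)
  then obtain x y where xy: "x \<in> verts G" "y \<in> verts G" "a = f x" "b = f y"
    using bij_betw_imp_surj_on[OF f] by blast
  then have "x \<in> nbh G y" using N[of y x] e ab by (simp add: nbh_def)
  then have "{x, y} \<in> edges G" by (simp add: nbh_def)
  moreover have "e = f ` {x, y}" using ab xy by simp
  ultimately show "e \<in> (\<lambda>e. f ` e) ` edges G" by blast
next
  fix e assume "e \<in> (\<lambda>e. f ` e) ` edges G"
  then obtain d where d: "d \<in> edges G" "e = f ` d" by blast
  then obtain x y where xy: "d = {x, y}" "x \<in> verts G" "y \<in> verts G"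
    using G by (auto simp: simple_graph_def card_2_iff)
  then show "e \<in> edges H" using N[of y x] d by (simp add: nbh_def)
qed

lemma graph_image:
  assumes F: "simple_graph F" and f: "inj_on f (verts F)"
  shows "simple_graph (f ` verts F, (\<lambda>e. f ` e) ` edges F)"
    and "graph_iso (f ` verts F, (\<lambda>e. f ` e) ` edges F) F"
proof -
  have E: "e \<subseteq> verts F" "card e = 2" if "e \<in> edges F" for e using F that by (auto simp: simple_graph_def)
  have "card (f ` e) = 2" if "e \<in> edges F" for e
    using E[OF that] inj_on_subset[OF f] by (simp add: card_image)
  then show "simple_graph (f ` verts F, (\<lambda>e. f ` e) ` edges F)"
    using F E by (force simp: simple_graph_def)
  let ?g = "inv_into (verts F) f"
  have "bij_betw ?g (f ` verts F) (verts F)"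
    using f by (simp add: bij_betw_inv_into bij_betw_def inj_on_inv_into inv_into_image_cancel)
  moreover have "?g ` f ` e = e" if "e \<in> edges F" for e
    using E(1)[OF that] f by (simp add: inv_into_image_cancel)
  then have "(\<lambda>e. ?g ` e) ` (\<lambda>e. f ` e) ` edges F = edges F"
    unfolding image_image by simp
  ultimately show "graph_iso (f ` verts F, (\<lambda>e. f ` e) ` edges F) F"
    unfolding graph_iso_def by (intro exI[of _ ?g]) simp
qed

lemma free_of_iff:
  assumes F: "simple_graph F"
  shows "free_of F G \<longleftrightarrow>
    \<not> (\<exists>f. inj_on f (verts F) \<and> f ` verts F \<subseteq> verts G \<and> (\<forall>e\<in>edges F. f ` e \<in> edges G))"
proof -
  have "(\<exists>H. subgraph H G \<and> graph_iso H F) \<longleftrightarrow>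
      (\<exists>f. inj_on f (verts F) \<and> f ` verts F \<subseteq> verts G \<and> (\<forall>e\<in>edges F. f ` e \<in> edges G))"
  proof
    assume "\<exists>H. subgraph H G \<and> graph_iso H F"
    then obtain H f where H: "subgraph H G" and f: "bij_betw f (verts H) (verts F)"
      and E: "edges F = (\<lambda>e. f ` e) ` edges H" unfolding graph_iso_def by blast
    let ?g = "inv_into (verts H) f"
    have g: "bij_betw ?g (verts F) (verts H)" using f by (rule bij_betw_inv_into)
    have "?g ` e \<in> edges G" if e: "e \<in> edges F" for e
    proof -
      from e obtain d where d: "d \<in> edges H" "e = f ` d" unfolding E by (rule imageE)
      have "d \<subseteq> verts H" using H d by (auto simp: subgraph_def simple_graph_def)
      then have "?g ` e = d" using f d by (simp add: bij_betw_def inv_into_image_cancel)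
      then show ?thesis using d H by (auto simp: subgraph_def)
    qed
    moreover have "?g ` verts F \<subseteq> verts G"
      using g H by (simp add: bij_betw_def subgraph_def)
    ultimately show "\<exists>f. inj_on f (verts F) \<and> f ` verts F \<subseteq> verts G \<and> (\<forall>e\<in>edges F. f ` e \<in> edges G)"
      using bij_betw_imp_inj_on[OF g] by blast
  next
    assume "\<exists>f. inj_on f (verts F) \<and> f ` verts F \<subseteq> verts G \<and> (\<forall>e\<in>edges F. f ` e \<in> edges G)"
    then obtain f where f: "inj_on f (verts F)" "f ` verts F \<subseteq> verts G" "\<forall>e\<in>edges F. f ` e \<in> edges G"
      by blast
    then have "subgraph (f ` verts F, (\<lambda>e. f ` e) ` edges F) G"
      using graph_image(1)[OF F f(1)] by (auto simp: subgraph_def)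
    then show "\<exists>H. subgraph H G \<and> graph_iso H F" using graph_image(2)[OF F f(1)] by blast
  qed
  then show ?thesis by (simp add: free_of_def)
qed

lemma simple_power_cycle: "simple_graph (power_cycle k p)"
  unfolding simple_graph_def
proof (intro conjI ballI)
  fix e assume "e \<in> edges (power_cycle k p)"
  then obtain u v where "e = {u, v}" "u < v" "v < k" by (rule edge_power_cycleE)
  then show "e \<subseteq> verts (power_cycle k p)" "card e = 2" by (auto simp: verts_power_cycle)
qed (simp add: verts_power_cycle)

lemma free_of_power_cycle_no_config:
  assumes G: "simple_graph G" and free: "free_of (power_cycle k p) G"
    and k: "k = s * q + t" "1 \<le> t" "t \<le> s" "p < q" "2 \<le> q"
  shows "\<not> config (nbh G) q t k"
proof
  assume "config (nbh G) q t k"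
  from power_cycle_embeds_in_config[OF sgraph_nbh[OF G] this k]
  obtain f where f: "inj_on f {..<k}" "f ` {..<k} \<subseteq> verts G"
    and adj: "\<And>x y. x < y \<Longrightarrow> y < k \<Longrightarrow> y \<le> x + p \<or> x + k \<le> y + p \<Longrightarrow> f y \<in> nbh G (f x)"
    by blast
  have "s * 1 \<le> s * q" using k by (intro mult_le_mono2) simp
  moreover have "1 * q \<le> s * q" using k by (intro mult_le_mono1) simp
  ultimately have pk: "p < k" using k by linarith
  have "f ` e \<in> edges G" if "e \<in> edges (power_cycle k p)" for e
  proof -
    obtain u v where uv: "e = {u, v}" "u < v" "v < k" using \<open>e \<in> _\<close> by (rule edge_power_cycleE)
    then have "f v \<in> nbh G (f u)" using that edges_power_cycle_iff[OF pk uv(2,3)] adj by simp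
    then show ?thesis using uv by (simp add: nbh_def insert_commute)
  qed
  then show False using free f unfolding free_of_iff[OF simple_power_cycle] verts_power_cycle by blast
qed

text \<open>A copy has at most \<open>t - 1\<close> vertices in the clique and at most
  \<open>s\<close> in each of the \<open>q\<close> independent parts, because \<open>s + 1\<close>
  disjoint arcs of \<open>p + 1\<close> vertices do not fit into the cycle. The total stays below
  \<open>s * q + t\<close>.\<close>

lemma turan_join_free_of_power_cycle:
  assumes G: "simple_graph G" and tj: "turan_join (verts G) (nbh G) (t - 1) q"
    and k: "k = s * q + t" "1 \<le> t" and p: "p < k" and s: "k < (s + 1) * (p + 1)"
  shows "free_of (power_cycle k p) G"
  unfolding free_of_iff[OF simple_power_cycle] verts_power_cycle
proof
  assume "\<exists>f. inj_on f {..<k} \<and> f ` {..<k} \<subseteq> verts G \<and> (\<forall>e\<in>edges (power_cycle k p). f ` e \<in> edges G)"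
  then obtain f where f: "inj_on f {..<k}" "f ` {..<k} \<subseteq> verts G"
    and E: "\<forall>e\<in>edges (power_cycle k p). f ` e \<in> edges G" by blast
  obtain col where col: "\<forall>x\<in>verts G. col x \<le> q" "card {x \<in> verts G. col x = q} = t - 1"
    "\<forall>x\<in>verts G. \<forall>y\<in>verts G. y \<in> nbh G x \<longleftrightarrow> x \<noteq> y \<and> (col x \<noteq> col y \<or> col x = q)"
    using tj unfolding turan_join_def by blast
  define I where "I j = {x. x < k \<and> col (f x) = j}" for j
  have small: "card (I j) \<le> s" if j: "j < q" for j
  proof -
    have "card (I j) * (p + 1) \<le> k"
    proof (rule independent_power_cycle[OF p])
      fix u v assume uv: "u \<in> I j" "v \<in> I j"
      show "{u, v} \<notin> edges (power_cycle k p)"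
      proof
        assume "{u, v} \<in> edges (power_cycle k p)"
        then have "f u \<in> nbh G (f v)" using E by (force simp: nbh_def)
        moreover have "f u \<in> verts G" "f v \<in> verts G" using uv f(2) by (auto simp: I_def)
        ultimately show False using col(3) uv j by (auto simp: I_def)
      qed
    qed (auto simp: I_def)
    then have "card (I j) * (p + 1) < (s + 1) * (p + 1)" using s by linarith
    then show ?thesis by (simp only: mult_less_cancel2) simp
  qed
  have "card (I q) \<le> card {x \<in> verts G. col x = q}"
  proof (rule card_inj_on_le[of f])
    show "inj_on f (I q)" using f(1) by (rule inj_on_subset) (auto simp: I_def)
    show "f ` I q \<subseteq> {x \<in> verts G. col x = q}" using f(2) by (auto simp: I_def)
    show "finite {x \<in> verts G. col x = q}" using G by (simp add: simple_graph_def)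
  qed
  then have "card (I q) \<le> t - 1" using col(2) by simp
  have "{..<k} \<subseteq> I q \<union> (\<Union>j<q. I j)"
  proof
    fix x assume "x \<in> {..<k}"
    then have "col (f x) \<le> q" "x < k" using col(1) f(2) by auto
    then show "x \<in> I q \<union> (\<Union>j<q. I j)" by (auto simp: I_def le_less)
  qed
  then have "card {..<k} \<le> card (I q \<union> (\<Union>j<q. I j))" by (intro card_mono) (auto simp: I_def)
  also have "\<dots> \<le> card (I q) + card (\<Union>j<q. I j)" by (rule card_Un_le)
  also have "card (\<Union>j<q. I j) \<le> (\<Sum>j<q. card (I j))" by (intro card_UN_le) simp
  also have "\<dots> \<le> q * s" using sum_bounded_above[of "{..<q}" "\<lambda>j. card (I j)" s] small by simp
  finally have "k \<le> (t - 1) + q * s" using \<open>card (I q) \<le> t - 1\<close> by simp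
  then show False using k by (simp add: mult.commute)
qed

section \<open>The extremal graph and the final comparison\<close>

abbreviation extremal_join :: "nat \<Rightarrow> nat \<Rightarrow> nat \<Rightarrow> (nat + nat) graph" where
  "extremal_join n t q \<equiv> graph_join (complete_graph (t - 1)) (turan_graph (n - t + 1) q)"

lemma nbh_graph_join:
  "Inl v \<in> nbh (graph_join G H) (Inl u) \<longleftrightarrow> v \<in> nbh G u"
  "Inr v \<in> nbh (graph_join G H) (Inr u) \<longleftrightarrow> v \<in> nbh H u"
  "Inr v \<in> nbh (graph_join G H) (Inl u) \<longleftrightarrow> u \<in> verts G \<and> v \<in> verts H"
  "Inl v \<in> nbh (graph_join G H) (Inr u) \<longleftrightarrow> v \<in> verts G \<and> u \<in> verts H"
proof -
  have l: "{Inl a, Inl b} = Inl ` e \<longleftrightarrow> e = {a, b}" for a b e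
    using inj_image_eq_iff[OF inj_Inl, of "{a, b}" e] by auto
  have r: "{Inr a, Inr b} = Inr ` e \<longleftrightarrow> e = {a, b}" for a b e
    using inj_image_eq_iff[OF inj_Inr, of "{a, b}" e] by auto
  have n: "{Inl a, x} \<noteq> Inr ` e" "{Inr b, x} \<noteq> Inl ` e" "{x, Inl a} \<noteq> Inr ` e" "{x, Inr b} \<noteq> Inl ` e"
    for a b x e by blast+
  show
    "Inl v \<in> nbh (graph_join G H) (Inl u) \<longleftrightarrow> v \<in> nbh G u"
    "Inr v \<in> nbh (graph_join G H) (Inr u) \<longleftrightarrow> v \<in> nbh H u"
    "Inr v \<in> nbh (graph_join G H) (Inl u) \<longleftrightarrow> u \<in> verts G \<and> v \<in> verts H"
    "Inl v \<in> nbh (graph_join G H) (Inr u) \<longleftrightarrow> v \<in> verts G \<and> u \<in> verts H"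
    by (simp_all add: nbh_def graph_join_def image_iff l r n) (simp_all add: doubleton_eq_iff)
qed

lemma verts_parts: "verts (complete_graph a) = {..<a}" "verts (turan_graph n q) = {..<n}"
  by (simp_all add: complete_graph_def turan_graph_def complete_multipartite_def)

lemma nbh_complete_graph: "v \<in> nbh (complete_graph a) u \<longleftrightarrow> u < a \<and> v < a \<and> u \<noteq> v"
  by (auto simp: nbh_def complete_graph_def doubleton_eq_iff)

lemma nbh_turan_graph: "v \<in> nbh (turan_graph n q) u \<longleftrightarrow> u < n \<and> v < n \<and> u mod q \<noteq> v mod q"
  by (auto simp: nbh_def turan_graph_def complete_multipartite_def doubleton_eq_iff)

lemma verts_extremal_join: "verts (extremal_join n t q) = {..<t - 1} <+> {..<n - t + 1}"
  by (simp add: graph_join_def complete_graph_def turan_graph_def complete_multipartite_def)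

lemma card_extremal_join:
  assumes "1 \<le> t" "t \<le> n"
  shows "card (verts (extremal_join n t q)) = n"
  unfolding verts_extremal_join using assms by (simp add: card_Plus)

lemma simple_graph_join:
  assumes "simple_graph G" "simple_graph H"
  shows "simple_graph (graph_join G H)"
  unfolding simple_graph_def
proof (intro conjI ballI)
  show "finite (verts (graph_join G H))" using assms by (simp add: graph_join_def simple_graph_def)
  fix e assume "e \<in> edges (graph_join G H)"
  then consider d where "d \<in> edges G" "e = Inl ` d" | d where "d \<in> edges H" "e = Inr ` d"
    | u v where "u \<in> verts G" "v \<in> verts H" "e = {Inl u, Inr v}"
    unfolding graph_join_def by auto
  then show "e \<subseteq> verts (graph_join G H)" "card e = 2"
    using assms by (cases; force simp: graph_join_def simple_graph_def card_image)+
qed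

lemma simple_complete_graph: "simple_graph (complete_graph a)"
  by (auto simp: simple_graph_def complete_graph_def)

lemma simple_turan_graph: "simple_graph (turan_graph n q)"
proof -
  have "card {u, v} = 2" if "u mod q \<noteq> v mod q" for u v
  proof -
    have "u \<noteq> v" using that by blast
    then show ?thesis by simp
  qed
  then show ?thesis by (auto simp: simple_graph_def turan_graph_def complete_multipartite_def)
qed

lemma turan_join_extremal_join:
  assumes "1 \<le> t" "t \<le> n" "1 \<le> q"
  shows "turan_join (verts (extremal_join n t q)) (nbh (extremal_join n t q)) (t - 1) q"
proof -
  define col where "col = case_sum (\<lambda>_::nat. q) (\<lambda>v. v mod q)"
  have "b mod q < q" for b using assms(3) by simp
  then have c: "col (Inl a) = q" "col (Inr b) = b mod q" "b mod q \<le> q" "b mod q \<noteq> q" for a b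
    by (auto simp: col_def less_imp_le less_imp_neq)
  have "{x \<in> {..<t - 1} <+> {..<n - t + 1}. col x = q} = Inl ` {..<t - 1}"
    by (auto simp: c c(4)[symmetric])
  then have cq: "card {x \<in> {..<t - 1} <+> {..<n - t + 1}. col x = q} = t - 1" by (simp add: card_image)
  have "{x \<in> {..<t - 1} <+> {..<n - t + 1}. col x = j} = Inr ` {v \<in> {..<n - t + 1}. v mod q = j}"
    if "j < q" for j using that by (auto simp: c(1,2))
  then have cj: "card {x \<in> {..<t - 1} <+> {..<n - t + 1}. col x = j} = turan_part q (n - t + 1) j"
    if "j < q" for j using card_mod_class[OF that, of "n - t + 1"] that by (simp add: card_image)
  have n: "card (verts (extremal_join n t q)) - (t - 1) = n - t + 1"
    using card_extremal_join[OF assms(1,2)] assms by simp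
  show ?thesis
    unfolding turan_join_def n unfolding verts_extremal_join
  proof (intro exI[of _ col] conjI ballI allI impI)
    fix x assume "x \<in> {..<t - 1} <+> {..<n - t + 1}"
    then show "col x \<le> q" by (auto simp: c)
  next
    fix x y assume "x \<in> {..<t - 1} <+> {..<n - t + 1}" "y \<in> {..<t - 1} <+> {..<n - t + 1}"
    then show "y \<in> nbh (extremal_join n t q) x \<longleftrightarrow> x \<noteq> y \<and> (col x \<noteq> col y \<or> col x = q)"
    proof (elim PlusE)
    qed (auto simp: nbh_graph_join nbh_complete_graph nbh_turan_graph verts_parts c c(4)[symmetric])
  qed (use cq cj in auto)
qed

lemma turan_join_graph_iso:
  assumes G: "simple_graph G" and H: "simple_graph H" and iso: "graph_iso G H"
    and tj: "turan_join (verts H) (nbh H) b q"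
  shows "turan_join (verts G) (nbh G) b q" "card (verts G) = card (verts H)"
proof -
  obtain f where f: "bij_betw f (verts G) (verts H)" and E: "edges H = (\<lambda>e. f ` e) ` edges G"
    using iso unfolding graph_iso_def by blast
  show card: "card (verts G) = card (verts H)" using f by (rule bij_betw_same_card)
  obtain col where col: "\<forall>x\<in>verts H. col x \<le> q" "card {x \<in> verts H. col x = q} = b"
    "\<forall>j<q. card {x \<in> verts H. col x = j} = turan_part q (card (verts H) - b) j"
    "\<forall>x\<in>verts H. \<forall>y\<in>verts H. y \<in> nbh H x \<longleftrightarrow> x \<noteq> y \<and> (col x \<noteq> col y \<or> col x = q)"
    using tj unfolding turan_join_def by blast
  have fV: "f x \<in> verts H" if "x \<in> verts G" for x using bij_betw_apply[OF f that] .
  have finj: "f x = f y \<longleftrightarrow> x = y" if "x \<in> verts G" "y \<in> verts G" for x y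
    using bij_betw_imp_inj_on[OF f] that by (auto simp: inj_on_def)
  have cc: "card {x \<in> verts G. col (f x) = j} = card {x \<in> verts H. col x = j}" for j
  proof (rule bij_betw_same_card[of f], unfold bij_betw_def, intro conjI)
    show "inj_on f {x \<in> verts G. col (f x) = j}" using finj by (auto simp: inj_on_def)
    show "f ` {x \<in> verts G. col (f x) = j} = {x \<in> verts H. col x = j}"
      using bij_betw_imp_surj_on[OF f] by auto
  qed
  have nb: "y \<in> nbh G x \<longleftrightarrow> f y \<in> nbh H (f x)" if xy: "x \<in> verts G" "y \<in> verts G" for x y
  proof
    assume "f y \<in> nbh H (f x)"
    then obtain e where e: "e \<in> edges G" "f ` {y, x} = f ` e" unfolding nbh_def E by auto
    have "e \<subseteq> verts G" using e G by (auto simp: simple_graph_def)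
    then have "{y, x} = e"
      using inj_on_image_eq_iff[OF bij_betw_imp_inj_on[OF f], of "{y, x}" e] e xy by auto
    then show "y \<in> nbh G x" using e by (simp add: nbh_def)
  next
    assume "y \<in> nbh G x"
    then have "f ` {y, x} \<in> edges H" unfolding nbh_def E by blast
    then show "f y \<in> nbh H (f x)" by (simp add: nbh_def)
  qed
  show "turan_join (verts G) (nbh G) b q"
    unfolding turan_join_def
  proof (intro exI[of _ "col \<circ> f"] conjI ballI allI impI)
    fix x assume "x \<in> verts G"
    then show "(col \<circ> f) x \<le> q" using col(1) fV by simp
  next
    fix x y assume "x \<in> verts G" "y \<in> verts G"
    then show "y \<in> nbh G x \<longleftrightarrow> x \<noteq> y \<and> ((col \<circ> f) x \<noteq> (col \<circ> f) y \<or> (col \<circ> f) x = q)"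
      using nb col(4) fV finj by simp
  qed (use cc col card in simp_all)
qed

theorem theorem1p1:
  fixes k p s r m t :: nat
  assumes "k \<ge> 1" and "p \<ge> 1" and "k \<ge> 2 * p + 1"
    and "k = s * (p + 1) + r" and "s \<ge> 1" and "r < p + 1"
    and "r \<noteq> 0"
    and "r = m * s + t" and "1 \<le> t" and "t \<le> s"
  shows "\<exists>N. \<forall>n\<ge>N.
    extremal_graphs n (graph_power (cycle_graph k) p) =
      {G. simple_graph G \<and>
          graph_iso G (graph_join (complete_graph (t - 1)) (turan_graph (n - t + 1) (p + m + 1)))}"
proof -
  define q where "q = p + m + 1"
  \<comment> \<open>s (p + 1) + (m s + t) = s (p + m + 1) + t.\<close>
  have k: "k = s * q + t" using assms by (simp add: q_def algebra_simps)
  have q: "1 \<le> q" "2 \<le> q" "p < q" using assms by (auto simp: q_def)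
  have pk: "p < k" using assms by simp
  have ks: "k < (s + 1) * (p + 1)" using assms by simp
  obtain n0 where n0: "\<And>V N. sgraph V (N :: nat \<Rightarrow> nat set) \<Longrightarrow> n0 \<le> card V \<Longrightarrow> \<not> config N q t k \<Longrightarrow>
    degree_target q (t - 1) (card V) \<le> int (\<Sum>v\<in>V. card (N v)) \<Longrightarrow> turan_join V N (t - 1) q"
    using turan_join_if_many_edges[OF q(1) assms(9), of k] by blast
  show ?thesis
    unfolding power_cycle_def[symmetric] q_def[symmetric]
  proof (intro exI[of _ "n0 + t"] allI impI)
    fix n assume n: "n0 + t \<le> n"
    then have tn: "t \<le> n" by simp
    let ?H = "extremal_join n t q"
    define h where "h = degree_target q (t - 1) n"
    have H: "turan_join (verts ?H) (nbh ?H) (t - 1) q" "simple_graph ?H" "card (verts ?H) = n"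
      using turan_join_extremal_join card_extremal_join assms(9) tn q(1)
        simple_graph_join[OF simple_complete_graph simple_turan_graph] by auto
    have edges_H: "int (2 * card (edges G)) = h"
      if "simple_graph G" "turan_join (verts G) (nbh G) (t - 1) q" "card (verts G) = n" for G :: "nat graph"
      using sgraph.turan_join_degree_sum[OF sgraph_nbh[OF that(1)] that(2)] sum_card_nbh[OF that(1)] that(3)
      by (simp add: h_def)
    have iso_free: "G \<in> free_graphs n (power_cycle k p)" "int (2 * card (edges G)) = h"
      if G: "simple_graph G" "graph_iso G ?H" for G :: "nat graph"
    proof -
      note tj = turan_join_graph_iso[OF G(1) H(2) G(2) H(1)]
      show "int (2 * card (edges G)) = h" using edges_H[OF G(1) tj(1)] tj(2) H(3) by simp
      show "G \<in> free_graphs n (power_cycle k p)"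
        using turan_join_free_of_power_cycle[OF G(1) tj(1) k assms(9) pk ks] G(1) tj(2) H(3)
        by (simp add: free_graphs_def)
    qed
    \<comment> \<open>Applies to every free graph with at least as many edges as the join, so it
      serves the upper bound (\<open>upper\<close>) as well as uniqueness.\<close>
    have dense: "turan_join (verts G) (nbh G) (t - 1) q" "graph_iso G ?H"
      if G: "G \<in> free_graphs n (power_cycle k p)" and h: "h \<le> int (2 * card (edges G))" for G
    proof -
      have G': "simple_graph G" "card (verts G) = n" "free_of (power_cycle k p) G"
        using G by (auto simp: free_graphs_def)
      show tj: "turan_join (verts G) (nbh G) (t - 1) q"
      proof (rule n0[OF sgraph_nbh[OF G'(1)]])
        show "\<not> config (nbh G) q t k"
          using free_of_power_cycle_no_config[OF G'(1,3) k assms(9,10) q(3,2)] .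
      qed (use n G' h sum_card_nbh[OF G'(1)] in \<open>simp_all add: h_def\<close>)
      obtain f where "bij_betw f (verts G) (verts ?H)"
        "\<forall>x\<in>verts G. \<forall>y\<in>verts G. y \<in> nbh G x \<longleftrightarrow> f y \<in> nbh ?H (f x)"
        using turan_join_iso[OF _ tj _ H(1)] G' H(2,3) by (auto simp: simple_graph_def)
      then show "graph_iso G ?H" using graph_iso_if_nbh[OF G'(1) H(2)] by blast
    qed
    have upper: "int (2 * card (edges G)) \<le> h" if G: "G \<in> free_graphs n (power_cycle k p)" for G
    proof (rule ccontr)
      assume n: "\<not> ?thesis"
      then have "turan_join (verts G) (nbh G) (t - 1) q" using dense(1)[OF G] by simp
      then show False using edges_H[of G] G n by (simp add: free_graphs_def)
    qed
    \<comment> \<open>The join has vertices in \<open>nat + nat\<close>; this copy on naturals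
      attains the maximum.\<close>
    define G0 where "G0 = ((to_nat :: nat + nat \<Rightarrow> nat) ` verts ?H, (\<lambda>e. to_nat ` e) ` edges ?H)"
    have "inj_on (to_nat :: nat + nat \<Rightarrow> nat) (verts ?H)" using inj_to_nat by (rule inj_on_subset) simp
    from graph_image[OF H(2) this] have G0: "simple_graph G0" "graph_iso G0 ?H" by (simp_all add: G0_def)
    have "ex_number n (power_cycle k p) = card (edges G0)"
      unfolding ex_number_def
    proof (rule Max_eqI)
      have le: "card (edges G) \<le> card (edges G0)" if "G \<in> free_graphs n (power_cycle k p)" for G
        using upper[OF that] iso_free(2)[OF G0] by simp
      \<comment> \<open>\<open>Max\<close> needs finiteness: the free graphs range over infinitely
        many vertex sets, but their edge numbers are bounded.\<close>
      then have "(\<lambda>G. card (edges G)) ` free_graphs n (power_cycle k p) \<subseteq> {..card (edges G0)}" by auto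
      then show "finite ((\<lambda>G. card (edges G)) ` free_graphs n (power_cycle k p))"
        by (rule finite_subset) simp
      show "y \<le> card (edges G0)" if "y \<in> (\<lambda>G. card (edges G)) ` free_graphs n (power_cycle k p)" for y
        using that le by auto
      show "card (edges G0) \<in> (\<lambda>G. card (edges G)) ` free_graphs n (power_cycle k p)"
        using iso_free(1)[OF G0] by blast
    qed
    then have ex: "int (2 * ex_number n (power_cycle k p)) = h" using iso_free(2)[OF G0] by simp
    show "extremal_graphs n (power_cycle k p) = {G. simple_graph G \<and> graph_iso G ?H}"
    proof (intro equalityI subsetI)
      fix G assume "G \<in> extremal_graphs n (power_cycle k p)"
      then have G: "G \<in> free_graphs n (power_cycle k p)" "card (edges G) = ex_number n (power_cycle k p)"
        by (auto simp: extremal_graphs_def)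
      then have "graph_iso G ?H" using dense(2)[OF G(1)] ex by simp
      then show "G \<in> {G. simple_graph G \<and> graph_iso G ?H}" using G(1) by (simp add: free_graphs_def)
    next
      fix G :: "nat graph"
      assume "G \<in> {G. simple_graph G \<and> graph_iso G ?H}"
      then have G: "simple_graph G" "graph_iso G ?H" by auto
      then show "G \<in> extremal_graphs n (power_cycle k p)"
        using iso_free[OF G] ex by (simp add: extremal_graphs_def)
    qed
  qed
qed

end
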